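(* Let $(K,\nu)$ be a valued field of arbitrary rank with valuation ring $R_\nu$, maximal ideal $M_\nu$, residue field $k_\nu$ and value group $\Gamma_\nu$. Let $f\in R_\nu[X]$ be a monic irreducible separable polynomial, $\alpha$ a root of $f$ in an algebraic closure of $K$, and $L=K(\alpha)$. Let $\overline{f}=\prod_{i=1}^s \overline{\phi_i}^{\,l_i}$ be the factorization of $\overline{f}$ into powers of distinct monic irreducible polynomials over $k_\nu$, and let $\phi_i\in R_\nu[X]$ be a monic lifting of $\overline{\phi_i}$. Let $I=\{i\in\{1,\dots,s\}: l_i\ge 2\}$. The following are equivalent: (i) $R_\nu[\alpha]$ is integrally closed; (ii) $\nu$ has exactly $s$ distinct extensions to $L$, and, if $I\neq\emptyset$, then $\Gamma_\nu^+$ has a minimum element and for every $i\in I$ and every valuation $\omega$ of $L$ extending $\nu$ with $\omega(\phi_i(\alpha))>0$, one has $l_i\,\omega(\phi_i(\alpha))=\min(\Gamma_\nu^+)$.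
   Context: $\Gamma_\nu^+=\{g\in\Gamma_\nu: g>0\}$. Bars denote reduction modulo $M_\nu$. $\Gamma_\nu$ is regarded as a subgroup of the value group of any extension of $\nu$ to $L$. "Integrally closed" means $R_\nu[\alpha]$ equals the integral closure of $R_\nu$ in $L$. *)

theory Defs
  imports
    "HOL-Algebra.Algebraic_Closure_Type"
    "HOL-Library.Extended"
    "HOL-Library.FuncSet"
begin

primrec nmul :: "nat \<Rightarrow> 'a::comm_monoid_add \<Rightarrow> 'a" where
  "nmul 0 a = 0"
| "nmul (Suc n) a = a + nmul n a"

lemma nmul_one [simp]: "nmul (Suc 0) a = a"
  by simp

lemma nmul_zero [simp]: "nmul n 0 = 0"
  by (induction n) simp_all

lemma nmul_add: "nmul (m + n) a = nmul m a + nmul n a"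
  by (induction m) (simp_all add: add.assoc)

lemma nmul_plus: "nmul n (a + b) = nmul n a + nmul n b"
  by (induction n) (simp_all add: ac_simps)

lemma nmul_mult: "nmul (m * n) a = nmul m (nmul n a)"
  by (induction m) (simp_all add: nmul_add)

lemma nmul_comm: "nmul m (nmul n a) = nmul n (nmul m a)"
  by (metis mult.commute nmul_mult)

lemma nmul_uminus: "nmul n (- a) = - nmul n (a :: 'a::ab_group_add)"
  by (induction n) simp_all

lemma nmul_strict_mono:
  fixes a b :: "'a::linordered_ab_group_add"
  assumes "0 < n" "a < b"
  shows "nmul n a < nmul n b"
  using assms(1)
proof (induction n)
  case (Suc n)
  then show ?case
    using assms(2) by (cases n) (auto intro: add_strict_mono)
qed simp

lemma nmul_le_iff [simp]:
  fixes a b :: "'a::linordered_ab_group_add"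
  assumes "0 < n"
  shows "nmul n a \<le> nmul n b \<longleftrightarrow> a \<le> b"
  by (metis assms nmul_strict_mono linorder_not_le order_le_less)

lemma nmul_eq_iff [simp]:
  fixes a b :: "'a::linordered_ab_group_add"
  assumes "0 < n"
  shows "nmul n a = nmul n b \<longleftrightarrow> a = b"
  by (metis assms antisym nmul_le_iff order_refl)


text \<open>
  The divisible hull of a linearly ordered abelian group: the pair \<open>(a, n)\<close> stands for \<open>a / n\<close>.
  Every extension of a valuation to an algebraic field extension takes its values, up to a unique
  order isomorphism over the original value group, in the divisible hull of that group;
  \<open>extension_normal_form\<close> below proves this.
\<close>

definition hull_rel :: "'a::linordered_ab_group_add \<times> nat \<Rightarrow> 'a \<times> nat \<Rightarrow> bool" where
  "hull_rel p q \<longleftrightarrow> 0 < snd p \<and> 0 < snd q \<and> nmul (snd q) (fst p) = nmul (snd p) (fst q)"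

lemma nmul_swap:
  assumes "nmul m' a = nmul m a'"
  shows "nmul (m' * k') (nmul k a) = nmul (m * k) (nmul k' a')"
proof -
  have "nmul (m' * k') (nmul k a) = nmul (k' * k) (nmul m' a)"
    by (simp add: ac_simps flip: nmul_mult)
  also have "\<dots> = nmul (m * k) (nmul k' a')"
    by (simp add: assms ac_simps flip: nmul_mult)
  finally show ?thesis .
qed

lemma hull_rel_part_equivp:
  "part_equivp (hull_rel :: 'a::linordered_ab_group_add \<times> nat \<Rightarrow> 'a \<times> nat \<Rightarrow> bool)"
proof (rule part_equivpI)
  show "\<exists>x :: 'a \<times> nat. hull_rel x x"
    by (rule exI[of _ "(0, 1)"]) (simp add: hull_rel_def)
  show "symp (hull_rel :: 'a \<times> nat \<Rightarrow> _)"
    by (auto simp: symp_def hull_rel_def)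
  show "transp (hull_rel :: 'a \<times> nat \<Rightarrow> _)"
  proof (rule transpI)
    fix p q r :: "'a \<times> nat"
    assume "hull_rel p q" "hull_rel q r"
    then have pos: "0 < snd p" "0 < snd q" "0 < snd r"
      and eqs: "nmul (snd q) (fst p) = nmul (snd p) (fst q)"
        "nmul (snd r) (fst q) = nmul (snd q) (fst r)"
      by (auto simp: hull_rel_def)
    have "nmul (snd q) (nmul (snd r) (fst p)) = nmul (snd q) (nmul (snd p) (fst r))"
      by (metis eqs nmul_comm)
    then show "hull_rel p r"
      using pos by (simp add: hull_rel_def)
  qed
qed

quotient_type (overloaded) 'a div_hull = "'a::linordered_ab_group_add \<times> nat" / partial: hull_rel
  by (rule hull_rel_part_equivp)

instantiation div_hull :: (linordered_ab_group_add) linordered_ab_group_add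
begin

lift_definition zero_div_hull :: "'a div_hull" is "(0, 1)"
  by (simp add: hull_rel_def)

lift_definition plus_div_hull :: "'a div_hull \<Rightarrow> 'a div_hull \<Rightarrow> 'a div_hull"
  is "\<lambda>p q. (nmul (snd q) (fst p) + nmul (snd p) (fst q), snd p * snd q)"
proof -
  fix p p' q q' :: "'a \<times> nat"
  assume "hull_rel p p'" "hull_rel q q'"
  then have e: "nmul (snd p') (fst p) = nmul (snd p) (fst p')"
      "nmul (snd q') (fst q) = nmul (snd q) (fst q')"
    and pos: "0 < snd p" "0 < snd q" "0 < snd p'" "0 < snd q'"
    by (auto simp: hull_rel_def)
  have "nmul (snd p' * snd q') (nmul (snd q) (fst p)) = nmul (snd p * snd q) (nmul (snd q') (fst p'))"
    by (rule nmul_swap) (rule e)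
  moreover have "nmul (snd p' * snd q') (nmul (snd p) (fst q)) = nmul (snd p * snd q) (nmul (snd p') (fst q'))"
    unfolding mult.commute[of "snd p'"] mult.commute[of "snd p"]
    by (rule nmul_swap) (rule e)
  ultimately show "hull_rel (nmul (snd q) (fst p) + nmul (snd p) (fst q), snd p * snd q)
      (nmul (snd q') (fst p') + nmul (snd p') (fst q'), snd p' * snd q')"
    using pos by (simp add: hull_rel_def nmul_plus)
qed

lift_definition uminus_div_hull :: "'a div_hull \<Rightarrow> 'a div_hull" is "\<lambda>p. (- fst p, snd p)"
  by (auto simp: hull_rel_def nmul_uminus)

definition minus_div_hull :: "'a div_hull \<Rightarrow> 'a div_hull \<Rightarrow> 'a div_hull" where
  "minus_div_hull x y = x + - y"

lift_definition less_eq_div_hull :: "'a div_hull \<Rightarrow> 'a div_hull \<Rightarrow> bool"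
  is "\<lambda>p q. nmul (snd q) (fst p) \<le> nmul (snd p) (fst q)"
proof -
  fix p p' q q' :: "'a \<times> nat"
  assume "hull_rel p p'" "hull_rel q q'"
  then have e: "nmul (snd p') (fst p) = nmul (snd p) (fst p')"
      "nmul (snd q') (fst q) = nmul (snd q) (fst q')"
    and pos: "0 < snd p" "0 < snd q" "0 < snd p'" "0 < snd q'"
    by (auto simp: hull_rel_def)
  have "nmul (snd q) (fst p) \<le> nmul (snd p) (fst q) \<longleftrightarrow>
      nmul (snd p' * snd q') (nmul (snd q) (fst p)) \<le> nmul (snd p' * snd q') (nmul (snd p) (fst q))"
    using pos by simp
  also have "nmul (snd p' * snd q') (nmul (snd q) (fst p)) = nmul (snd p * snd q) (nmul (snd q') (fst p'))"
    by (rule nmul_swap) (rule e)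
  also have "nmul (snd p' * snd q') (nmul (snd p) (fst q)) = nmul (snd p * snd q) (nmul (snd p') (fst q'))"
    unfolding mult.commute[of "snd p'"] mult.commute[of "snd p"]
    by (rule nmul_swap) (rule e)
  finally show "nmul (snd q) (fst p) \<le> nmul (snd p) (fst q) \<longleftrightarrow>
      nmul (snd q') (fst p') \<le> nmul (snd p') (fst q')"
    using pos by simp
qed

definition less_div_hull :: "'a div_hull \<Rightarrow> 'a div_hull \<Rightarrow> bool" where
  "less_div_hull x y \<longleftrightarrow> x \<le> y \<and> \<not> y \<le> x"

instance
proof
  fix a b c :: "'a div_hull"
  show "a + b + c = a + (b + c)"
    by transfer (auto simp: hull_rel_def nmul_plus ac_simps simp flip: nmul_mult)
  show "a + b = b + a"
    by transfer (auto simp: hull_rel_def ac_simps)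
  show "0 + a = a"
    by transfer (auto simp: hull_rel_def)
  show "- a + a = 0"
    by transfer (auto simp: hull_rel_def nmul_uminus)
  show "a - b = a + - b"
    by (simp add: minus_div_hull_def)
  show "a < b \<longleftrightarrow> a \<le> b \<and> \<not> b \<le> a"
    by (simp add: less_div_hull_def)
  show "a \<le> a"
    by transfer simp
  show "a \<le> c" if "a \<le> b" "b \<le> c"
    using that
  proof transfer
    fix p q r :: "'a \<times> nat"
    assume "hull_rel p p" "hull_rel q q" "hull_rel r r"
    then have pos: "0 < snd p" "0 < snd q" "0 < snd r"
      by (auto simp: hull_rel_def)
    assume "nmul (snd q) (fst p) \<le> nmul (snd p) (fst q)"
      and "nmul (snd r) (fst q) \<le> nmul (snd q) (fst r)"
    then have "nmul (snd r) (nmul (snd q) (fst p)) \<le> nmul (snd r) (nmul (snd p) (fst q))"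
      and "nmul (snd p) (nmul (snd r) (fst q)) \<le> nmul (snd p) (nmul (snd q) (fst r))"
      using pos by simp_all
    then have "nmul (snd q) (nmul (snd r) (fst p)) \<le> nmul (snd q) (nmul (snd p) (fst r))"
      unfolding nmul_comm[of "snd q" "snd r"] nmul_comm[of "snd q" "snd p"]
      by (simp only: nmul_comm[of "snd r" "snd p"])
    then show "nmul (snd r) (fst p) \<le> nmul (snd p) (fst r)"
      using pos by simp
  qed
  show "a = b" if "a \<le> b" "b \<le> a"
    using that by transfer (auto simp: hull_rel_def)
  show "a \<le> b \<or> b \<le> a"
    by transfer auto
  show "c + a \<le> c + b" if "a \<le> b"
    using that
  proof transfer
    fix p q r :: "'a \<times> nat"
    assume "hull_rel p p" "hull_rel q q" "hull_rel r r"
    then have pos: "0 < snd p" "0 < snd q" "0 < snd r"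
      by (auto simp: hull_rel_def)
    assume "nmul (snd q) (fst p) \<le> nmul (snd p) (fst q)"
    then have "nmul (snd r * snd r) (nmul (snd q) (fst p)) \<le> nmul (snd r * snd r) (nmul (snd p) (fst q))"
      using pos by simp
    then show "nmul (snd (nmul (snd q) (fst r) + nmul (snd r) (fst q), snd r * snd q))
        (fst (nmul (snd p) (fst r) + nmul (snd r) (fst p), snd r * snd p))
      \<le> nmul (snd (nmul (snd p) (fst r) + nmul (snd r) (fst p), snd r * snd p))
        (fst (nmul (snd q) (fst r) + nmul (snd r) (fst q), snd r * snd q))"
      by (simp add: nmul_plus ac_simps flip: nmul_mult)
  qed
qed

end

lift_definition to_hull :: "'a::linordered_ab_group_add \<Rightarrow> 'a div_hull" is "\<lambda>a. (a, 1)"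
  by (simp add: hull_rel_def)

lemma to_hull_add: "to_hull (a + b) = to_hull a + to_hull b"
  by transfer (simp add: hull_rel_def)

lemma to_hull_zero [simp]: "to_hull 0 = 0"
  by transfer (simp add: hull_rel_def)

lemma to_hull_le_iff [simp]: "to_hull a \<le> to_hull b \<longleftrightarrow> a \<le> b"
  by transfer simp

lemma to_hull_eq_iff [simp]: "to_hull a = to_hull b \<longleftrightarrow> a = b"
  by (metis antisym to_hull_le_iff order_refl)

lemma to_hull_nmul: "to_hull (nmul n a) = nmul n (to_hull a)"
  by (induction n) (simp_all add: to_hull_add)

lift_definition hull_frac :: "'a::linordered_ab_group_add \<Rightarrow> nat \<Rightarrow> 'a div_hull" is "\<lambda>a n. (a, Suc n)"
  by (simp add: hull_rel_def)

lemma hull_frac_add: "hull_frac a n + hull_frac b n = hull_frac (a + b) n"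
  by transfer (simp add: hull_rel_def nmul_plus nmul_mult del: nmul.simps mult_Suc mult_Suc_right)

lemma hull_frac_zero: "hull_frac 0 n = 0"
  by transfer (simp add: hull_rel_def)

lemma nmul_hull_frac: "nmul k (hull_frac a n) = hull_frac (nmul k a) n"
  by (induction k) (simp_all add: hull_frac_zero hull_frac_add)

lemma to_hull_divisible:
  assumes "0 < n"
  obtains z where "nmul n z = to_hull a"
proof -
  obtain m where n: "n = Suc m"
    using assms by (cases n) auto
  have "hull_frac (nmul (Suc m) a) m = to_hull a"
    by transfer (simp add: hull_rel_def del: nmul.simps(2))
  then show ?thesis
    using that[of "hull_frac a m"] by (simp only: n nmul_hull_frac)
qed


text \<open>
  Valuations, written additively, of a field \<open>F\<close> given as a subfield of a field type.  The values
  lie in an arbitrary linearly ordered abelian group together with \<open>Pinf\<close>; the element \<open>Minf\<close>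
  of the library type of extended values is excluded.
\<close>

definition is_subfield :: "'a::field set \<Rightarrow> bool" where
  "is_subfield F \<longleftrightarrow> 0 \<in> F \<and> 1 \<in> F \<and>
     (\<forall>x\<in>F. \<forall>y\<in>F. x + y \<in> F \<and> x * y \<in> F) \<and> (\<forall>x\<in>F. - x \<in> F \<and> inverse x \<in> F)"

definition valuation_on ::
    "'a::field set \<Rightarrow> ('a \<Rightarrow> 'g::linordered_ab_group_add extended) \<Rightarrow> bool" where
  "valuation_on F v \<longleftrightarrow>
     (\<forall>x\<in>F. v x \<noteq> Minf \<and> (v x = Pinf \<longleftrightarrow> x = 0)) \<and>
     (\<forall>x\<in>F. \<forall>y\<in>F. v (x * y) = v x + v y) \<and>
     (\<forall>x\<in>F. \<forall>y\<in>F. min (v x) (v y) \<le> v (x + y))"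

definition val_ring :: "('a::field \<Rightarrow> 'g::linordered_ab_group_add extended) \<Rightarrow> 'a set" where
  "val_ring v = {x. 0 \<le> v x}"

definition max_ideal :: "('a::field \<Rightarrow> 'g::linordered_ab_group_add extended) \<Rightarrow> 'a set" where
  "max_ideal v = {x. 0 < v x}"

definition value_group :: "('a::field \<Rightarrow> 'g::linordered_ab_group_add extended) \<Rightarrow> 'g set" where
  "value_group v = {g. \<exists>x. x \<noteq> 0 \<and> v x = Fin g}"

definition pos_values :: "('a::field \<Rightarrow> 'g::linordered_ab_group_add extended) \<Rightarrow> 'g set" where
  "pos_values v = {g \<in> value_group v. 0 < g}"

text \<open>
  The residue field, which depends on the valuation and so cannot be a type built from it, is a
  field type \<open>'r\<close> together with the reduction map: a surjective ring homomorphism from the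
  valuation ring onto \<open>'r\<close> whose kernel is the maximal ideal.  The values of \<open>res\<close> outside the
  valuation ring are irrelevant.
\<close>

definition residue_map ::
    "('a::field \<Rightarrow> 'g::linordered_ab_group_add extended) \<Rightarrow> ('a \<Rightarrow> 'r::field) \<Rightarrow> bool" where
  "residue_map v res \<longleftrightarrow>
     (\<forall>x\<in>val_ring v. \<forall>y\<in>val_ring v. res (x + y) = res x + res y \<and> res (x * y) = res x * res y) \<and>
     res 1 = 1 \<and> res ` val_ring v = UNIV \<and>
     {x \<in> val_ring v. res x = 0} = max_ideal v"

definition polys_over :: "'a::zero set \<Rightarrow> 'a poly set" where
  "polys_over R = {p. \<forall>n. Polynomial.coeff p n \<in> R}"

text \<open>Separable in the sense of having only simple roots in an algebraic closure.\<close>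

definition separable_poly :: "'a::field poly \<Rightarrow> bool" where
  "separable_poly f \<longleftrightarrow> rsquarefree (map_poly to_ac f)"

definition eval_ac :: "'a::field poly \<Rightarrow> 'a alg_closure \<Rightarrow> 'a alg_closure" where
  "eval_ac p x = poly (map_poly to_ac p) x"

definition adjoin_field :: "'a::field alg_closure \<Rightarrow> 'a alg_closure set" where
  "adjoin_field \<alpha> = \<Inter>{F. is_subfield F \<and> range to_ac \<subseteq> F \<and> \<alpha> \<in> F}"

definition adjoin_ring :: "'a::field set \<Rightarrow> 'a alg_closure \<Rightarrow> 'a alg_closure set" where
  "adjoin_ring R \<alpha> = {eval_ac p \<alpha> |p. p \<in> polys_over R}"

definition integral_closure_in :: "'a::field set \<Rightarrow> 'a alg_closure set \<Rightarrow> 'a alg_closure set" where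
  "integral_closure_in R L =
     {x \<in> L. \<exists>p \<in> polys_over R. Polynomial.lead_coeff p = 1 \<and> eval_ac p x = 0}"

text \<open>
  The extensions of \<open>v\<close> to \<open>L\<close>, normalised to have values in the divisible hull and to be
  \<open>undefined\<close> outside \<open>L\<close>, so that distinct extensions are distinct functions.
\<close>

definition val_extensions ::
    "('a::field \<Rightarrow> 'g::linordered_ab_group_add extended) \<Rightarrow> 'a alg_closure set \<Rightarrow>
      ('a alg_closure \<Rightarrow> 'g div_hull extended) set" where
  "val_extensions v L =
     {w \<in> extensional L. valuation_on L w \<and> (\<forall>x. w (to_ac x) = map_extended to_hull (v x))}"

lemma nmul_Fin: "nmul n (Fin a) = Fin (nmul n a)"
  by (induction n) (simp_all add: zero_extended_def)

lemma nmul_Pinf: "0 < n \<Longrightarrow> nmul n Pinf = (Pinf :: 'a::comm_monoid_add extended)"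
proof (induction n)
  case (Suc n)
  then show ?case by (cases n) (simp_all add: zero_extended_def)
qed simp

lemma nmul_ext_le_iff:
  fixes a b :: "'a::linordered_ab_group_add extended"
  assumes "0 < n" "a \<noteq> Minf" "b \<noteq> Minf"
  shows "nmul n a \<le> nmul n b \<longleftrightarrow> a \<le> b"
  using assms by (cases a; cases b) (auto simp: nmul_Fin nmul_Pinf)

lemma nmul_ext_eq_iff:
  fixes a b :: "'a::linordered_ab_group_add extended"
  assumes "0 < n" "a \<noteq> Minf" "b \<noteq> Minf"
  shows "nmul n a = nmul n b \<longleftrightarrow> a = b"
  using assms by (metis antisym nmul_ext_le_iff order_refl)

abbreviation hull_ext :: "'g::linordered_ab_group_add extended \<Rightarrow> 'g div_hull extended" where
  "hull_ext \<equiv> map_extended to_hull"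

lemma hull_ext_le_iff: "hull_ext a \<le> hull_ext b \<longleftrightarrow> a \<le> b"
  by (cases a; cases b) auto

lemma hull_ext_add: "hull_ext (a + b) = hull_ext a + hull_ext b"
  by (cases a; cases b) (auto simp: to_hull_add)

lemma hull_ext_nmul: "hull_ext (nmul n a) = nmul n (hull_ext a)"
  by (induction n) (auto simp: hull_ext_add zero_extended_def)

lemma is_subfield_power: "is_subfield F \<Longrightarrow> x \<in> F \<Longrightarrow> x ^ n \<in> F"
  by (induction n) (auto simp: is_subfield_def)

lemma valuation_on_one:
  assumes "valuation_on F v" "is_subfield F"
  shows "v 1 = 0"
proof -
  have "1 \<in> F" using assms(2) by (simp add: is_subfield_def)
  then have "v 1 \<noteq> Minf" "v 1 \<noteq> Pinf" and "v (1 * 1) = v 1 + v 1"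
    using assms(1) unfolding valuation_on_def by auto
  then show ?thesis
    by (cases "v 1") (auto simp: zero_extended_def)
qed

lemma valuation_on_power:
  assumes "valuation_on F v" "is_subfield F" "x \<in> F"
  shows "v (x ^ n) = nmul n (v x)"
proof (induction n)
  case 0
  then show ?case using valuation_on_one[OF assms(1,2)] by simp
next
  case (Suc n)
  then show ?case
    using assms is_subfield_power[OF assms(2,3), of n] by (simp add: valuation_on_def)
qed

lemma valuation_on_uminus:
  assumes "valuation_on F v" "is_subfield F" "x \<in> F"
  shows "v (- x) = v x"
proof -
  have m: "-1 \<in> F" using assms(2) by (auto simp: is_subfield_def)
  have "nmul 2 (v (-1)) = nmul 2 0"
    using valuation_on_power[OF assms(1,2) m, of 2] valuation_on_one[OF assms(1,2)] by simp
  moreover have "v (-1) \<noteq> Minf"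
    using assms(1) m by (simp add: valuation_on_def)
  ultimately have "v (-1) = 0"
    by (subst (asm) nmul_ext_eq_iff) (auto simp: zero_extended_def)
  moreover have "v (-1 * x) = v (-1) + v x"
    using assms(1,3) m unfolding valuation_on_def by blast
  ultimately show ?thesis by simp
qed

lemma valuation_on_add_eq:
  assumes v: "valuation_on F v" "is_subfield F" and xy: "x \<in> F" "y \<in> F" and lt: "v x < v y"
  shows "v (x + y) = v x"
proof (rule antisym)
  have "min (v x) (v y) \<le> v (x + y)"
    using v xy by (simp add: valuation_on_def)
  then show "v x \<le> v (x + y)" using lt by simp
  have "x + y \<in> F" "- y \<in> F"
    using v xy by (auto simp: is_subfield_def)
  then have "min (v (x + y)) (v (- y)) \<le> v (x + y + - y)"
    using v(1) unfolding valuation_on_def by blast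
  then have "min (v (x + y)) (v y) \<le> v x"
    by (simp add: valuation_on_uminus[OF v xy(2)])
  then show "v (x + y) \<le> v x"
    using lt by (auto simp: min_def split: if_splits)
qed

lemma valuation_on_sum:
  assumes v: "valuation_on F v" "is_subfield F"
    and "finite S" "S \<noteq> {}" "\<And>i. i \<in> S \<Longrightarrow> t i \<in> F" "inj_on (\<lambda>i. v (t i)) S"
  shows "sum t S \<in> F \<and> (\<exists>i\<in>S. v (sum t S) = v (t i))"
  using assms(3-)
proof (induction S rule: finite_ne_induct)
  case (insert j S)
  then obtain i where i: "i \<in> S" "v (sum t S) = v (t i)" and F: "sum t S \<in> F" "t j \<in> F"
    by auto
  have "v (t j) \<noteq> v (sum t S)"
    using insert.prems insert.hyps i by (auto simp: inj_on_def)
  then have "v (t j + sum t S) = v (t j) \<or> v (sum t S + t j) = v (sum t S)"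
    using valuation_on_add_eq[OF v F] valuation_on_add_eq[OF v F(2,1)] by (meson linorder_neqE)
  moreover have "t j + sum t S \<in> F"
    using F v(2) by (simp add: is_subfield_def)
  ultimately show ?case
    using insert.hyps i by (auto simp: add.commute)
qed simp

lemma valuation_on_torsion:
  fixes w :: "'a::field alg_closure \<Rightarrow> 'h::linordered_ab_group_add extended"
  assumes w: "valuation_on L w" "is_subfield L" and sub: "range to_ac \<subseteq> L" and x: "x \<in> L"
  obtains n c where "0 < n" "w (x ^ n) = w (to_ac c)"
proof (cases "x = 0")
  case True
  then show ?thesis using that[of 1 0] by simp
next
  case False
  note goal = that
  obtain p :: "'a poly" where p: "p \<noteq> 0" "poly (map_poly to_ac p) x = 0"
    using alg_closure_algebraic by blast
  define t where "t = (\<lambda>i. to_ac (Polynomial.coeff p i) * x ^ i)"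
  define S where "S = {i. i \<le> Polynomial.degree p \<and> Polynomial.coeff p i \<noteq> 0}"
  have "sum t S = (\<Sum>i\<le>Polynomial.degree p. t i)"
    by (rule sum.mono_neutral_left) (auto simp: S_def t_def)
  also have "\<dots> = 0"
    using p(2) by (simp add: poly_altdef degree_map_poly coeff_map_poly t_def)
  finally have sum0: "sum t S = 0" .
  have S: "finite S" "S \<noteq> {}"
    using p(1) by (auto simp: S_def intro: exI[of _ "Polynomial.degree p"])
  have tL: "t i \<in> L" for i
    using w(2) sub is_subfield_power[OF w(2) x] by (auto simp: t_def is_subfield_def)
  have t0: "t i \<noteq> 0" if "i \<in> S" for i
    using that False by (auto simp: t_def S_def)
  have "\<not> inj_on (\<lambda>i. w (t i)) S"
  proof
    assume "inj_on (\<lambda>i. w (t i)) S"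
    then obtain i where "i \<in> S" "w 0 = w (t i)"
      using valuation_on_sum[OF w S, of t] tL sum0 by auto
    moreover have "0 \<in> L" using w(2) by (simp add: is_subfield_def)
    ultimately show False
      using w(1) t0[of i] tL[of i] unfolding valuation_on_def by metis
  qed
  then obtain i j where ij: "i \<in> S" "j \<in> S" "w (t i) = w (t j)" "i \<noteq> j"
    by (auto simp: inj_on_def)
  have main: thesis if "i \<in> S" "j \<in> S" "w (t i) = w (t j)" "i < j" for i j
  proof -
    let ?a = "to_ac (Polynomial.coeff p i)" and ?b = "to_ac (Polynomial.coeff p j)"
    define u where "u = inverse (?b * x ^ i)"
    have nz: "?b \<noteq> 0" "x ^ i \<noteq> 0"
      using that False by (auto simp: S_def)
    have "?b * x ^ i \<in> L"
      using w(2) sub is_subfield_power[OF w(2) x] by (auto simp: is_subfield_def)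
    then have u: "u \<in> L"
      using w(2) unfolding u_def is_subfield_def by blast
    have "t i * u = to_ac (Polynomial.coeff p i / Polynomial.coeff p j)"
      using nz by (simp add: t_def u_def divide_inverse)
    moreover have "t j * u = x ^ (j - i)"
      using nz False \<open>i < j\<close> by (simp add: t_def u_def power_diff divide_inverse)
    moreover have "w (t i * u) = w (t j * u)"
      using w(1) tL u that(3) by (simp add: valuation_on_def)
    ultimately show thesis
      using \<open>i < j\<close> goal[of "j - i" "Polynomial.coeff p i / Polynomial.coeff p j"] by simp
  qed
  show thesis
    using main[of i j] main[of j i] ij by (cases "i < j") auto
qed

text \<open>
  Any valuation \<open>w\<close> of \<open>L\<close>, with values in any ordered group, whose restriction to the base field
  is equivalent to \<open>v\<close>, is equivalent to exactly one member of \<open>val_extensions v L\<close>.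
\<close>

theorem extension_normal_form:
  fixes v :: "'a::field \<Rightarrow> 'g::linordered_ab_group_add extended"
    and w :: "'a alg_closure \<Rightarrow> 'h::linordered_ab_group_add extended"
  assumes v: "valuation_on UNIV v"
    and L: "is_subfield L" "range to_ac \<subseteq> L"
    and w: "valuation_on L w"
    and equiv: "\<And>x y. w (to_ac x) \<le> w (to_ac y) \<longleftrightarrow> v x \<le> v y"
  shows "\<exists>!w'. w' \<in> val_extensions v L \<and> (\<forall>x\<in>L. \<forall>y\<in>L. w' x \<le> w' y \<longleftrightarrow> w x \<le> w y)"
proof -
  have U: "is_subfield (UNIV :: 'a set)"
    by (simp add: is_subfield_def)
  note vpow = valuation_on_power[OF v U UNIV_I]
  note wpow = valuation_on_power[OF w L(1)]
  have acL: "to_ac c \<in> L" for c using L(2) by auto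
  have vM: "v x \<noteq> Minf" for x using v by (simp add: valuation_on_def)
  have wM: "w x \<noteq> Minf" if "x \<in> L" for x using w that by (simp add: valuation_on_def)
  have wmult: "w (x * y) = w x + w y" if "x \<in> L" "y \<in> L" for x y
    using w that by (simp add: valuation_on_def)
  have eqv: "w (to_ac x) = w (to_ac y) \<longleftrightarrow> v x = v y" for x y
    using equiv[of x y] equiv[of y x] by (auto intro: antisym)
  have ex: "\<exists>z. z \<noteq> Minf \<and>
      (\<forall>n c. 0 < n \<longrightarrow> w (x ^ n) = w (to_ac c) \<longrightarrow> nmul n z = hull_ext (v c))"
    if x: "x \<in> L" for x
  proof -
    obtain n c where nc: "0 < n" "w (x ^ n) = w (to_ac c)"
      using valuation_on_torsion[OF w L x] by blast
    obtain z where z: "z \<noteq> Minf" "nmul n z = hull_ext (v c)"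
    proof (cases "v c")
      case (Fin g)
      obtain z where "nmul n z = to_hull g"
        using to_hull_divisible[OF nc(1)] by blast
      then show ?thesis using that[of "Fin z"] Fin by (simp add: nmul_Fin)
    next
      case Pinf
      then show ?thesis using that[of Pinf] nc(1) by (simp add: nmul_Pinf)
    qed (use vM in auto)
    have "nmul m z = hull_ext (v d)" if md: "0 < m" "w (x ^ m) = w (to_ac d)" for m d
    proof -
      have "w (to_ac (c ^ m)) = nmul m (w (x ^ n))"
        by (simp add: wpow acL nc(2))
      also have "\<dots> = nmul n (w (x ^ m))"
        by (simp add: wpow x nmul_comm[of m])
      also have "\<dots> = w (to_ac (d ^ n))"
        by (simp add: wpow acL md(2))
      finally have "v (c ^ m) = v (d ^ n)"
        by (simp only: eqv)
      then have "nmul n (nmul m z) = nmul n (hull_ext (v d))"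
        by (simp only: vpow nmul_comm[of n m] z(2) flip: hull_ext_nmul)
      moreover have "nmul m z \<noteq> Minf"
        using z(1) md(1) by (cases z) (auto simp: nmul_Fin nmul_Pinf)
      moreover have "hull_ext (v d) \<noteq> Minf"
        using vM[of d] by (cases "v d") auto
      ultimately show ?thesis
        using nc(1) by (simp add: nmul_ext_eq_iff)
    qed
    with z(1) show ?thesis by blast
  qed
  define w' where "w' = restrict (\<lambda>x. SOME z. z \<noteq> Minf \<and>
      (\<forall>n c. 0 < n \<longrightarrow> w (x ^ n) = w (to_ac c) \<longrightarrow> nmul n z = hull_ext (v c))) L"
  have w'1: "w' x \<noteq> Minf"
    and w'2: "\<And>n c. 0 < n \<Longrightarrow> w (x ^ n) = w (to_ac c) \<Longrightarrow> nmul n (w' x) = hull_ext (v c)"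
    if "x \<in> L" for x
    using someI_ex[OF ex[OF that]] that by (auto simp: w'_def)
  have le: "w' x \<le> w' y \<longleftrightarrow> w x \<le> w y" if x: "x \<in> L" and y: "y \<in> L" for x y
  proof -
    obtain n c where nc: "0 < n" "w (x ^ n) = w (to_ac c)"
      using valuation_on_torsion[OF w L x] by blast
    obtain m d where md: "0 < m" "w (y ^ m) = w (to_ac d)"
      using valuation_on_torsion[OF w L y] by blast
    have "w' x \<le> w' y \<longleftrightarrow> nmul (m * n) (w' x) \<le> nmul (m * n) (w' y)"
      using nc md w'1[OF x] w'1[OF y] by (simp add: nmul_ext_le_iff)
    also have "nmul (m * n) (w' x) = hull_ext (v (c ^ m))"
      by (simp add: nmul_mult w'2[OF x nc] vpow hull_ext_nmul)
    also have "nmul (m * n) (w' y) = hull_ext (v (d ^ n))"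
      by (simp add: nmul_mult nmul_comm[of m] w'2[OF y md] vpow hull_ext_nmul)
    also have "hull_ext (v (c ^ m)) \<le> hull_ext (v (d ^ n)) \<longleftrightarrow> w (to_ac (c ^ m)) \<le> w (to_ac (d ^ n))"
      by (simp only: hull_ext_le_iff equiv)
    also have "w (to_ac (c ^ m)) = nmul (m * n) (w x)"
      using nc(2) by (simp add: nmul_mult wpow acL x)
    also have "w (to_ac (d ^ n)) = nmul (m * n) (w y)"
      using md(2) by (simp add: nmul_mult nmul_comm[of m] wpow acL y)
    also have "nmul (m * n) (w x) \<le> nmul (m * n) (w y) \<longleftrightarrow> w x \<le> w y"
      using nc md wM[OF x] wM[OF y] by (simp add: nmul_ext_le_iff)
    finally show ?thesis .
  qed
  have ext: "w' (to_ac a) = hull_ext (v a)" for a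
    using w'2[OF acL, of 1 a a] by simp
  have zero: "0 \<in> L" using L(1) by (simp add: is_subfield_def)
  have inf: "w' x = Pinf \<longleftrightarrow> x = 0" if x: "x \<in> L" for x
  proof -
    have v0: "v 0 = Pinf" "w 0 = Pinf"
      using v w zero by (auto simp: valuation_on_def)
    then have "w' 0 = Pinf" using ext[of 0] by simp
    then have "w' x = Pinf \<longleftrightarrow> w' 0 \<le> w' x" by simp
    also have "\<dots> \<longleftrightarrow> w x = Pinf" using le[OF zero x] v0 by simp
    also have "\<dots> \<longleftrightarrow> x = 0" using w x by (simp add: valuation_on_def)
    finally show ?thesis .
  qed
  have mult: "w' (x * y) = w' x + w' y" if x: "x \<in> L" and y: "y \<in> L" for x y
  proof -
    have xy: "x * y \<in> L" using x y L(1) by (simp add: is_subfield_def)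
    obtain n c where nc: "0 < n" "w (x ^ n) = w (to_ac c)"
      using valuation_on_torsion[OF w L x] by blast
    obtain m d where md: "0 < m" "w (y ^ m) = w (to_ac d)"
      using valuation_on_torsion[OF w L y] by blast
    have 1: "w (x ^ (m * n)) = w (to_ac (c ^ m))" "w (y ^ (m * n)) = w (to_ac (d ^ n))"
      using nc(2) md(2) by (simp_all add: wpow x y acL nmul_mult nmul_comm[of m n "w y"])
    then have "w ((x * y) ^ (m * n)) = w (to_ac (c ^ m * d ^ n))"
      using wmult[OF is_subfield_power[OF L(1) x] is_subfield_power[OF L(1) y]] wmult[OF acL acL]
      by (simp only: power_mult_distrib to_ac_mult)
    then have "nmul (m * n) (w' (x * y)) = hull_ext (v (c ^ m * d ^ n))"
      using w'2[OF xy] nc md by simp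
    also have "\<dots> = hull_ext (v (c ^ m)) + hull_ext (v (d ^ n))"
      using v by (simp add: valuation_on_def hull_ext_add)
    also have "\<dots> = nmul (m * n) (w' x + w' y)"
      using w'2[OF x _ 1(1)] w'2[OF y _ 1(2)] nc md by (simp add: nmul_plus)
    finally have "nmul (m * n) (w' (x * y)) = nmul (m * n) (w' x + w' y)" .
    moreover have "w' x + w' y \<noteq> Minf"
      using w'1[OF x] w'1[OF y] by (cases "w' x"; cases "w' y") auto
    ultimately show ?thesis
      using w'1[OF xy] nc(1) md(1) nmul_ext_eq_iff[of "m * n" "w' (x * y)" "w' x + w' y"] by simp
  qed
  have add: "min (w' x) (w' y) \<le> w' (x + y)" if x: "x \<in> L" and y: "y \<in> L" for x y
  proof -
    have xy: "x + y \<in> L" using x y L(1) by (simp add: is_subfield_def)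
    have "min (w x) (w y) \<le> w (x + y)"
      using w x y by (simp add: valuation_on_def)
    then show ?thesis
      using le[OF x xy] le[OF y xy] by (simp add: min_le_iff_disj)
  qed
  have "w' \<in> val_extensions v L"
    using w'1 inf mult add ext by (auto simp: val_extensions_def valuation_on_def w'_def)
  moreover have "w1 = w'" if w1: "w1 \<in> val_extensions v L"
    and le1: "\<forall>x\<in>L. \<forall>y\<in>L. w1 x \<le> w1 y \<longleftrightarrow> w x \<le> w y" for w1
  proof (rule extensionalityI[of _ L])
    show "w1 \<in> extensional L" "w' \<in> extensional L"
      using w1 by (auto simp: val_extensions_def w'_def)
    fix x assume x: "x \<in> L"
    have v1: "valuation_on L w1"
      using w1 by (simp add: val_extensions_def)
    obtain n c where nc: "0 < n" "w (x ^ n) = w (to_ac c)"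
      using valuation_on_torsion[OF w L x] by blast
    have "w1 (x ^ n) = w1 (to_ac c)"
      using le1 nc(2) acL[of c] is_subfield_power[OF L(1) x, of n] by (intro antisym) auto
    then have "nmul n (w1 x) = nmul n (w' x)"
      using w'2[OF x nc] w1 valuation_on_power[OF v1 L(1) x] by (simp add: val_extensions_def)
    moreover have "w1 x \<noteq> Minf"
      using v1 x by (simp add: valuation_on_def)
    ultimately show "w1 x = w' x"
      using nc(1) w'1[OF x] by (simp add: nmul_ext_eq_iff)
  qed
  ultimately show ?thesis
    using le by blast
qed

end

theory Submission
  imports Defs
begin

text \<open>
  Let \<open>S\<close> be the integral closure of \<open>R\<close> in \<open>L\<close>.  By Chevalley's extension theorem \<open>S\<close> is the
  intersection of the valuation rings of the extensions \<open>\<omega>\<close> of \<open>v\<close>, and every \<open>\<phi>\<^sub>i\<close> has an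
  \<open>\<omega>\<close> over it, meaning \<open>\<omega>(\<phi>\<^sub>i(\<alpha>)) > 0\<close>; conversely each \<open>\<omega>\<close> lies over exactly one \<open>\<phi>\<^sub>i\<close>, and then
  \<open>\<omega>(p(\<alpha>)) > 0\<close> iff the reduction of \<open>\<phi>\<^sub>i\<close> divides that of \<open>p\<close>.

  If \<open>R[\<alpha>] = S\<close>, extensions are determined by their centre on \<open>S\<close> (a Pruefer domain), hence by \<open>i\<close>,
  and there are \<open>s\<close> of them.  If moreover \<open>l\<^sub>i \<ge> 2\<close>, write \<open>f = g \<phi>\<^sub>i + \<rho> u\<close> with \<open>\<rho>\<close> a coefficient
  of least value of \<open>f - g \<phi>\<^sub>i\<close>, where \<open>g = \<phi>\<^sub>i\<^bsup>l\<^sub>i-1\<^esup> \<Prod>\<^sub>j\<^sub>\<noteq>\<^sub>i \<phi>\<^sub>j\<^bsup>l\<^sub>j\<^esup>\<close>.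
  As \<open>g\<close> is monic of degree less than that of \<open>f\<close>, no \<open>g(\<alpha>) / c\<close> with \<open>c \<in> M\<close> is integral, and
  comparing values forces \<open>l\<^sub>i \<omega>(\<phi>\<^sub>i(\<alpha>)) = v \<rho> = min \<Gamma>\<^sup>+\<close>.
\<close>

section \<open>Valuation rings dominating a proper ideal\<close>

text \<open>In arbitrary rank there is in general no uniformizer, so extensions are produced
  abstractly: a subring with a proper ideal is enlarged by Zorn's lemma to a valuation ring with its
  maximal ideal, and values are assigned afterwards in the divisible hull. Because extensions are
  normalised there, equality of valuation rings already gives equality of functions, which makes
  counting them possible.

  The comparison of values is plain arithmetic. Put
  \<open>\<gamma> = \<omega>(\<phi> i(\<alpha>))\<close> and \<open>k = l i - 1\<close>. The failure
  of \<open>g(\<alpha>) / c\<close> to be integral can only show at \<omega> when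
  \<open>v c \<le> v \<rho>\<close>, and it shows that all positive values exceed
  \<open>k \<gamma>\<close>, hence also \<gamma>. In
  \<open>l i \<gamma> = v \<rho> + \<omega>(u(\<alpha>))\<close> a positive last term would be at
  least \<gamma> and force \<open>v \<rho> \<le> k \<gamma>\<close>; so it is 0. If a positive value
  \<open>h\<close> were below \<open>v \<rho>\<close>, then \<open>v \<rho> = e + h\<close> with
  \<open>e\<close> positive, \<open>e > k \<gamma>\<close> and \<open>h > \<gamma>\<close>, so the
  sum would exceed \<open>l i \<gamma>\<close>. The existence of a least positive value is thus an
  outcome of the argument.\<close>

definition proper_ideal_of :: "'b::field set \<Rightarrow> 'b set \<Rightarrow> bool" where
  "proper_ideal_of B Q \<longleftrightarrow> 1 \<in> B \<and> (\<forall>x\<in>B. \<forall>y\<in>B. x - y \<in> B \<and> x * y \<in> B) \<and>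
     Q \<subseteq> B \<and> 0 \<in> Q \<and> (\<forall>x\<in>Q. \<forall>y\<in>Q. x + y \<in> Q) \<and> (\<forall>x\<in>B. \<forall>y\<in>Q. x * y \<in> Q) \<and> 1 \<notin> Q"

lemma proper_ideal_ofD:
  assumes "proper_ideal_of B Q"
  shows "1 \<in> B" "0 \<in> B" "0 \<in> Q" "1 \<notin> Q"
    and "x \<in> B \<Longrightarrow> y \<in> B \<Longrightarrow> x + y \<in> B" "x \<in> B \<Longrightarrow> y \<in> B \<Longrightarrow> x - y \<in> B"
    and "x \<in> B \<Longrightarrow> y \<in> B \<Longrightarrow> x * y \<in> B" "x \<in> B \<Longrightarrow> - x \<in> B" "x \<in> B \<Longrightarrow> x ^ n \<in> B"
    and "x \<in> Q \<Longrightarrow> x \<in> B" "x \<in> Q \<Longrightarrow> y \<in> Q \<Longrightarrow> x + y \<in> Q"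
    and "x \<in> B \<Longrightarrow> y \<in> Q \<Longrightarrow> x * y \<in> Q" "y \<in> B \<Longrightarrow> x \<in> Q \<Longrightarrow> x * y \<in> Q"
    and "x \<in> Q \<Longrightarrow> - x \<in> Q"
proof -
  note a = assms[unfolded proper_ideal_of_def]
  show zero: "0 \<in> B" and "1 \<in> B" "0 \<in> Q" "1 \<notin> Q" using a by blast+
  show m: "x \<in> B \<Longrightarrow> - x \<in> B" for x using a zero by (metis diff_0)
  show "x \<in> B \<Longrightarrow> y \<in> B \<Longrightarrow> x + y \<in> B" using a m by (metis diff_minus_eq_add)
  show "x \<in> B \<Longrightarrow> x ^ n \<in> B" using a by (induction n) auto
  show "x \<in> Q \<Longrightarrow> - x \<in> Q" using a m[of 1] by (metis mult_minus1)
  show "x \<in> B \<Longrightarrow> y \<in> B \<Longrightarrow> x - y \<in> B" "x \<in> B \<Longrightarrow> y \<in> B \<Longrightarrow> x * y \<in> B"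
    "x \<in> Q \<Longrightarrow> x \<in> B" "x \<in> Q \<Longrightarrow> y \<in> Q \<Longrightarrow> x + y \<in> Q"
    "x \<in> B \<Longrightarrow> y \<in> Q \<Longrightarrow> x * y \<in> Q" "y \<in> B \<Longrightarrow> x \<in> Q \<Longrightarrow> x * y \<in> Q"
    using a by (auto simp: mult.commute)
qed

text \<open>The clause on inverses says both that \<open>B\<close> is a valuation ring of the whole
  field and that \<open>Q\<close> is its maximal ideal: for a nonzero nonunit \<open>x\<close> of
  \<open>B\<close>, apply it to \<open>inverse x\<close>. No value group appears, so Zorn's lemma
  can be run on sets alone.\<close>

definition valuation_pair :: "'b::field set \<Rightarrow> 'b set \<Rightarrow> bool" where
  "valuation_pair B Q \<longleftrightarrow> proper_ideal_of B Q \<and> (\<forall>y. y \<notin> B \<longrightarrow> inverse y \<in> Q)"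

lemma sum_in_additive:
  assumes "0 \<in> A" "\<And>x y. x \<in> A \<Longrightarrow> y \<in> A \<Longrightarrow> x + y \<in> A" "\<And>i. i \<in> S \<Longrightarrow> f i \<in> A"
  shows "sum f S \<in> A"
  using assms(3) by (induction S rule: infinite_finite_induct) (auto intro: assms)

lemma polys_over_mult:
  assumes "proper_ideal_of B Q" "W = B \<or> W = Q" "p \<in> polys_over B" "q \<in> polys_over W"
  shows "p * q \<in> polys_over W"
  using assms proper_ideal_ofD[OF assms(1)]
  by (auto simp: polys_over_def coeff_mult intro!: sum_in_additive)

text \<open>\<open>U = Q\<close> gives the ideal that \<open>Q\<close> generates in
  \<open>B[y]\<close>, \<open>U = B\<close> the ideal generated by \<open>Q\<close> and
  \<open>y\<close>. Only properness can fail, and \<open>one\<close> isolates it as the absence of a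
  polynomial relation of value 1 at \<open>y\<close>.\<close>

lemma proper_ideal_of_adjoin:
  fixes B Q U :: "'b::field set"
  assumes B: "proper_ideal_of B Q" and U: "U = Q \<or> U = B"
    and one: "\<And>p. p \<in> polys_over U \<Longrightarrow> Polynomial.coeff p 0 \<in> Q \<Longrightarrow> poly p y \<noteq> 1"
  shows "proper_ideal_of ((\<lambda>p. poly p y) ` polys_over B)
           ((\<lambda>p. poly p y) ` {p \<in> polys_over U. Polynomial.coeff p 0 \<in> Q})"
proof -
  note D = proper_ideal_ofD[OF B]
  have UB: "U \<subseteq> B" "0 \<in> U" "\<And>a b. a \<in> U \<Longrightarrow> b \<in> U \<Longrightarrow> a + b \<in> U"
    "\<And>a b. a \<in> B \<Longrightarrow> b \<in> U \<Longrightarrow> a * b \<in> U"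
    using U D by auto
  have mult: "p * q \<in> polys_over W"
    if "p \<in> polys_over B" "q \<in> polys_over W" "W = B \<or> W = U" for p q W
    using polys_over_mult[OF B] that U by blast
  show ?thesis
    unfolding proper_ideal_of_def
  proof (intro conjI ballI)
    show "1 \<in> (\<lambda>p. poly p y) ` polys_over B"
      by (rule image_eqI[of _ _ 1]) (auto simp: polys_over_def coeff_1 D)
    show "0 \<in> (\<lambda>p. poly p y) ` {p \<in> polys_over U. Polynomial.coeff p 0 \<in> Q}"
      by (rule image_eqI[of _ _ 0]) (auto simp: polys_over_def UB D)
    show "1 \<notin> (\<lambda>p. poly p y) ` {p \<in> polys_over U. Polynomial.coeff p 0 \<in> Q}"
      using one by fastforce
    show "(\<lambda>p. poly p y) ` {p \<in> polys_over U. Polynomial.coeff p 0 \<in> Q}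
        \<subseteq> (\<lambda>p. poly p y) ` polys_over B"
      using UB(1) by (auto simp: polys_over_def)
  next
    fix a b assume "a \<in> (\<lambda>p. poly p y) ` polys_over B" "b \<in> (\<lambda>p. poly p y) ` polys_over B"
    then obtain p q where "p \<in> polys_over B" "q \<in> polys_over B" "a = poly p y" "b = poly q y"
      by auto
    moreover from this have "p * q \<in> polys_over B" "p - q \<in> polys_over B"
      using mult[of p q B] D by (auto simp: polys_over_def)
    ultimately show "a - b \<in> (\<lambda>p. poly p y) ` polys_over B" "a * b \<in> (\<lambda>p. poly p y) ` polys_over B"
      by (auto intro: image_eqI[of _ _ "p - q"] image_eqI[of _ _ "p * q"])
  next
    fix a b assume "a \<in> (\<lambda>p. poly p y) ` {p \<in> polys_over U. Polynomial.coeff p 0 \<in> Q}"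
      "b \<in> (\<lambda>p. poly p y) ` {p \<in> polys_over U. Polynomial.coeff p 0 \<in> Q}"
    then obtain p q where "p \<in> polys_over U" "q \<in> polys_over U" "a = poly p y" "b = poly q y"
      "Polynomial.coeff p 0 \<in> Q" "Polynomial.coeff q 0 \<in> Q" by auto
    then show "a + b \<in> (\<lambda>p. poly p y) ` {p \<in> polys_over U. Polynomial.coeff p 0 \<in> Q}"
      using D UB by (auto intro!: image_eqI[of _ _ "p + q"] simp: polys_over_def)
  next
    fix a b assume "a \<in> (\<lambda>p. poly p y) ` polys_over B"
      "b \<in> (\<lambda>p. poly p y) ` {p \<in> polys_over U. Polynomial.coeff p 0 \<in> Q}"
    then obtain p q where pq: "p \<in> polys_over B" "q \<in> polys_over U" "a = poly p y" "b = poly q y"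
      "Polynomial.coeff q 0 \<in> Q" by auto
    then have "Polynomial.coeff (p * q) 0 \<in> Q"
      using D by (simp add: coeff_mult polys_over_def)
    then show "a * b \<in> (\<lambda>p. poly p y) ` {p \<in> polys_over U. Polynomial.coeff p 0 \<in> Q}"
      using mult[of p q U] pq by (auto intro!: image_eqI[of _ _ "p * q"])
  qed
qed

text \<open>Inverting all \<open>1 - t\<close> with \<open>t \<in> Q\<close> keeps the ideal proper,
  since \<open>1 = b / (1 - t)\<close> with \<open>b \<in> Q\<close> would put
  \<open>1 = b + t\<close> into \<open>Q\<close>. A maximal pair is therefore unchanged by it, which
  makes every \<open>1 - t\<close> a unit.\<close>

lemma proper_ideal_of_localize:
  fixes B Q :: "'b::field set"
  assumes B: "proper_ideal_of B Q"
  shows "proper_ideal_of {b / (1 - t) |b t. b \<in> B \<and> t \<in> Q} {b / (1 - t) |b t. b \<in> Q \<and> t \<in> Q}"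
proof -
  note D = proper_ideal_ofD[OF B]
  have nz: "1 - t \<noteq> 0" if "t \<in> Q" for t using D that by auto
  have inB: "1 - t \<in> B" if "t \<in> Q" for t using D that by auto
  have frac: "\<exists>t\<in>Q. (1 - t1) * (1 - t2) = 1 - t" if "t1 \<in> Q" "t2 \<in> Q" for t1 t2
  proof
    show "(1 - t1) * (1 - t2) = 1 - (t1 + t2 + - (t1 * t2))" by (simp add: algebra_simps)
    show "t1 + t2 + - (t1 * t2) \<in> Q" using that by (intro D) auto
  qed
  show ?thesis
    unfolding proper_ideal_of_def
  proof (intro conjI ballI)
    show "1 \<in> {b / (1 - t) |b t. b \<in> B \<and> t \<in> Q}"
      using D by (intro CollectI exI[of _ 1] exI[of _ 0]) auto
    show "0 \<in> {b / (1 - t) |b t. b \<in> Q \<and> t \<in> Q}"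
      using D by (intro CollectI exI[of _ 0]) auto
    show "{b / (1 - t) |b t. b \<in> Q \<and> t \<in> Q} \<subseteq> {b / (1 - t) |b t. b \<in> B \<and> t \<in> Q}"
      using D(10) by blast
    show "1 \<notin> {b / (1 - t) |b t. b \<in> Q \<and> t \<in> Q}"
    proof
      assume "1 \<in> {b / (1 - t) |b t. b \<in> Q \<and> t \<in> Q}"
      then obtain b t where "b \<in> Q" "t \<in> Q" "1 = b / (1 - t)" by blast
      then have "1 = b + t" using nz[of t] by (simp add: field_simps)
      then show False using D(4) D(11)[OF \<open>b \<in> Q\<close> \<open>t \<in> Q\<close>] by simp
    qed
  next
    fix x y assume "x \<in> {b / (1 - t) |b t. b \<in> B \<and> t \<in> Q}" "y \<in> {b / (1 - t) |b t. b \<in> B \<and> t \<in> Q}"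
    then obtain b1 t1 b2 t2 where *: "b1 \<in> B" "t1 \<in> Q" "b2 \<in> B" "t2 \<in> Q"
      "x = b1 / (1 - t1)" "y = b2 / (1 - t2)" by blast
    obtain t where t: "t \<in> Q" "(1 - t1) * (1 - t2) = 1 - t" using frac * by blast
    have "x - y = (b1 * (1 - t2) - b2 * (1 - t1)) / (1 - t)"
      unfolding t(2)[symmetric] using * nz[of t1] nz[of t2] by (simp add: diff_frac_eq)
    moreover have "b1 * (1 - t2) - b2 * (1 - t1) \<in> B" using * D inB by auto
    ultimately show "x - y \<in> {b / (1 - t) |b t. b \<in> B \<and> t \<in> Q}" using t by blast
    have "x * y = (b1 * b2) / (1 - t)" unfolding t(2)[symmetric] using * by simp
    then show "x * y \<in> {b / (1 - t) |b t. b \<in> B \<and> t \<in> Q}" using t * D(7) by blast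
  next
    fix x y assume "x \<in> {b / (1 - t) |b t. b \<in> Q \<and> t \<in> Q}" "y \<in> {b / (1 - t) |b t. b \<in> Q \<and> t \<in> Q}"
    then obtain b1 t1 b2 t2 where *: "b1 \<in> Q" "t1 \<in> Q" "b2 \<in> Q" "t2 \<in> Q"
      "x = b1 / (1 - t1)" "y = b2 / (1 - t2)" by blast
    obtain t where t: "t \<in> Q" "(1 - t1) * (1 - t2) = 1 - t" using frac * by blast
    have "x + y = (b1 * (1 - t2) + b2 * (1 - t1)) / (1 - t)"
      unfolding t(2)[symmetric] using * nz[of t1] nz[of t2] by (simp add: add_frac_eq)
    moreover have "b1 * (1 - t2) + b2 * (1 - t1) \<in> Q" using * D inB by auto
    ultimately show "x + y \<in> {b / (1 - t) |b t. b \<in> Q \<and> t \<in> Q}" using t by blast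
  next
    fix x y assume "x \<in> {b / (1 - t) |b t. b \<in> B \<and> t \<in> Q}" "y \<in> {b / (1 - t) |b t. b \<in> Q \<and> t \<in> Q}"
    then obtain b1 t1 b2 t2 where *: "b1 \<in> B" "t1 \<in> Q" "b2 \<in> Q" "t2 \<in> Q"
      "x = b1 / (1 - t1)" "y = b2 / (1 - t2)" by blast
    obtain t where t: "t \<in> Q" "(1 - t1) * (1 - t2) = 1 - t" using frac * by blast
    have "x * y = (b1 * b2) / (1 - t)" unfolding t(2)[symmetric] using * by simp
    then show "x * y \<in> {b / (1 - t) |b t. b \<in> Q \<and> t \<in> Q}" using t * D(12) by blast
  qed
qed

text \<open>Multiplying the second relation by \<open>y ^ n\<close> expresses \<open>y ^ n\<close> by lower powers of \<open>y\<close>.\<close>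

lemma lower_degree_relation:
  fixes y z e :: "'b::field"
  assumes yz: "y * z = 1" and e: "(1 - r 0) * e = 1" and "m \<le> n"
    and a: "(\<Sum>i\<le>n. a i * y ^ i) = 1" and r: "(\<Sum>j\<le>m. r j * z ^ j) = 1"
  shows "(\<Sum>i<n. (a i + a n * e * (if n - i \<le> m then r (n - i) else 0)) * y ^ i) = 1"
proof -
  define r' where "r' j = (if j \<le> m then r j else 0)" for j
  have "(\<Sum>j\<le>n. r' j * z ^ j) = (\<Sum>j\<le>m. r j * z ^ j)"
    using \<open>m \<le> n\<close> by (intro sum.mono_neutral_cong_right) (auto simp: r'_def)
  then have "1 = r 0 + (\<Sum>j\<in>{..n} - {0}. r' j * z ^ j)"
    using r by (simp add: sum.remove[of "{..n}" 0] r'_def)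
  then have "1 - r 0 = (\<Sum>j\<in>{..n} - {0}. r' j * z ^ j)"
    by (simp add: algebra_simps)
  then have "(1 - r 0) * y ^ n = (\<Sum>j\<in>{..n} - {0}. r' j * z ^ j) * y ^ n"
    by (rule arg_cong)
  also have "\<dots> = (\<Sum>j\<in>{..n} - {0}. r' j * y ^ (n - j))"
    unfolding sum_distrib_right
  proof (rule sum.cong)
    fix j assume "j \<in> {..n} - {0}"
    then have "y ^ n = y ^ j * y ^ (n - j)" by (simp flip: power_add)
    moreover have "z ^ j * y ^ j = 1" using yz by (simp add: mult.commute flip: power_mult_distrib)
    ultimately show "r' j * z ^ j * y ^ n = r' j * y ^ (n - j)"
      by (metis (no_types, lifting) mult.assoc mult.left_neutral)
  qed simp
  also have "\<dots> = (\<Sum>i<n. r' (n - i) * y ^ i)"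
    by (rule sum.reindex_bij_witness[of _ "\<lambda>i. n - i" "\<lambda>i. n - i"]) auto
  finally have "(1 - r 0) * e * y ^ n = e * (\<Sum>i<n. r' (n - i) * y ^ i)"
    by (metis mult.assoc mult.commute)
  then have yn: "y ^ n = e * (\<Sum>i<n. r' (n - i) * y ^ i)" using e by simp
  have "1 = (\<Sum>i<n. a i * y ^ i) + a n * y ^ n"
    using a by (simp add: lessThan_Suc_atMost[symmetric])
  also have "\<dots> = (\<Sum>i<n. (a i + a n * e * r' (n - i)) * y ^ i)"
    unfolding yn by (simp add: sum.distrib sum_distrib_left algebra_simps)
  finally show ?thesis by (simp add: r'_def)
qed

text \<open>Suppose a maximal pair has \<open>y \<notin> B\<close> and
  \<open>1/y \<notin> Q\<close>. Adjoining \<open>y\<close> would enlarge \<open>B\<close> and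
  adjoining \<open>1/y\<close> would enlarge \<open>Q\<close>, so both adjunctions destroy
  properness: 1 is a polynomial in \<open>y\<close> with coefficients in \<open>Q\<close>, and a
  polynomial in \<open>1/y\<close> over \<open>B\<close> with constant coefficient in
  \<open>Q\<close>. Of two shortest such relations, one can be shortened by means of the
  other.\<close>

theorem dominating_valuation_pair_exists:
  fixes B0 Q0 :: "'b::field set"
  assumes "proper_ideal_of B0 Q0"
  obtains B Q where "valuation_pair B Q" "B0 \<subseteq> B" "Q0 \<subseteq> Q"
proof -
  \<comment> \<open>A pair \<open>(B, Q)\<close> is coded as the set \<open>B <+> Q\<close>, so that Zorn's lemma for inclusion applies.\<close>
  define \<A> :: "('b + 'b) set set" where
    "\<A> = {Z. proper_ideal_of (Inl -` Z) (Inr -` Z) \<and> B0 \<subseteq> Inl -` Z \<and> Q0 \<subseteq> Inr -` Z}"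
  have "\<exists>M\<in>\<A>. \<forall>Z\<in>\<A>. M \<subseteq> Z \<longrightarrow> Z = M"
  proof (rule subset_Zorn_nonempty)
    have "B0 <+> Q0 \<in> \<A>"
    proof -
      have "Inl -` (B0 <+> Q0) = B0" "Inr -` (B0 <+> Q0) = Q0" by auto
      then show ?thesis using assms by (simp add: \<A>_def)
    qed
    then show "\<A> \<noteq> {}" by blast
    fix C assume C: "C \<noteq> {}" "subset.chain \<A> C"
    have two: "\<exists>Z\<in>C. x \<in> Z \<and> y \<in> Z" if "x \<in> \<Union>C" "y \<in> \<Union>C" for x y
      using that C(2) unfolding subset.chain_def by blast
    have pr: "proper_ideal_of (Inl -` Z) (Inr -` Z)" if "Z \<in> C" for Z
      using C(2) that by (auto simp: \<A>_def subset.chain_def)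
    obtain Z0 where Z0: "Z0 \<in> C" using C by blast
    have "proper_ideal_of (Inl -` \<Union>C) (Inr -` \<Union>C)"
      unfolding proper_ideal_of_def
    proof (intro conjI ballI)
      show "1 \<in> Inl -` \<Union>C" "0 \<in> Inr -` \<Union>C"
        using proper_ideal_ofD(1,3)[OF pr[OF Z0]] Z0 by auto
      show "1 \<notin> Inr -` \<Union>C" using proper_ideal_ofD(4)[OF pr] by auto
      show "Inr -` \<Union>C \<subseteq> Inl -` \<Union>C" using proper_ideal_ofD(10)[OF pr] by fast
    next
      fix x y assume "x \<in> Inl -` \<Union>C" "y \<in> Inl -` \<Union>C"
      then obtain Z where Z: "Z \<in> C" "x \<in> Inl -` Z" "y \<in> Inl -` Z" using two[of "Inl x" "Inl y"] by auto
      show "x - y \<in> Inl -` \<Union>C" "x * y \<in> Inl -` \<Union>C"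
        using proper_ideal_ofD(6,7)[OF pr[OF Z(1)] Z(2,3)] Z(1) by auto
    next
      fix x y assume "x \<in> Inr -` \<Union>C" "y \<in> Inr -` \<Union>C"
      then obtain Z where Z: "Z \<in> C" "x \<in> Inr -` Z" "y \<in> Inr -` Z" using two[of "Inr x" "Inr y"] by auto
      show "x + y \<in> Inr -` \<Union>C" using proper_ideal_ofD(11)[OF pr[OF Z(1)] Z(2,3)] Z(1) by auto
    next
      fix x y assume "x \<in> Inl -` \<Union>C" "y \<in> Inr -` \<Union>C"
      then obtain Z where Z: "Z \<in> C" "x \<in> Inl -` Z" "y \<in> Inr -` Z" using two[of "Inl x" "Inr y"] by auto
      show "x * y \<in> Inr -` \<Union>C" using proper_ideal_ofD(12)[OF pr[OF Z(1)] Z(2,3)] Z(1) by auto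
    qed
    moreover have "Z0 \<in> \<A>" using C(2) Z0 by (auto simp: subset.chain_def)
    then have "B0 \<subseteq> Inl -` \<Union>C" "Q0 \<subseteq> Inr -` \<Union>C"
      using Z0 unfolding \<A>_def by blast+
    ultimately show "\<Union>C \<in> \<A>" by (simp add: \<A>_def)
  qed
  then obtain M where M: "M \<in> \<A>" and max: "\<And>Z. Z \<in> \<A> \<Longrightarrow> M \<subseteq> Z \<Longrightarrow> Z = M" by blast
  define B Q where "B = Inl -` M" and "Q = Inr -` M"
  have BQ: "proper_ideal_of B Q" and sub: "B0 \<subseteq> B" "Q0 \<subseteq> Q"
    using M by (auto simp: \<A>_def B_def Q_def)
  note D = proper_ideal_ofD[OF BQ]
  have maximal: "B' = B \<and> Q' = Q" if "proper_ideal_of B' Q'" "B \<subseteq> B'" "Q \<subseteq> Q'" for B' Q'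
  proof -
    have eq: "Inl -` (B' <+> Q') = B'" "Inr -` (B' <+> Q') = Q'" by auto
    have "M \<subseteq> B' <+> Q'"
    proof
      fix x assume "x \<in> M"
      then show "x \<in> B' <+> Q'" using that(2,3) by (cases x) (auto simp: B_def Q_def)
    qed
    moreover have "B' <+> Q' \<in> \<A>" using that sub by (auto simp: \<A>_def eq)
    ultimately have "B' <+> Q' = M" using max by blast
    then show ?thesis using eq by (simp add: B_def Q_def)
  qed
  have unit: "\<exists>e\<in>B. (1 - t) * e = 1" if t: "t \<in> Q" for t
  proof -
    have "{b / (1 - t) |b t. b \<in> B \<and> t \<in> Q} = B"
    proof -
      have "b \<in> {b / (1 - t) |b t. b \<in> A \<and> t \<in> Q}" if "b \<in> A" for b A
        using that D(3) by (intro CollectI exI[of _ b] exI[of _ 0]) simp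
      then show ?thesis using maximal[OF proper_ideal_of_localize[OF BQ]] by blast
    qed
    then have "1 / (1 - t) \<in> B" using t D(1) by blast
    moreover have "(1 - t) * (1 / (1 - t)) = 1" using t D(4) by auto
    ultimately show ?thesis by blast
  qed
  have "inverse y \<in> Q" if y: "y \<notin> B" for y
  proof (rule ccontr)
    define z where "z = inverse y"
    assume "inverse y \<notin> Q"
    then have z: "z \<notin> Q" by (simp add: z_def)
    have "y \<noteq> 0" using y D(2) by metis
    then have yz: "y * z = 1" by (simp add: z_def)
    define P where "P n \<longleftrightarrow> (\<exists>a. (\<forall>i. a i \<in> Q) \<and> (\<Sum>i\<le>n. a i * y ^ i) = 1)" for n :: nat
    define P' where
      "P' n \<longleftrightarrow> (\<exists>r. r 0 \<in> Q \<and> (\<forall>i. r i \<in> B) \<and> (\<Sum>i\<le>n. r i * z ^ i) = 1)" for n :: nat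
    have const: "B \<subseteq> (\<lambda>p. poly p x) ` polys_over B" for x
    proof
      fix b assume "b \<in> B"
      then show "b \<in> (\<lambda>p. poly p x) ` polys_over B"
        using D(2) by (intro image_eqI[of _ _ "[:b:]"]) (auto simp: polys_over_def coeff_pCons split: nat.splits)
    qed
    have var: "x \<in> (\<lambda>p. poly p x) ` {p \<in> polys_over B. Polynomial.coeff p 0 \<in> Q}" for x
      using D(1-3) by (intro image_eqI[of _ _ "[:0, 1:]"]) (auto simp: polys_over_def coeff_pCons split: nat.splits)
    have constQ: "Q \<subseteq> (\<lambda>p. poly p x) ` {p \<in> polys_over U. Polynomial.coeff p 0 \<in> Q}"
      if "U = Q \<or> U = B" for x U
    proof
      fix b assume b: "b \<in> Q"
      then have "[:b:] \<in> polys_over U"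
        using that D(2,3,10) by (auto simp: polys_over_def coeff_pCons split: nat.splits)
      with b show "b \<in> (\<lambda>p. poly p x) ` {p \<in> polys_over U. Polynomial.coeff p 0 \<in> Q}"
        by (intro image_eqI[of _ _ "[:b:]"]) auto
    qed
    have "\<exists>n. P n"
    proof (rule ccontr)
      assume no: "\<nexists>n. P n"
      have "poly p y \<noteq> 1" if "p \<in> polys_over Q" for p
        using no that unfolding P_def polys_over_def poly_altdef by blast
      then have "(\<lambda>p. poly p y) ` polys_over B = B"
        using maximal[OF proper_ideal_of_adjoin[OF BQ, of Q y]] const constQ by blast
      then show False using y var[of y] by auto
    qed
    moreover have "\<exists>n. P' n"
    proof (rule ccontr)
      assume no: "\<nexists>n. P' n"
      have "poly p z \<noteq> 1" if "p \<in> polys_over B" "Polynomial.coeff p 0 \<in> Q" for p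
        using no that unfolding P'_def polys_over_def poly_altdef by blast
      then have "(\<lambda>p. poly p z) ` {p \<in> polys_over B. Polynomial.coeff p 0 \<in> Q} = Q"
        using maximal[OF proper_ideal_of_adjoin[OF BQ, of B z]] const constQ by blast
      then show False using z var[of z] by auto
    qed
    moreover define n m where "n = (LEAST n. P n)" and "m = (LEAST n. P' n)"
    ultimately have "P n" "P' m" by (auto intro: LeastI_ex)
    then obtain a r where a: "\<And>i. a i \<in> Q" "(\<Sum>i\<le>n. a i * y ^ i) = 1"
      and r: "r 0 \<in> Q" "\<And>i. r i \<in> B" "(\<Sum>i\<le>m. r i * z ^ i) = 1"
      by (auto simp: P_def P'_def)
    show False
    proof (cases "m \<le> n")
      case True
      obtain e where e: "e \<in> B" "(1 - r 0) * e = 1" using unit r by blast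
      \<comment> \<open>Every correction carries the factor \<open>a n \<in> Q\<close>, so the
        shorter relation still has all coefficients in \<open>Q\<close>.\<close>
      define a' where "a' i = a i + a n * e * (if n - i \<le> m then r (n - i) else 0)" for i
      have s: "(\<Sum>i<n. a' i * y ^ i) = 1"
        unfolding a'_def by (rule lower_degree_relation) (use yz e True a r in auto)
      then obtain n' where n': "n = Suc n'" by (cases n) auto
      moreover have "a' i \<in> Q" for i using a r e D by (auto simp: a'_def)
      ultimately have "P n'" using s by (auto simp: P_def lessThan_Suc_atMost)
      then show False using not_less_Least[of n' P] n' by (simp add: n_def)
    next
      case False
      obtain e where e: "e \<in> B" "(1 - a 0) * e = 1" using unit a by blast
      \<comment> \<open>Here \<open>n < m\<close>, so the correction at \<open>i = 0\<close>
        vanishes and the constant coefficient \<open>r 0\<close> stays in \<open>Q\<close>.\<close>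
      define a' where "a' i = r i + r m * e * (if m - i \<le> n then a (m - i) else 0)" for i
      have s: "(\<Sum>i<m. a' i * z ^ i) = 1"
        unfolding a'_def by (rule lower_degree_relation) (use yz e False a r in \<open>auto simp: mult.commute\<close>)
      then obtain m' where m': "m = Suc m'" by (cases m) auto
      moreover have "a' i \<in> B" for i using a r e D by (auto simp: a'_def)
      moreover have "a' 0 \<in> Q" using a r e D by (auto simp: a'_def)
      ultimately have "P' m'" using s by (auto simp: P'_def lessThan_Suc_atMost)
      then show False using not_less_Least[of m' P'] m' by (simp add: m_def)
    qed
  qed
  then show ?thesis using that[of B Q] BQ sub by (auto simp: valuation_pair_def)
qed

section \<open>Extensions of a valuation from valuation rings\<close>

lemma valuation_on_divide:
  fixes v :: "'b::field \<Rightarrow> 'g::linordered_ab_group_add extended"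
  assumes v: "valuation_on F v" "is_subfield F" and xy: "x \<in> F" "y \<in> F" "y \<noteq> 0"
  shows "0 \<le> v (x / y) \<longleftrightarrow> v y \<le> v x" "0 < v (x / y) \<longleftrightarrow> v y < v x"
proof -
  have F: "x / y \<in> F" using v(2) xy by (auto simp: is_subfield_def divide_inverse)
  have "v (x / y * y) = v (x / y) + v y" using v(1) xy F unfolding valuation_on_def by blast
  then have eq: "v x = v (x / y) + v y" using xy by simp
  have "v y \<noteq> Pinf" "v y \<noteq> Minf" "v (x / y) \<noteq> Minf"
    using v(1) xy F by (auto simp: valuation_on_def)
  then obtain g where "v y = Fin g" by (cases "v y") auto
  with eq \<open>v (x / y) \<noteq> Minf\<close> show "0 \<le> v (x / y) \<longleftrightarrow> v y \<le> v x" "0 < v (x / y) \<longleftrightarrow> v y < v x"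
    by (cases "v (x / y)"; simp add: zero_extended_def)+
qed

lemma is_subfield_UNIV: "is_subfield (UNIV :: 'b::field set)"
  by (simp add: is_subfield_def)

text \<open>The nonzero terms of an algebraic equation of \<open>x\<close> sum to 0 and are totally
  ordered by divisibility in \<open>B\<close>. If a term dividing all the others had no associate
  among them, division by it would put 1 into \<open>Q\<close>. Two associated terms
  \<open>t i\<close> and \<open>t j\<close> make a power of \<open>x\<close> associated to a
  constant.\<close>

lemma valuation_pair_torsion:
  fixes B Q :: "'a::field alg_closure set"
  assumes BQ: "valuation_pair B Q" and x: "x \<noteq> 0"
  obtains n c where "0 < n" "c \<noteq> 0" "x ^ n / to_ac c \<in> B" "to_ac c / x ^ n \<in> B"
proof -
  note goal = that
  note D = proper_ideal_ofD[of B Q]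
  have P: "proper_ideal_of B Q" and inv: "\<And>y. y \<notin> B \<Longrightarrow> inverse y \<in> Q"
    using BQ by (auto simp: valuation_pair_def)
  obtain p :: "'a poly" where p: "p \<noteq> 0" "poly (map_poly to_ac p) x = 0"
    using alg_closure_algebraic by blast
  define t where "t = (\<lambda>i. to_ac (Polynomial.coeff p i) * x ^ i)"
  define S where "S = {i. i \<le> Polynomial.degree p \<and> Polynomial.coeff p i \<noteq> 0}"
  have "sum t S = (\<Sum>i\<le>Polynomial.degree p. t i)"
    by (rule sum.mono_neutral_left) (auto simp: S_def t_def)
  also have "\<dots> = 0"
    using p(2) by (simp add: poly_altdef degree_map_poly coeff_map_poly t_def)
  finally have sum0: "sum t S = 0" .
  have S: "finite S" "S \<noteq> {}"
    using p(1) by (auto simp: S_def intro: exI[of _ "Polynomial.degree p"])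
  have t0: "t i \<noteq> 0" if "i \<in> S" for i
    using that x by (auto simp: t_def S_def)
  have "\<exists>i\<in>T. \<forall>j\<in>T. t j / t i \<in> B" if "finite T" "T \<noteq> {}" "T \<subseteq> S" for T
    using that
  proof (induction T rule: finite_ne_induct)
    case (singleton i)
    then show ?case using t0[of i] D(1)[OF P] by auto
  next
    case (insert k T)
    then obtain i where i: "i \<in> T" "\<And>j. j \<in> T \<Longrightarrow> t j / t i \<in> B" by auto
    have nz: "t i \<noteq> 0" "t k \<noteq> 0" using t0 i insert.prems by auto
    show ?case
    proof (cases "t k / t i \<in> B")
      case True
      then show ?thesis using i by auto
    next
      case False
      then have ik: "t i / t k \<in> B" using inv[OF False] D(10)[OF P] by simp
      have "t j / t k \<in> B" if "j \<in> T" for j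
        using D(7)[OF P i(2)[OF that] ik] nz by simp
      then show ?thesis using D(1)[OF P] nz by auto
    qed
  qed
  then obtain i where i: "i \<in> S" "\<And>j. j \<in> S \<Longrightarrow> t j / t i \<in> B" using S(1,2)
    by (metis subset_refl)
  have "\<exists>j\<in>S. j \<noteq> i \<and> t i / t j \<in> B"
  proof (rule ccontr)
    assume no: "\<not> ?thesis"
    have "t j / t i \<in> Q" if "j \<in> S - {i}" for j
      using inv[of "t i / t j"] that no by auto
    then have q: "(\<Sum>j\<in>S - {i}. t j / t i) \<in> Q" using D(3,11)[OF P] by (intro sum_in_additive) auto
    have "0 = (\<Sum>j\<in>S. t j / t i)" using sum0 by (simp flip: sum_divide_distrib)
    also have "\<dots> = 1 + (\<Sum>j\<in>S - {i}. t j / t i)" using i S t0 by (simp add: sum.remove)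
    finally have "- (\<Sum>j\<in>S - {i}. t j / t i) = 1" by (simp add: add_eq_0_iff)
    then show False using D(14)[OF P q] D(4)[OF P] by simp
  qed
  then obtain j where j: "j \<in> S" "j \<noteq> i" "t i / t j \<in> B" by blast
  have main: thesis if "i \<in> S" "j \<in> S" "i < j" "t j / t i \<in> B" "t i / t j \<in> B" for i j
  proof -
    let ?a = "Polynomial.coeff p i" and ?b = "Polynomial.coeff p j"
    have nz: "?a \<noteq> 0" "?b \<noteq> 0" using that by (auto simp: S_def)
    have xj: "x ^ j = x ^ i * x ^ (j - i)" using \<open>i < j\<close> by (simp flip: power_add)
    have "t j / t i = x ^ (j - i) / to_ac (?a / ?b)" "t i / t j = to_ac (?a / ?b) / x ^ (j - i)"
      using nz x by (simp_all add: t_def xj field_simps)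
    then show thesis using that nz goal[of "j - i" "?a / ?b"] by simp
  qed
  show thesis
    using main[of i j] main[of j i] i j by (cases "i < j") auto
qed

text \<open>
  By the torsion lemma, the value of \<open>x\<close> can only be \<open>v c / n\<close> when \<open>x ^ n\<close> and \<open>c\<close> are associated
  in \<open>B\<close>; this determines the extension inside the divisible hull.
\<close>

theorem valuation_pair_extension:
  fixes v :: "'a::field \<Rightarrow> 'g::linordered_ab_group_add extended"
  assumes v: "valuation_on UNIV v"
    and BQ: "valuation_pair B Q"
    and RB: "\<And>c. 0 \<le> v c \<Longrightarrow> to_ac c \<in> B" and MQ: "\<And>c. 0 < v c \<Longrightarrow> to_ac c \<in> Q"
    and L: "is_subfield L" "range to_ac \<subseteq> L"
  obtains w where "w \<in> val_extensions v L"
    "\<And>x. x \<in> L \<Longrightarrow> 0 \<le> w x \<longleftrightarrow> x \<in> B" "\<And>x. x \<in> L \<Longrightarrow> 0 < w x \<longleftrightarrow> x \<in> Q"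
proof -
  have P: "proper_ideal_of B Q" and inv: "\<And>y. y \<notin> B \<Longrightarrow> inverse y \<in> Q"
    using BQ by (auto simp: valuation_pair_def)
  note D = proper_ideal_ofD[OF P]
  note U = is_subfield_UNIV
  note vpow = valuation_on_power[OF v U UNIV_I]
  have vM: "v x \<noteq> Minf" for x using v by (simp add: valuation_on_def)
  have vinf: "v x = Pinf \<longleftrightarrow> x = 0" for x using v by (simp add: valuation_on_def)
  have notB: "x \<notin> B" if "inverse x \<in> Q" "x \<noteq> 0" for x
  proof
    assume "x \<in> B"
    then have "x * inverse x \<in> Q" using that D(12) by blast
    then show False using that D(4) by simp
  qed
  have acB: "to_ac c / to_ac d \<in> B \<longleftrightarrow> v d \<le> v c" if "d \<noteq> 0" for c d
  proof -
    have "to_ac c \<in> B \<longleftrightarrow> 0 \<le> v c" for c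
    proof (cases "0 \<le> v c")
      case False
      then have "c \<noteq> 0" using vinf[of 0] by auto
      then have "0 < v (1 / c)"
        using False valuation_on_divide(2)[OF v U, of 1 c] valuation_on_one[OF v U] by simp
      then show ?thesis using MQ[of "1 / c"] notB[of "to_ac c"] \<open>c \<noteq> 0\<close> False by (simp add: inverse_eq_divide)
    qed (use RB in auto)
    from this[of "c / d"] show ?thesis using valuation_on_divide(1)[OF v U, of c d] that by simp
  qed
  \<comment> \<open>Associates in \<open>B\<close>, the relation that will become equality of
    values. As division by 0 yields 0, every element is related to 0, hence the side condition on
    the middle term of \<open>eqv_trans\<close>.\<close>
  define eqv where "eqv x y \<longleftrightarrow> x / y \<in> B \<and> y / x \<in> B" for x y :: "'a alg_closure"
  have eqv_mult: "eqv (x * y) (x' * y')" if "eqv x x'" "eqv y y'" for x y x' y'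
    using that D(7)[of "x / x'" "y / y'"] D(7)[of "x' / x" "y' / y"] by (simp add: eqv_def)
  have eqv_sym: "eqv x y \<Longrightarrow> eqv y x" for x y by (simp add: eqv_def)
  have eqv_trans: "eqv x z" if "eqv x y" "eqv y z" "y \<noteq> 0" for x y z
    using that D(7)[of "x / y" "y / z"] D(7)[of "z / y" "y / x"] by (simp add: eqv_def)
  have eqv_power: "eqv (x ^ n) (y ^ n)" if "eqv x y" for x y n
    using that D(1) eqv_mult by (induction n) (auto simp: eqv_def)
  have eqv_ac: "eqv (to_ac c) (to_ac d) \<longleftrightarrow> v c = v d" if "c \<noteq> 0" "d \<noteq> 0" for c d
    using that acB by (auto simp: eqv_def intro: antisym)
  \<comment> \<open>An element outside \<open>B\<close> has its inverse in \<open>Q\<close>, and so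
    have its powers. This lets exponents be stripped when values are compared.\<close>
  have root: "x ^ n \<in> B \<longleftrightarrow> x \<in> B" if "0 < n" for x n
  proof (cases "x \<in> B")
    case False
    then have "x \<noteq> 0" using D(2) by metis
    have i: "inverse x \<in> Q" using inv False by blast
    have "inverse x ^ Suc k \<in> Q" for k
      by (induction k) (use i D in auto)
    from this[of "n - 1"] have "inverse (x ^ n) \<in> Q" using that by (simp add: power_inverse)
    then show ?thesis using notB[of "x ^ n"] \<open>x \<noteq> 0\<close> False by simp
  qed (use D in auto)
  \<comment> \<open>The admissible values of \<open>x\<close>: every presentation of a power
    \<open>x ^ n\<close> as an associate of a constant \<open>c\<close> must give the same quotient
    \<open>v c / n\<close>.\<close>
  define good where "good x z \<longleftrightarrow> z \<noteq> Minf \<and>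
      (\<forall>n c. 0 < n \<longrightarrow> c \<noteq> 0 \<longrightarrow> eqv (x ^ n) (to_ac c) \<longrightarrow> nmul n z = hull_ext (v c))" for x z
  have "\<exists>z. good x z" if x: "x \<noteq> 0" for x
  proof -
    obtain n c where nc: "0 < n" "c \<noteq> 0" "eqv (x ^ n) (to_ac c)"
      using valuation_pair_torsion[OF BQ x] unfolding eqv_def by blast
    have "v c \<noteq> Pinf" using vinf nc(2) by simp
    then obtain g where g: "v c = Fin g" using vM[of c] by (cases "v c") auto
    obtain z where "nmul n z = to_hull g"
      using to_hull_divisible[OF nc(1)] by blast
    then have z: "nmul n (Fin z) = hull_ext (v c)" using g by (simp add: nmul_Fin)
    have "nmul m (Fin z) = hull_ext (v d)"
      if md: "0 < m" "d \<noteq> 0" "eqv (x ^ m) (to_ac d)" for m d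
    proof -
      \<comment> \<open>Two presentations \<open>(n, c)\<close> and \<open>(m, d)\<close> are
        compared at the common power \<open>x ^ (n * m)\<close>; the factor \<open>n\<close> is
        cancelled at the end because the hull is torsion-free.\<close>
      have "eqv ((x ^ n) ^ m) (to_ac (c ^ m))" "eqv ((x ^ m) ^ n) (to_ac (d ^ n))"
        using eqv_power nc(3) md(3) by auto
      then have "eqv (to_ac (c ^ m)) (to_ac (d ^ n))"
        using eqv_trans[OF eqv_sym, of "(x ^ n) ^ m" "to_ac (c ^ m)" "to_ac (d ^ n)"] x
        by (simp add: mult.commute flip: power_mult)
      then have "v (c ^ m) = v (d ^ n)"
        using eqv_ac[of "c ^ m" "d ^ n"] nc md by simp
      then have "nmul n (nmul m (Fin z)) = nmul n (hull_ext (v d))"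
        by (simp only: vpow nmul_comm[of n m] z flip: hull_ext_nmul)
      moreover have "nmul m (Fin z) \<noteq> Minf" by (simp add: nmul_Fin)
      moreover have "hull_ext (v d) \<noteq> Minf"
        using vM[of d] by (cases "v d") auto
      ultimately show ?thesis
        using nc(1) by (simp add: nmul_ext_eq_iff)
    qed
    then have "good x (Fin z)" by (auto simp: good_def)
    then show ?thesis by blast
  qed
  then obtain w0 where w0: "\<And>x. x \<noteq> 0 \<Longrightarrow> good x (w0 x)" by metis
  define w' where "w' x = (if x = 0 then Pinf else w0 x)" for x
  have w'0: "w' 0 = Pinf" by (simp add: w'_def)
  have w'1: "w' x \<noteq> Minf" for x
    using w0[of x] by (auto simp: w'_def good_def)
  have w'2: "nmul n (w' x) = hull_ext (v c)"
    if "0 < n" "c \<noteq> 0" "eqv (x ^ n) (to_ac c)" "x \<noteq> 0" for x n c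
    using w0[of x] that by (auto simp: w'_def good_def)
  have w'3: "w' x \<noteq> Pinf" if x: "x \<noteq> 0" for x
  proof
    assume inf: "w' x = Pinf"
    obtain n c where nc: "0 < n" "c \<noteq> 0" "eqv (x ^ n) (to_ac c)"
      using valuation_pair_torsion[OF BQ x] unfolding eqv_def by blast
    have "v c \<noteq> Pinf" using vinf nc(2) by simp
    then show False using w'2[OF nc x] inf nc(1) by (cases "v c") (auto simp: nmul_Pinf)
  qed
  \<comment> \<open>The order of values has to be divisibility in \<open>B\<close>. At the common
    exponent \<open>m * n\<close> both values come from the base field, where \<open>acB\<close>
    decides.\<close>
  have le0: "w' x \<le> w' y \<longleftrightarrow> y / x \<in> B" if x: "x \<noteq> 0" and y: "y \<noteq> 0" for x y
  proof -
    obtain n c where nc: "0 < n" "c \<noteq> 0" "eqv (x ^ n) (to_ac c)"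
      using valuation_pair_torsion[OF BQ x] unfolding eqv_def by blast
    obtain m d where md: "0 < m" "d \<noteq> 0" "eqv (y ^ m) (to_ac d)"
      using valuation_pair_torsion[OF BQ y] unfolding eqv_def by blast
    have "w' x \<le> w' y \<longleftrightarrow> nmul (m * n) (w' x) \<le> nmul (m * n) (w' y)"
      using nc md w'1[of x] w'1[of y] by (simp add: nmul_ext_le_iff)
    also have "nmul (m * n) (w' x) = hull_ext (v (c ^ m))"
      by (simp add: nmul_mult w'2[OF nc x] vpow hull_ext_nmul)
    also have "nmul (m * n) (w' y) = hull_ext (v (d ^ n))"
      by (simp add: nmul_mult nmul_comm[of m] w'2[OF md y] vpow hull_ext_nmul)
    also have "hull_ext (v (c ^ m)) \<le> hull_ext (v (d ^ n)) \<longleftrightarrow> to_ac (d ^ n) / to_ac (c ^ m) \<in> B"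
      using nc by (subst acB) (auto simp: hull_ext_le_iff)
    also have "\<dots> \<longleftrightarrow> (y / x) ^ (m * n) \<in> B"
    proof -
      have "eqv ((x ^ n) ^ m) (to_ac (c ^ m))" "eqv ((y ^ m) ^ n) (to_ac (d ^ n))"
        using eqv_power nc(3) md(3) by auto
      then have "eqv (y ^ (m * n)) (to_ac (d ^ n))" "eqv (inverse (x ^ (m * n))) (inverse (to_ac (c ^ m)))"
        by (auto simp: mult.commute eqv_def divide_inverse simp flip: power_mult)
      then have "eqv ((y / x) ^ (m * n)) (to_ac (d ^ n) / to_ac (c ^ m))"
        using eqv_mult[of "y ^ (m * n)" "to_ac (d ^ n)" "inverse (x ^ (m * n))" "inverse (to_ac (c ^ m))"]
        by (simp add: divide_inverse power_mult_distrib power_inverse)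
      then show ?thesis
        using D(7)[of "(y / x) ^ (m * n)" "(to_ac (d ^ n) / to_ac (c ^ m)) / (y / x) ^ (m * n)"]
          D(7)[of "to_ac (d ^ n) / to_ac (c ^ m)" "(y / x) ^ (m * n) / (to_ac (d ^ n) / to_ac (c ^ m))"]
          x y nc md
        by (auto simp: eqv_def)
    qed
    also have "\<dots> \<longleftrightarrow> y / x \<in> B" using root nc md by simp
    finally show ?thesis .
  qed
  have ext: "w' (to_ac a) = hull_ext (v a)" for a
  proof (cases "a = 0")
    case True
    then show ?thesis using vinf[of 0] w'0 by simp
  next
    case False
    then show ?thesis using w'2[of 1 a "to_ac a"] D(1) by (simp add: eqv_def)
  qed
  have inf: "w' x = Pinf \<longleftrightarrow> x = 0" for x
    using w'0 w'3 by auto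
  have mult: "w' (x * y) = w' x + w' y" for x y
  proof (cases "x = 0 \<or> y = 0")
    case True
    then show ?thesis using w'0 w'1[of x] w'1[of y] by (cases "w' x"; cases "w' y") auto
  next
    case False
    then have x: "x \<noteq> 0" and y: "y \<noteq> 0" by auto
    obtain n c where nc: "0 < n" "c \<noteq> 0" "eqv (x ^ n) (to_ac c)"
      using valuation_pair_torsion[OF BQ x] unfolding eqv_def by blast
    obtain m d where md: "0 < m" "d \<noteq> 0" "eqv (y ^ m) (to_ac d)"
      using valuation_pair_torsion[OF BQ y] unfolding eqv_def by blast
    have 1: "eqv (x ^ (m * n)) (to_ac (c ^ m))" "eqv (y ^ (m * n)) (to_ac (d ^ n))"
      using eqv_power[OF nc(3), of m] eqv_power[OF md(3), of n]
      by (simp_all add: mult.commute flip: power_mult)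
    then have "eqv ((x * y) ^ (m * n)) (to_ac (c ^ m * d ^ n))"
      using eqv_mult by (simp only: power_mult_distrib to_ac_mult)
    then have "nmul (m * n) (w' (x * y)) = hull_ext (v (c ^ m * d ^ n))"
      using w'2 nc md x y by simp
    also have "\<dots> = hull_ext (v (c ^ m)) + hull_ext (v (d ^ n))"
      using v by (simp add: valuation_on_def hull_ext_add)
    also have "\<dots> = nmul (m * n) (w' x + w' y)"
      using w'2[OF _ _ 1(1) x] w'2[OF _ _ 1(2) y] nc md by (simp add: nmul_plus)
    finally have "nmul (m * n) (w' (x * y)) = nmul (m * n) (w' x + w' y)" .
    moreover have "w' x + w' y \<noteq> Minf"
      using w'1[of x] w'1[of y] by (cases "w' x"; cases "w' y") auto
    ultimately show ?thesis
      using w'1 nc(1) md(1) nmul_ext_eq_iff[of "m * n" "w' (x * y)" "w' x + w' y"] by simp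
  qed
  have add: "min (w' x) (w' y) \<le> w' (x + y)" for x y
  proof (cases "x = 0 \<or> y = 0 \<or> x + y = 0")
    case True
    then show ?thesis using w'0 by auto
  next
    case False
    then have nz: "x \<noteq> 0" "y \<noteq> 0" "x + y \<noteq> 0" by auto
    have "w' x \<le> w' (x + y) \<or> w' y \<le> w' (x + y)"
    proof (cases "y / x \<in> B")
      case True
      then have "1 + y / x \<in> B" using D by blast
      moreover have "(x + y) / x = 1 + y / x" using nz by (simp add: field_simps)
      ultimately show ?thesis using le0[OF nz(1,3)] by simp
    next
      case False
      then have "x / y \<in> B" using inv[OF False] D(10) by simp
      then have "1 + x / y \<in> B" using D by blast
      moreover have "(x + y) / y = 1 + x / y" using nz by (simp add: field_simps)
      ultimately show ?thesis using le0[OF nz(2,3)] by simp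
    qed
    then show ?thesis by (simp add: min_le_iff_disj)
  qed
  have nonneg: "0 \<le> w' x \<longleftrightarrow> x \<in> B" for x
  proof (cases "x = 0")
    case False
    have "w' 1 = 0" using ext[of 1] valuation_on_one[OF v U] by (simp add: zero_extended_def)
    then show ?thesis using le0[of 1 x] False by simp
  qed (use w'0 D(2) in simp)
  have pos: "0 < w' x \<longleftrightarrow> x \<in> Q" for x
  proof (cases "x = 0")
    case False
    have "w' 1 = 0" using ext[of 1] valuation_on_one[OF v U] by (simp add: zero_extended_def)
    then have "0 < w' x \<longleftrightarrow> inverse x \<notin> B"
      using le0[of x 1] False by (simp add: inverse_eq_divide not_le[symmetric])
    also have "\<dots> \<longleftrightarrow> x \<in> Q" using inv[of "inverse x"] notB[of "inverse x"] False by auto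
    finally show ?thesis .
  qed (use w'0 D(3) in \<open>simp add: zero_extended_def\<close>)
  have acL: "to_ac a \<in> L" for a using L(2) by auto
  have "restrict w' L \<in> val_extensions v L"
    using w'1 inf mult add ext L(1) acL by (auto simp: val_extensions_def valuation_on_def is_subfield_def)
  then show ?thesis using that[of "restrict w' L"] nonneg pos by auto
qed

section \<open>Polynomials evaluated in the algebraic closure\<close>

lemma eval_ac_pCons [simp]: "eval_ac (pCons c p) x = to_ac c + x * eval_ac p x"
  by (cases "p = 0 \<and> c = 0") (auto simp: eval_ac_def map_poly_pCons)

lemma eval_ac_0 [simp]: "eval_ac 0 x = 0"
  by (simp add: eval_ac_def)

lemma eval_ac_1 [simp]: "eval_ac 1 x = 1"
  by (simp add: eval_ac_def)

lemma eval_ac_add [simp]: "eval_ac (p + q) x = eval_ac p x + eval_ac q x"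
  by (induction p q rule: poly_induct2) (simp_all add: algebra_simps)

lemma eval_ac_smult [simp]: "eval_ac (Polynomial.smult c p) x = to_ac c * eval_ac p x"
  by (induction p) (simp_all add: algebra_simps)

lemma eval_ac_minus [simp]: "eval_ac (- p) x = - eval_ac p x"
  using eval_ac_smult[of "-1" p x] by simp

lemma eval_ac_diff [simp]: "eval_ac (p - q) x = eval_ac p x - eval_ac q x"
  using eval_ac_add[of p "- q" x] by simp

lemma eval_ac_mult [simp]: "eval_ac (p * q) x = eval_ac p x * eval_ac q x"
  by (induction p) (simp_all add: algebra_simps)

lemma eval_ac_power [simp]: "eval_ac (p ^ n) x = eval_ac p x ^ n"
  by (induction n) simp_all

lemma eval_ac_prod: "eval_ac (\<Prod>i\<in>S. p i) x = (\<Prod>i\<in>S. eval_ac (p i) x)"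
  by (induction S rule: infinite_finite_induct) simp_all

lemma eval_ac_altdef:
  "eval_ac p x = (\<Sum>i\<le>Polynomial.degree p. to_ac (Polynomial.coeff p i) * x ^ i)"
  by (simp add: eval_ac_def poly_altdef degree_map_poly coeff_map_poly)

lemma eval_ac_in_subring:
  assumes "\<And>c. to_ac c \<in> F" "\<And>a b. a \<in> F \<Longrightarrow> b \<in> F \<Longrightarrow> a + b \<in> F"
    "\<And>a b. a \<in> F \<Longrightarrow> b \<in> F \<Longrightarrow> a * b \<in> F" "x \<in> F"
  shows "eval_ac p x \<in> F"
proof (induction p)
  case 0
  then show ?case using assms(1)[of 0] by simp
qed (use assms in auto)

text \<open>Cancelling powers of \<open>x\<close> from an algebraic equation leaves one with nonzero
  constant coefficient, which can be solved for \<open>1/x\<close>. Hence the polynomials in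
  \<open>x\<close> already form a field.\<close>

lemma inverse_eq_eval_ac:
  fixes x :: "'a::field alg_closure"
  obtains q where "inverse x = eval_ac q x"
proof (cases "x = 0")
  case True
  then show ?thesis using that[of 0] by simp
next
  case False
  have "\<exists>r. eval_ac r x = 0 \<and> Polynomial.coeff r 0 \<noteq> 0" if "q \<noteq> 0" "eval_ac q x = 0" for q
    using that
  proof (induction q)
    case (pCons a q)
    show ?case
    proof (cases "a = 0")
      case True
      then show ?thesis using pCons \<open>x \<noteq> 0\<close> by auto
    next
      case False
      then show ?thesis using pCons by (intro exI[of _ "pCons a q"]) auto
    qed
  qed simp
  moreover obtain q :: "'a poly" where "q \<noteq> 0" "eval_ac q x = 0"
    using alg_closure_algebraic[of x] unfolding eval_ac_def by blast
  ultimately obtain r where r: "eval_ac r x = 0" "Polynomial.coeff r 0 \<noteq> 0" by blast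
  obtain a q where aq: "r = pCons a q" by (cases r)
  have "a \<noteq> 0" "x * eval_ac q x = - to_ac a" using r aq by (auto simp: add_eq_0_iff)
  then have "x * (- eval_ac q x / to_ac a) = 1" by simp
  then have "inverse x = - eval_ac q x / to_ac a" by (rule inverse_unique)
  also have "\<dots> = eval_ac (Polynomial.smult (- 1 / a) q) x" by (simp add: field_simps)
  finally show ?thesis by (rule that)
qed

lemma range_eval_ac_subfield:
  "is_subfield (range (\<lambda>p. eval_ac p \<alpha>))" (is "is_subfield ?F")
proof -
  have add: "a + b \<in> ?F" if "a \<in> ?F" "b \<in> ?F" for a b
    using that by (auto simp flip: eval_ac_add)
  have mult: "a * b \<in> ?F" if "a \<in> ?F" "b \<in> ?F" for a b
    using that by (auto simp flip: eval_ac_mult)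
  have ac: "to_ac c \<in> ?F" for c
    using rangeI[of "\<lambda>p. eval_ac p \<alpha>" "[:c:]"] by simp
  have "inverse x \<in> ?F" if x: "x \<in> ?F" for x
  proof -
    obtain q where "inverse x = eval_ac q x" by (rule inverse_eq_eval_ac)
    then show ?thesis using eval_ac_in_subring[OF ac add mult x] by simp
  qed
  moreover have "- x \<in> ?F" if x: "x \<in> ?F" for x
    using mult[OF ac[of "-1"] x] by simp
  ultimately show ?thesis
    using add mult ac[of 0] ac[of 1] by (simp add: is_subfield_def)
qed

lemma adjoin_field_eq: "adjoin_field \<alpha> = range (\<lambda>p. eval_ac p \<alpha>)"
proof
  have "to_ac c \<in> range (\<lambda>p. eval_ac p \<alpha>)" for c
    using rangeI[of "\<lambda>p. eval_ac p \<alpha>" "[:c:]"] by simp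
  moreover have "\<alpha> \<in> range (\<lambda>p. eval_ac p \<alpha>)"
    using rangeI[of "\<lambda>p. eval_ac p \<alpha>" "[:0, 1:]"] by simp
  ultimately show "adjoin_field \<alpha> \<subseteq> range (\<lambda>p. eval_ac p \<alpha>)"
    using range_eval_ac_subfield[of \<alpha>] by (auto simp: adjoin_field_def)
  show "range (\<lambda>p. eval_ac p \<alpha>) \<subseteq> adjoin_field \<alpha>"
  proof (clarsimp simp: adjoin_field_def)
    fix p F assume "is_subfield F" "range to_ac \<subseteq> F" "\<alpha> \<in> F"
    then show "eval_ac p \<alpha> \<in> F" by (intro eval_ac_in_subring) (auto simp: is_subfield_def)
  qed
qed

text \<open>By division with remainder, a nonzero combination of \<open>p\<close> and
  \<open>q\<close> of least degree divides every combination, in particular \<open>p\<close> and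
  \<open>q\<close>; irreducibility of \<open>p\<close> then makes it a unit.\<close>

lemma irreducible_bezout:
  fixes p q :: "'b::field poly"
  assumes "Factorial_Ring.irreducible p" "\<not> p dvd q"
  obtains a b where "a * p + b * q = 1"
proof -
  define C where "C d \<longleftrightarrow> d \<noteq> 0 \<and> (\<exists>a b. d = a * p + b * q)" for d
  have "p = 1 * p + 0 * q" by simp
  moreover have "p \<noteq> 0" using assms by auto
  ultimately have "C p" unfolding C_def by blast
  then obtain d where d: "C d" "\<And>e. C e \<Longrightarrow> Polynomial.degree d \<le> Polynomial.degree e"
    using arg_min_nat_lemma[of C p Polynomial.degree] by blast
  obtain a b where ab: "d = a * p + b * q" using d(1) by (auto simp: C_def)
  have "d dvd e" if "e = a' * p + b' * q" for e a' b'
  proof (rule ccontr)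
    assume "\<not> d dvd e"
    then have nz: "e mod d \<noteq> 0" by (simp add: dvd_eq_mod_eq_0)
    have "e mod d = e - e div d * d" by (simp add: minus_div_mult_eq_mod)
    also have "\<dots> = (a' - e div d * a) * p + (b' - e div d * b) * q"
      unfolding that ab by (simp add: algebra_simps)
    finally have "C (e mod d)" using nz unfolding C_def by blast
    moreover have "Polynomial.degree (e mod d) < Polynomial.degree d"
      using degree_mod_less[of d e] nz d(1) by (auto simp: C_def)
    ultimately show False using d(2) by fastforce
  qed
  from this[of p 1 0] this[of q 0 1] have dvd: "d dvd p" "d dvd q" by auto
  obtain c where c: "p = d * c" using dvd(1) by (elim dvdE)
  have "d dvd 1"
  proof (rule ccontr)
    assume "\<not> d dvd 1"
    then have "c dvd 1" using irreducibleD[OF assms(1) c] by blast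
    then have "p dvd d" using c by (metis dvd_refl mult_unit_dvd_iff)
    then show False using assms(2) dvd(2) dvd_trans by blast
  qed
  then obtain e where "1 = d * e" by (elim dvdE)
  then have "(a * e) * p + (b * e) * q = 1" using ab by (simp add: algebra_simps)
  then show ?thesis by (rule that)
qed

lemma irreducible_imp_prime_elem_field_poly:
  fixes p :: "'b::field poly"
  assumes "Factorial_Ring.irreducible p"
  shows "prime_elem p"
proof (rule prime_elemI)
  show "p \<noteq> 0" "\<not> p dvd 1" using assms irreducible_not_unit by auto
  fix q r assume pqr: "p dvd q * r"
  show "p dvd q \<or> p dvd r"
  proof (rule disjCI, rule ccontr)
    assume r: "\<not> p dvd r" and "\<not> p dvd q"
    then obtain a b where "a * p + b * q = 1" using irreducible_bezout[OF assms] by blast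
    then have "r = a * r * p + b * (q * r)" by (metis (no_types, lifting) distrib_right mult.assoc mult.commute mult_1)
    then show False using r pqr by (metis dvd_add dvd_mult dvd_triv_right)
  qed
qed

lemma irreducible_dvd_of_common_root:
  assumes "Factorial_Ring.irreducible f" "eval_ac f \<alpha> = 0" "eval_ac g \<alpha> = 0"
  shows "f dvd g"
proof (rule ccontr)
  assume "\<not> f dvd g"
  then obtain a b where "a * f + b * g = 1" using irreducible_bezout[OF assms(1)] by blast
  then have "eval_ac (a * f + b * g) \<alpha> = 1" by simp
  then show False using assms by simp
qed

lemma monic_irreducible_dvd_eq:
  fixes p q :: "'b::field poly"
  assumes "Factorial_Ring.irreducible p" "Factorial_Ring.irreducible q"
    "Polynomial.lead_coeff p = 1" "Polynomial.lead_coeff q = 1" "p dvd q"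
  shows "p = q"
proof -
  obtain c where c: "q = p * c" using assms(5) by (elim dvdE)
  have "\<not> p dvd 1" using assms(1) irreducible_not_unit by blast
  then have "c dvd 1" using irreducibleD[OF assms(2) c] by blast
  then obtain k where "c = [:k:]" by (auto simp: is_unit_poly_iff)
  with c assms(3,4) show ?thesis by (auto simp: lead_coeff_mult split: if_splits)
qed

lemma prime_elem_dvd_prodE:
  assumes "prime_elem p" "p dvd (\<Prod>i\<in>S. q i)"
  obtains i where "i \<in> S" "p dvd q i"
proof -
  have "\<not> p dvd 1" using assms(1) by (auto simp: prime_elem_def)
  with assms(2) have "\<exists>i\<in>S. p dvd q i"
    by (induction S rule: infinite_finite_induct) (auto simp: prime_elem_dvd_mult_iff[OF assms(1)])
  then show ?thesis using that by blast
qed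

text \<open>The prime \<open>p k\<close> does not divide the product of the other prime powers, so
  the whole power \<open>p k ^ l k\<close> must divide the remaining cofactor.\<close>

lemma prime_powers_prod_dvd:
  fixes p :: "'i \<Rightarrow> 'b::algebraic_semidom"
  assumes "finite S" "\<And>i. i \<in> S \<Longrightarrow> prime_elem (p i)"
    and "\<And>i j. i \<in> S \<Longrightarrow> j \<in> S \<Longrightarrow> p i dvd p j \<Longrightarrow> i = j"
    and "\<And>i. i \<in> S \<Longrightarrow> p i ^ l i dvd g"
  shows "(\<Prod>i\<in>S. p i ^ l i) dvd g"
  using assms
proof (induction S)
  case (insert k S)
  then obtain h where h: "g = (\<Prod>i\<in>S. p i ^ l i) * h" by (metis dvdE insertCI)
  have pk: "prime_elem (p k)" using insert.prems by blast
  have "\<not> p k dvd (\<Prod>i\<in>S. p i ^ l i)"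
  proof
    assume "p k dvd (\<Prod>i\<in>S. p i ^ l i)"
    then obtain i where "i \<in> S" "p k dvd p i ^ l i"
      by (rule prime_elem_dvd_prodE[OF pk])
    then show False using insert.prems(2) insert.hyps(2) prime_elem_dvd_power[OF pk] by blast
  qed
  moreover have "p k ^ l k dvd (\<Prod>i\<in>S. p i ^ l i) * h" using insert.prems(3)[of k] h by simp
  then obtain a b where "a + b = l k" "p k ^ a dvd (\<Prod>i\<in>S. p i ^ l i)" "p k ^ b dvd h"
    using prime_elem_power_dvd_prod[OF _ pk] by blast
  ultimately have "p k ^ l k dvd h" by (cases a) (auto dest: dvd_mult_left)
  then show ?case using insert.hyps h by (simp add: mult.commute mult_dvd_mono)
qed simp

section \<open>Reduction of polynomials\<close>

lemma valuation_on_proper_ideal: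
  fixes w :: "'b::field \<Rightarrow> 'h::linordered_ab_group_add extended"
  assumes w: "valuation_on F w" and F: "is_subfield F"
  shows "proper_ideal_of {x \<in> F. 0 \<le> w x} {x \<in> F. 0 < w x}"
proof -
  have FD: "0 \<in> F" "1 \<in> F" "\<And>x y. x \<in> F \<Longrightarrow> y \<in> F \<Longrightarrow> x + y \<in> F"
    "\<And>x y. x \<in> F \<Longrightarrow> y \<in> F \<Longrightarrow> x * y \<in> F" "\<And>x. x \<in> F \<Longrightarrow> - x \<in> F"
    using F by (auto simp: is_subfield_def)
  have add: "min (w x) (w y) \<le> w (x + y)" if "x \<in> F" "y \<in> F" for x y
    using w that by (simp add: valuation_on_def)
  have mult: "w (x * y) = w x + w y" if "x \<in> F" "y \<in> F" for x y
    using w that by (simp add: valuation_on_def)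
  have "w 0 = Pinf" using w FD(1) unfolding valuation_on_def by blast
  have one: "w 1 = 0" using valuation_on_one[OF w F] .
  show ?thesis
    unfolding proper_ideal_of_def
  proof (intro conjI ballI)
    show "1 \<in> {x \<in> F. 0 \<le> w x}" "1 \<notin> {x \<in> F. 0 < w x}" using one FD by auto
    show "0 \<in> {x \<in> F. 0 < w x}" using \<open>w 0 = Pinf\<close> FD by (simp add: zero_extended_def)
    show "{x \<in> F. 0 < w x} \<subseteq> {x \<in> F. 0 \<le> w x}" by auto
  next
    fix x y assume xy: "x \<in> {x \<in> F. 0 \<le> w x}" "y \<in> {x \<in> F. 0 \<le> w x}"
    have "0 \<le> w (x + - y)"
      using add[of x "- y"] valuation_on_uminus[OF w F, of y] xy FD
      by (auto intro: order_trans[of _ "min (w x) (w y)"])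
    then show "x - y \<in> {x \<in> F. 0 \<le> w x}" using xy FD(3)[of x "- y"] FD(5) by simp
    have "0 + 0 \<le> w x + w y" by (rule add_mono) (use xy in auto)
    then show "x * y \<in> {x \<in> F. 0 \<le> w x}" using mult[of x y] xy FD by simp
  next
    fix x y assume xy: "x \<in> {x \<in> F. 0 < w x}" "y \<in> {x \<in> F. 0 < w x}"
    then show "x + y \<in> {x \<in> F. 0 < w x}"
      using add[of x y] FD by (auto intro: order_less_le_trans[of _ "min (w x) (w y)"])
  next
    fix x y assume xy: "x \<in> {x \<in> F. 0 \<le> w x}" "y \<in> {x \<in> F. 0 < w x}"
    have "0 + w y \<le> w x + w y" by (rule add_mono) (use xy in auto)
    then have "0 < w (x * y)" using xy mult[of x y] by auto
    then show "x * y \<in> {x \<in> F. 0 < w x}" using xy FD by simp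
  qed
qed

text \<open>Dividing \<open>p(x) = 0\<close> by \<open>x ^ n\<close>, where \<open>n\<close> is the
  degree, writes 1 as a combination of positive powers of \<open>1/x\<close> with coefficients in
  \<open>B\<close>, which would lie in \<open>Q\<close>. This is why integral elements have
  nonnegative value.\<close>

lemma monic_eval_nonzero_if_inverse_in_ideal:
  assumes P: "proper_ideal_of B Q" and x: "x \<noteq> 0" "inverse x \<in> Q"
    and p: "Polynomial.lead_coeff p = 1" "\<And>n. to_ac (Polynomial.coeff p n) \<in> B"
  shows "eval_ac p x \<noteq> 0"
proof
  assume root: "eval_ac p x = 0"
  note D = proper_ideal_ofD[OF P]
  define n where "n = Polynomial.degree p"
  define y where "y = inverse x"
  define S where "S = (\<Sum>i<n. to_ac (Polynomial.coeff p i) * y ^ (n - i))"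
  have "0 = eval_ac p x * y ^ n" using root by simp
  also have "\<dots> = (\<Sum>i<n. to_ac (Polynomial.coeff p i) * x ^ i * y ^ n) + x ^ n * y ^ n"
    using p(1) by (simp add: eval_ac_altdef n_def[symmetric] sum_distrib_right distrib_right flip: lessThan_Suc_atMost)
  also have "x ^ n * y ^ n = 1" using x by (simp add: y_def flip: power_mult_distrib)
  also have "(\<Sum>i<n. to_ac (Polynomial.coeff p i) * x ^ i * y ^ n) = S"
    unfolding S_def
  proof (rule sum.cong)
    fix i assume "i \<in> {..<n}"
    then have "y ^ n = y ^ i * y ^ (n - i)" by (simp flip: power_add)
    moreover have "x ^ i * y ^ i = 1" using x by (simp add: y_def flip: power_mult_distrib)
    ultimately show "to_ac (Polynomial.coeff p i) * x ^ i * y ^ n = to_ac (Polynomial.coeff p i) * y ^ (n - i)"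
      by (metis (no_types, lifting) mult.assoc mult.right_neutral)
  qed simp
  finally have "1 = - S" by (simp add: add_eq_0_iff)
  moreover have "S \<in> Q"
    unfolding S_def
  proof (rule sum_in_additive[OF D(3) D(11)])
    fix i assume "i \<in> {..<n}"
    then obtain k where k: "n - i = Suc k" by (metis Suc_diff_Suc lessThan_iff)
    have "y \<in> Q" using x by (simp add: y_def)
    then have "y * y ^ k \<in> Q" using D(9,10,13) by blast
    then show "to_ac (Polynomial.coeff p i) * y ^ (n - i) \<in> Q" using p(2) D(12) k by simp
  qed
  ultimately show False using D(14)[of S] D(4) by simp
qed

section \<open>Gauss-type arithmetic of polynomials under coefficientwise reduction\<close>

locale residue_field =
  fixes v :: "'a::field \<Rightarrow> 'g::linordered_ab_group_add extended"
    and res :: "'a \<Rightarrow> 'r::field"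
  assumes v: "valuation_on UNIV v" and residue: "residue_map v res"
begin

abbreviation "R \<equiv> val_ring v"
abbreviation "M \<equiv> max_ideal v"

lemma RM: "proper_ideal_of R M"
  using valuation_on_proper_ideal[OF v is_subfield_UNIV] by (simp add: val_ring_def max_ideal_def)

lemmas RM_simps = proper_ideal_ofD[OF RM]

lemma v_mult: "v (x * y) = v x + v y"
  using v by (simp add: valuation_on_def)

lemma v_inf_iff: "v x = Pinf \<longleftrightarrow> x = 0"
  using v by (simp add: valuation_on_def)

lemma v_fin: "x \<noteq> 0 \<Longrightarrow> \<exists>g. v x = Fin g"
  using v by (cases "v x") (auto simp: valuation_on_def)

lemma divide_in_R: "y \<noteq> 0 \<Longrightarrow> x / y \<in> R \<longleftrightarrow> v y \<le> v x"
  using valuation_on_divide(1)[OF v is_subfield_UNIV] by (simp add: val_ring_def)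

lemma divide_in_M: "y \<noteq> 0 \<Longrightarrow> x / y \<in> M \<longleftrightarrow> v y < v x"
  using valuation_on_divide(2)[OF v is_subfield_UNIV] by (simp add: max_ideal_def)

lemma notin_R_iff: "x \<notin> R \<longleftrightarrow> x \<noteq> 0 \<and> inverse x \<in> M"
proof (cases "x = 0")
  case False
  then show ?thesis
    using divide_in_M[of x 1] valuation_on_one[OF v is_subfield_UNIV]
    by (auto simp: val_ring_def inverse_eq_divide)
qed (use RM_simps in auto)

lemma res_add: "x \<in> R \<Longrightarrow> y \<in> R \<Longrightarrow> res (x + y) = res x + res y"
  and res_mult: "x \<in> R \<Longrightarrow> y \<in> R \<Longrightarrow> res (x * y) = res x * res y"
  and res_1 [simp]: "res 1 = 1"
  and res_surj: "\<exists>x\<in>R. res x = r"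
  and res_eq_0_iff: "x \<in> R \<Longrightarrow> res x = 0 \<longleftrightarrow> x \<in> M"
proof -
  have img: "res ` R = UNIV" and ker: "{x \<in> R. res x = 0} = M"
    using residue unfolding residue_map_def by blast+
  show "\<exists>x\<in>R. res x = r" using img by (metis UNIV_I imageE)
  show "x \<in> R \<Longrightarrow> res x = 0 \<longleftrightarrow> x \<in> M" using ker by blast
qed (use residue in \<open>auto simp: residue_map_def\<close>)

lemma res_0 [simp]: "res 0 = 0"
  using res_eq_0_iff[of 0] RM_simps by simp

lemma res_sum: "(\<And>i. i \<in> S \<Longrightarrow> t i \<in> R) \<Longrightarrow> res (sum t S) = (\<Sum>i\<in>S. res (t i))"
proof (induction S rule: infinite_finite_induct)
  case (insert i S)
  moreover have "sum t S \<in> R" using insert.prems RM_simps by (intro sum_in_additive) auto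
  ultimately show ?case by (simp add: res_add)
qed simp_all

abbreviation "RX \<equiv> polys_over R"
abbreviation "MX \<equiv> polys_over M"

lemma RX_add: "p \<in> RX \<Longrightarrow> q \<in> RX \<Longrightarrow> p + q \<in> RX"
  and RX_diff: "p \<in> RX \<Longrightarrow> q \<in> RX \<Longrightarrow> p - q \<in> RX"
  and RX_smult: "c \<in> R \<Longrightarrow> p \<in> RX \<Longrightarrow> Polynomial.smult c p \<in> RX"
  and MX_smult: "c \<in> M \<Longrightarrow> p \<in> RX \<Longrightarrow> Polynomial.smult c p \<in> MX"
  and MX_RX: "p \<in> MX \<Longrightarrow> p \<in> RX"
  and RX_1: "1 \<in> RX" and RX_0: "0 \<in> RX"
  using RM_simps by (auto simp: polys_over_def)

lemma RX_mult: "p \<in> RX \<Longrightarrow> q \<in> RX \<Longrightarrow> p * q \<in> RX"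
  using polys_over_mult[OF RM] by blast

lemma RX_power: "p \<in> RX \<Longrightarrow> p ^ n \<in> RX"
  by (induction n) (auto intro: RX_mult RX_1)

lemma RX_prod: "(\<And>i. i \<in> S \<Longrightarrow> p i \<in> RX) \<Longrightarrow> (\<Prod>i\<in>S. p i) \<in> RX"
  by (induction S rule: infinite_finite_induct) (auto intro: RX_mult RX_1)

lemma RX_coeff: "p \<in> RX \<Longrightarrow> Polynomial.coeff p n \<in> R"
  by (simp add: polys_over_def)

abbreviation "rp \<equiv> map_poly res"

lemma rp_1 [simp]: "rp 1 = 1"
  by (rule poly_eqI) (simp add: coeff_map_poly)

lemma rp_add: "p \<in> RX \<Longrightarrow> q \<in> RX \<Longrightarrow> rp (p + q) = rp p + rp q"
  by (rule poly_eqI) (simp add: coeff_map_poly res_add RX_coeff)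

lemma rp_diff: "p \<in> RX \<Longrightarrow> q \<in> RX \<Longrightarrow> rp (p - q) = rp p - rp q"
  using rp_add[of "p - q" q] RX_diff by (simp add: algebra_simps)

lemma rp_mult: "p \<in> RX \<Longrightarrow> q \<in> RX \<Longrightarrow> rp (p * q) = rp p * rp q"
  by (rule poly_eqI)
    (simp add: coeff_map_poly coeff_mult RX_coeff RM_simps res_sum res_mult)

lemma rp_power: "p \<in> RX \<Longrightarrow> rp (p ^ n) = rp p ^ n"
  by (induction n) (simp_all add: rp_mult RX_power)

lemma rp_prod: "(\<And>i. i \<in> S \<Longrightarrow> p i \<in> RX) \<Longrightarrow> rp (\<Prod>i\<in>S. p i) = (\<Prod>i\<in>S. rp (p i))"
  by (induction S rule: infinite_finite_induct) (simp_all add: rp_mult RX_prod)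

lemma rp_eq_0_iff: "p \<in> RX \<Longrightarrow> rp p = 0 \<longleftrightarrow> p \<in> MX"
  by (auto simp: poly_eq_iff coeff_map_poly polys_over_def res_eq_0_iff)

lemma rp_surj: obtains p where "p \<in> RX" "rp p = q"
proof -
  \<comment> \<open>The section of \<open>res\<close> must send 0 to 0, so that
    \<open>map_poly s\<close> acts on every coefficient, including those beyond the degree.\<close>
  define s where "s r = (if r = 0 then 0 else SOME x. x \<in> R \<and> res x = r)" for r
  have s: "s r \<in> R" "res (s r) = r" for r
    using someI_ex[of "\<lambda>x. x \<in> R \<and> res x = r"] res_surj[of r] RM_simps by (auto simp: s_def)
  have "s 0 = 0" by (simp add: s_def)
  then have "map_poly s q \<in> RX" "rp (map_poly s q) = q"
    by (auto simp: polys_over_def coeff_map_poly s intro: poly_eqI)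
  then show ?thesis by (rule that)
qed

lemma degree_rp_le: "Polynomial.degree (rp p) \<le> Polynomial.degree p"
  by (rule map_poly_degree_leq)

lemma lead_coeff_rp:
  assumes "Polynomial.lead_coeff p = 1"
  shows "Polynomial.degree (rp p) = Polynomial.degree p" "Polynomial.lead_coeff (rp p) = 1"
proof -
  show "Polynomial.degree (rp p) = Polynomial.degree p"
    using assms degree_rp_le[of p] le_degree[of "rp p" "Polynomial.degree p"]
    by (simp add: coeff_map_poly)
  then show "Polynomial.lead_coeff (rp p) = 1" using assms by (simp add: coeff_map_poly)
qed

text \<open>A coefficient of least value exists because there are finitely many, and dividing by it
  leaves a polynomial over \<open>R\<close> with a coefficient 1. It plays the role of the content,
  and \<open>u\<close> that of the primitive part.\<close>

lemma primitive_part: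
  fixes g :: "'a poly"
  assumes "g \<noteq> 0"
  obtains j u where "Polynomial.coeff g j \<noteq> 0" "u \<in> RX" "rp u \<noteq> 0"
    "g = Polynomial.smult (Polynomial.coeff g j) u" "Polynomial.coeff u j = 1"
proof -
  define S where "S = {j. j \<le> Polynomial.degree g}"
  have "\<exists>j\<in>S. \<forall>i\<in>S. v (Polynomial.coeff g j) \<le> v (Polynomial.coeff g i)"
    using ex_min_if_finite[of "(\<lambda>i. v (Polynomial.coeff g i)) ` S"] by (auto simp: S_def not_less)
  then obtain j where j: "\<And>i. i \<in> S \<Longrightarrow> v (Polynomial.coeff g j) \<le> v (Polynomial.coeff g i)" by blast
  define \<rho> where "\<rho> = Polynomial.coeff g j"
  have nz: "\<rho> \<noteq> 0"
  proof
    assume "\<rho> = 0"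
    then have "v (Polynomial.lead_coeff g) = Pinf"
      using j[of "Polynomial.degree g"] v_inf_iff[of 0] by (simp add: S_def \<rho>_def)
    then show False using assms v_inf_iff by simp
  qed
  have le: "v \<rho> \<le> v (Polynomial.coeff g i)" for i
    using j[of i] v_inf_iff[of 0]
    by (cases "i \<in> S") (auto simp: \<rho>_def S_def coeff_eq_0 not_le)
  define u where "u = Polynomial.smult (inverse \<rho>) g"
  have u: "Polynomial.coeff u i = Polynomial.coeff g i / \<rho>" for i by (simp add: u_def field_simps)
  have "u \<in> RX" using divide_in_R[OF nz] le by (simp add: polys_over_def u)
  moreover have uj: "Polynomial.coeff u j = 1" using nz by (simp add: u flip: \<rho>_def)
  moreover have "g = Polynomial.smult \<rho> u" using nz by (simp add: u_def)
  moreover have "Polynomial.coeff (rp u) j = 1" using uj by (simp add: coeff_map_poly)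
  then have "rp u \<noteq> 0" by auto
  ultimately show ?thesis using nz that[of j u] by (simp add: \<rho>_def)
qed

text \<open>If the content \<rho> of \<open>q\<close> were outside \<open>R\<close>, then
  \<open>f * u\<close>, which is \<open>f * q\<close> divided by \<rho>, would reduce to 0, although
  neither \<open>f\<close> nor the primitive \<open>u\<close> does.\<close>

lemma monic_dvd_in_RX:
  assumes "f \<in> RX" "Polynomial.lead_coeff f = 1" "f * q \<in> RX"
  shows "q \<in> RX"
proof (cases "q = 0")
  case False
  then obtain j u where u: "u \<in> RX" "rp u \<noteq> 0" "q = Polynomial.smult (Polynomial.coeff q j) u"
    using primitive_part by metis
  define \<rho> where "\<rho> = Polynomial.coeff q j"
  have "\<rho> \<in> R"
  proof (rule ccontr)
    assume "\<rho> \<notin> R"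
    then have \<rho>: "inverse \<rho> \<in> M" "\<rho> \<noteq> 0" by (auto simp: notin_R_iff)
    have "f * u = Polynomial.smult (inverse \<rho>) (f * q)"
      using \<rho>(2) by (subst u(3)) (simp flip: \<rho>_def)
    then have "rp (f * u) = 0" using MX_smult[OF \<rho>(1) assms(3)] rp_eq_0_iff MX_RX by simp
    then have "rp f * rp u = 0" using assms u by (simp add: rp_mult)
    then show False using u(2) lead_coeff_rp(2)[OF assms(2)] by auto
  qed
  then have "Polynomial.smult \<rho> u \<in> RX" using RX_smult u(1) by blast
  then show ?thesis using u(3) by (simp add: \<rho>_def)
qed (use RX_0 in simp)

end

section \<open>Extensions to a simple extension and the integral closure\<close>

locale simple_extension = residue_field v res
  for v :: "'a::field \<Rightarrow> 'g::linordered_ab_group_add extended" and res :: "'a \<Rightarrow> 'r::field" +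
  fixes f :: "'a poly" and \<alpha> :: "'a alg_closure" and L :: "'a alg_closure set"
  assumes f_RX: "f \<in> polys_over (val_ring v)"
    and f_monic: "Polynomial.lead_coeff f = 1"
    and f_irr: "Factorial_Ring.irreducible f"
    and f_root: "eval_ac f \<alpha> = 0"
    and L_eq: "L = adjoin_field \<alpha>"
begin

abbreviation "E \<equiv> val_extensions v L"
abbreviation "S \<equiv> integral_closure_in R L"
abbreviation ev :: "'a poly \<Rightarrow> 'a alg_closure" where "ev p \<equiv> eval_ac p \<alpha>"

lemma L_range: "L = range ev"
  using L_eq adjoin_field_eq by simp

lemma L_subfield: "is_subfield L"
  using range_eval_ac_subfield L_range by simp

lemma ev_in_L [simp]: "ev p \<in> L"
  by (simp add: L_range)

lemma to_ac_in_L [simp]: "to_ac c \<in> L"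
  using ev_in_L[of "[:c:]"] by simp

lemma alpha_in_L: "\<alpha> \<in> L"
  using ev_in_L[of "[:0, 1:]"] by simp

lemma L_closed:
  "x \<in> L \<Longrightarrow> y \<in> L \<Longrightarrow> x + y \<in> L" "x \<in> L \<Longrightarrow> y \<in> L \<Longrightarrow> x * y \<in> L"
  "x \<in> L \<Longrightarrow> - x \<in> L" "x \<in> L \<Longrightarrow> inverse x \<in> L" "0 \<in> L" "1 \<in> L" "x \<in> L \<Longrightarrow> x ^ n \<in> L"
  using L_subfield is_subfield_power by (auto simp: is_subfield_def)

lemma extensionD:
  assumes "\<omega> \<in> E"
  shows "valuation_on L \<omega>" "\<omega> (to_ac c) = hull_ext (v c)"
    and "x \<in> L \<Longrightarrow> y \<in> L \<Longrightarrow> \<omega> (x * y) = \<omega> x + \<omega> y"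
    and "x \<in> L \<Longrightarrow> \<omega> x = Pinf \<longleftrightarrow> x = 0" "x \<in> L \<Longrightarrow> \<omega> x \<noteq> Minf" "\<omega> 1 = 0"
    and "x \<in> L \<Longrightarrow> \<omega> (x ^ n) = nmul n (\<omega> x)" "x \<in> L \<Longrightarrow> \<omega> (- x) = \<omega> x"
proof -
  show w: "valuation_on L \<omega>" and "\<omega> (to_ac c) = hull_ext (v c)"
    using assms by (auto simp: val_extensions_def)
  show "x \<in> L \<Longrightarrow> y \<in> L \<Longrightarrow> \<omega> (x * y) = \<omega> x + \<omega> y"
    "x \<in> L \<Longrightarrow> \<omega> x = Pinf \<longleftrightarrow> x = 0" "x \<in> L \<Longrightarrow> \<omega> x \<noteq> Minf"
    using w by (auto simp: valuation_on_def)
  show "\<omega> 1 = 0" "x \<in> L \<Longrightarrow> \<omega> (x ^ n) = nmul n (\<omega> x)" "x \<in> L \<Longrightarrow> \<omega> (- x) = \<omega> x"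
    using valuation_on_one[OF w L_subfield] valuation_on_power[OF w L_subfield]
      valuation_on_uminus[OF w L_subfield] by auto
qed

lemma extension_proper_ideal:
  "\<omega> \<in> E \<Longrightarrow> proper_ideal_of {x \<in> L. 0 \<le> \<omega> x} {x \<in> L. 0 < \<omega> x}"
  using valuation_on_proper_ideal[OF extensionD(1) L_subfield] .

lemma hull_ext_nonneg_iff [simp]: "0 \<le> hull_ext c \<longleftrightarrow> 0 \<le> c"
  and hull_ext_pos_iff [simp]: "0 < hull_ext c \<longleftrightarrow> 0 < c"
  for c :: "'h::linordered_ab_group_add extended"
  using hull_ext_le_iff[of 0 c] hull_ext_le_iff[of c 0]
  by (auto simp: zero_extended_def not_le[symmetric])

lemma extension_divide:
  assumes "\<omega> \<in> E" "x \<in> L" "y \<in> L" "y \<noteq> 0"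
  shows "0 \<le> \<omega> (x / y) \<longleftrightarrow> \<omega> y \<le> \<omega> x" "0 < \<omega> (x / y) \<longleftrightarrow> \<omega> y < \<omega> x"
  using valuation_on_divide[OF extensionD(1)[OF assms(1)] L_subfield assms(2-4)] by auto

lemma integral_nonneg:
  assumes "\<omega> \<in> E" "x \<in> S"
  shows "0 \<le> \<omega> x"
proof (rule ccontr)
  assume neg: "\<not> 0 \<le> \<omega> x"
  obtain p where p: "p \<in> RX" "Polynomial.lead_coeff p = 1" "eval_ac p x = 0" and xL: "x \<in> L"
    using assms(2) by (auto simp: integral_closure_in_def)
  have x0: "x \<noteq> 0" using neg extensionD(4)[OF assms(1) L_closed(5)] by auto
  have "0 < \<omega> (1 / x)"
    using extension_divide(2)[OF assms(1) L_closed(6) xL x0] neg extensionD(6)[OF assms(1)] by simp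
  then have "inverse x \<in> {x \<in> L. 0 < \<omega> x}" using L_closed(4)[OF xL] by (simp add: inverse_eq_divide)
  then show False
    using monic_eval_nonzero_if_inverse_in_ideal[OF extension_proper_ideal[OF assms(1)] x0 _ p(2)] p(1,3)
      extensionD(2)[OF assms(1)] by (auto simp: polys_over_def val_ring_def)
qed

lemma to_ac_proper_ideal: "proper_ideal_of (to_ac ` R) (to_ac ` M)"
  unfolding proper_ideal_of_def
proof (intro conjI ballI)
  show "1 \<in> to_ac ` R" "0 \<in> to_ac ` M"
    using RM_simps(1,3) by (auto intro: image_eqI[of _ _ 1] image_eqI[of _ _ 0])
  show "to_ac ` M \<subseteq> to_ac ` R" using RM_simps(10) by auto
  show "1 \<notin> to_ac ` M" using RM_simps(4) by (metis imageE to_ac_1 to_ac_eq_iff)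
qed (use RM_simps in \<open>auto simp flip: to_ac_diff to_ac_mult to_ac_add\<close>)

text \<open>If \<open>x\<close> is not integral, \<open>M\<close> and \<open>1/x\<close> generate a
  proper ideal of \<open>R[1/x]\<close>, and a valuation ring dominating it yields an extension with
  \<open>\<omega>(1/x) > 0\<close>. Properness holds because a relation
  \<open>1 = \<Sum> c i / x ^ i\<close> with \<open>c 0 \<in> M\<close>, multiplied by
  \<open>x ^ n\<close>, is a monic equation for \<open>x\<close> up to the unit
  \<open>1 - c 0\<close>.\<close>

lemma integralI:
  assumes x: "x \<in> L" and nonneg: "\<And>\<omega>. \<omega> \<in> E \<Longrightarrow> 0 \<le> \<omega> x"
  shows "x \<in> S"
proof (rule ccontr)
  assume notS: "x \<notin> S"
  have x0: "x \<noteq> 0"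
  proof
    assume "x = 0"
    then have "eval_ac [:0, 1:] x = 0" by simp
    moreover have "[:0, 1:] \<in> RX" "Polynomial.lead_coeff [:0, 1 :: 'a:] = 1"
      using RM_simps by (auto simp: polys_over_def coeff_pCons split: nat.splits)
    ultimately show False using notS x unfolding integral_closure_in_def by blast
  qed
  define y where "y = inverse x"
  have one: "poly p y \<noteq> 1" if p: "p \<in> polys_over (to_ac ` R)" "Polynomial.coeff p 0 \<in> to_ac ` M" for p
  proof
    assume eq: "poly p y = 1"
    define n where "n = Polynomial.degree p"
    have "\<forall>i. \<exists>c\<in>R. Polynomial.coeff p i = to_ac c" using p(1) by (auto simp: polys_over_def)
    then obtain c where c: "\<And>i. c i \<in> R" "\<And>i. Polynomial.coeff p i = to_ac (c i)" by metis
    have c0: "c 0 \<in> M" using p(2) c(2)[of 0] by auto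
    have "1 - c 0 \<noteq> 0" using c0 RM_simps(4) by auto
    have "1 - c 0 \<notin> M" using c0 RM_simps(4) RM_simps(11)[of "1 - c 0" "c 0"] by auto
    then have inv: "inverse (1 - c 0) \<in> R"
      using notin_R_iff[of "inverse (1 - c 0)"] by auto
    have "x ^ n = (\<Sum>i\<le>n. to_ac (c i) * y ^ i) * x ^ n"
      using eq by (simp add: poly_altdef c(2) n_def)
    also have "\<dots> = (\<Sum>i\<le>n. to_ac (c i) * x ^ (n - i))"
      unfolding sum_distrib_right
    proof (rule sum.cong)
      fix i assume "i \<in> {..n}"
      then have "x ^ n = x ^ i * x ^ (n - i)" by (simp flip: power_add)
      moreover have "y ^ i * x ^ i = 1" using x0 by (simp add: y_def flip: power_mult_distrib)
      ultimately show "to_ac (c i) * y ^ i * x ^ n = to_ac (c i) * x ^ (n - i)"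
        by (metis (no_types, lifting) mult.assoc mult.left_neutral)
    qed simp
    finally have xn: "x ^ n = (\<Sum>i\<le>n. to_ac (c i) * x ^ (n - i))" .
    \<comment> \<open>Before scaling, the coefficient of degree \<open>n\<close> is
      \<open>1 - c 0\<close>, since only \<open>i = 0\<close> contributes to that degree in the
      sum.\<close>
    define q where "q = Polynomial.smult (inverse (1 - c 0))
      (Polynomial.monom 1 n - (\<Sum>i\<le>n. Polynomial.monom (c i) (n - i)))"
    have ev_monom: "eval_ac (Polynomial.monom a k) x = to_ac a * x ^ k" for a k
      by (simp add: eval_ac_def map_poly_monom poly_monom)
    have ev_sum: "eval_ac (sum t T) x = (\<Sum>i\<in>T. eval_ac (t i) x)" for t and T :: "nat set"
      by (induction T rule: infinite_finite_induct) auto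
    have "eval_ac q x = 0" using xn by (simp add: q_def ev_monom ev_sum)
    have mon: "Polynomial.monom a k \<in> RX" if "a \<in> R" for a k
      using that RM_simps by (auto simp: polys_over_def)
    have "q \<in> RX"
      unfolding q_def
      by (intro RX_smult RX_diff mon inv RM_simps sum_in_additive c RX_add RX_0)
    have cq: "Polynomial.coeff (\<Sum>i\<le>n. Polynomial.monom (c i) (n - i)) k = (\<Sum>i\<le>n. if n - i = k then c i else 0)" for k
      by (simp add: coeff_sum)
    have "(\<Sum>i\<le>n. if n - i = n then c i else 0) = (\<Sum>i\<in>{0}. c i)"
      by (rule sum.mono_neutral_cong_right) auto
    then have lc: "Polynomial.coeff q n = 1" using \<open>1 - c 0 \<noteq> 0\<close> by (simp add: q_def cq)
    have "Polynomial.coeff q k = 0" if "k > n" for k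
    proof -
      have "(\<Sum>i\<le>n. if n - i = k then c i else 0) = 0"
        using that by (intro sum.neutral) auto
      then show ?thesis using that by (simp add: q_def cq)
    qed
    then have "Polynomial.degree q = n" using lc by (intro antisym degree_le le_degree) auto
    then have "Polynomial.lead_coeff q = 1" using lc by simp
    then show False
      using notS x \<open>q \<in> RX\<close> \<open>eval_ac q x = 0\<close> unfolding integral_closure_in_def by blast
  qed
  define B0 Q0 where "B0 = (\<lambda>p. poly p y) ` polys_over (to_ac ` R)"
    and "Q0 = (\<lambda>p. poly p y) ` {p \<in> polys_over (to_ac ` R). Polynomial.coeff p 0 \<in> to_ac ` M}"
  have "proper_ideal_of B0 Q0"
    unfolding B0_def Q0_def by (rule proper_ideal_of_adjoin[OF to_ac_proper_ideal]) (use one in auto)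
  then obtain B Q where BQ: "valuation_pair B Q" "B0 \<subseteq> B" "Q0 \<subseteq> Q"
    using dominating_valuation_pair_exists by blast
  have zero: "0 \<in> to_ac ` R" "1 \<in> to_ac ` R" "0 \<in> to_ac ` M"
    using proper_ideal_ofD[OF to_ac_proper_ideal] by auto
  have "to_ac c \<in> B0" if "c \<in> R" for c
    unfolding B0_def using that zero
    by (intro image_eqI[of _ _ "[:to_ac c:]"]) (auto simp: polys_over_def coeff_pCons split: nat.splits)
  moreover have "to_ac c \<in> Q0" if "c \<in> M" for c
    unfolding Q0_def using that zero RM_simps(10)
    by (intro image_eqI[of _ _ "[:to_ac c:]"]) (auto simp: polys_over_def coeff_pCons split: nat.splits)
  moreover have "y \<in> Q0"
    unfolding Q0_def using zero
    by (intro image_eqI[of _ _ "[:0, 1:]"]) (auto simp: polys_over_def coeff_pCons split: nat.splits)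
  moreover obtain \<omega> where \<omega>: "\<omega> \<in> E" "\<And>x. x \<in> L \<Longrightarrow> 0 \<le> \<omega> x \<longleftrightarrow> x \<in> B" "\<And>x. x \<in> L \<Longrightarrow> 0 < \<omega> x \<longleftrightarrow> x \<in> Q"
  proof (rule valuation_pair_extension[OF v BQ(1) _ _ L_subfield])
    show "to_ac c \<in> B" if "0 \<le> v c" for c
      using calculation(1) BQ(2) that by (auto simp: val_ring_def)
    show "to_ac c \<in> Q" if "0 < v c" for c
      using calculation(2) BQ(3) that by (auto simp: max_ideal_def)
  qed auto
  ultimately have "0 < \<omega> y" using x L_closed(4) BQ(3) by (auto simp: y_def)
  moreover have "0 \<le> \<omega> x" using nonneg \<omega>(1) .
  moreover have "\<omega> (x * y) = 0" using x0 extensionD(6)[OF \<omega>(1)] by (simp add: y_def)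
  moreover have "\<omega> (x * y) = \<omega> x + \<omega> y"
    using extensionD(3)[OF \<omega>(1)] x L_closed(4) by (simp add: y_def)
  ultimately show False
    using add_mono[of 0 "\<omega> x" "\<omega> y" "\<omega> y"] by auto
qed

section \<open>Values of polynomials in \<alpha> and centres on \<open>R[\<alpha>]\<close>\<close>

lemma eval_ac_nonneg:
  assumes "\<omega> \<in> E" "x \<in> L" "0 \<le> \<omega> x" "p \<in> RX"
  shows "0 \<le> \<omega> (eval_ac p x)"
proof -
  note D = proper_ideal_ofD[OF extension_proper_ideal[OF assms(1)]]
  have x: "x \<in> {x \<in> L. 0 \<le> \<omega> x}" using assms by simp
  have "eval_ac p x \<in> {x \<in> L. 0 \<le> \<omega> x}"
    unfolding eval_ac_altdef
  proof (rule sum_in_additive[OF D(2,5)])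
    fix i
    have "to_ac (Polynomial.coeff p i) \<in> {x \<in> L. 0 \<le> \<omega> x}"
      using assms by (simp add: extensionD(2) polys_over_def val_ring_def)
    then show "to_ac (Polynomial.coeff p i) * x ^ i \<in> {x \<in> L. 0 \<le> \<omega> x}"
      using D(7) D(9)[OF x] by blast
  qed auto
  then show ?thesis by simp
qed

lemma ev_nonneg:
  assumes "\<omega> \<in> E" "p \<in> RX"
  shows "0 \<le> \<omega> (ev p)"
proof -
  have "\<alpha> \<in> S"
    using f_RX f_monic f_root alpha_in_L unfolding integral_closure_in_def by blast
  then show ?thesis using eval_ac_nonneg alpha_in_L integral_nonneg assms by blast
qed

text \<open>Factoring out a coefficient of least value leaves a polynomial over \<open>R\<close>,
  whose value at \<alpha> is nonnegative. A bound by an element of \<open>M\<close>, beyond mere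
  positivity, is what comparison with the least positive value of the base field requires.\<close>

lemma ev_MX_ge:
  assumes "\<omega> \<in> E" "p \<in> MX" "p \<noteq> 0"
  obtains c where "c \<in> M" "c \<noteq> 0" "hull_ext (v c) \<le> \<omega> (ev p)"
proof -
  obtain j u where u: "Polynomial.coeff p j \<noteq> 0" "u \<in> RX" "p = Polynomial.smult (Polynomial.coeff p j) u"
    using primitive_part[OF assms(3)] by metis
  define c where "c = Polynomial.coeff p j"
  have "ev p = to_ac c * ev u" by (subst u(3)) (simp add: c_def)
  then have "\<omega> (ev p) = hull_ext (v c) + \<omega> (ev u)"
    using extensionD(2,3)[OF assms(1)] by simp
  then have "hull_ext (v c) \<le> \<omega> (ev p)"
    using ev_nonneg[OF assms(1) u(2)] add_mono[of "hull_ext (v c)" _ 0 "\<omega> (ev u)"] by simp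
  then show ?thesis using that[of c] u(1) assms(2) by (auto simp: c_def polys_over_def)
qed

lemma ev_MX_pos:
  assumes "\<omega> \<in> E" "p \<in> MX"
  shows "0 < \<omega> (ev p)"
proof (cases "p = 0")
  case True
  then show ?thesis using extensionD(4)[OF assms(1) L_closed(5)] by (simp add: zero_extended_def)
next
  case False
  then obtain c where "c \<in> M" "hull_ext (v c) \<le> \<omega> (ev p)" using ev_MX_ge[OF assms] by blast
  then have "0 < hull_ext (v c)" "hull_ext (v c) \<le> \<omega> (ev p)" by (simp_all add: max_ideal_def)
  then show ?thesis by (rule less_le_trans)
qed

text \<open>The ideal of \<open>R[X]\<close> generated by \<open>M\<close> and \<phi> is maximal, so
  it is exactly the set of polynomials of positive value at \<alpha>. Divisibility of reductions
  lifts to \<open>p - \<phi> * b' \<in> MX\<close>; without it, a lifted Bezout identity would give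
  1 a positive value.\<close>

lemma center_iff_dvd:
  assumes \<omega>: "\<omega> \<in> E" and irr: "Factorial_Ring.irreducible (rp \<phi>)" and \<phi>: "\<phi> \<in> RX" "0 < \<omega> (ev \<phi>)"
    and p: "p \<in> RX"
  shows "0 < \<omega> (ev p) \<longleftrightarrow> rp \<phi> dvd rp p"
proof -
  note D = proper_ideal_ofD[OF extension_proper_ideal[OF \<omega>]]
  have in_ideal: "ev q \<in> {x \<in> L. 0 < \<omega> x}" if "q \<in> MX" for q
    using ev_MX_pos[OF \<omega> that] by simp
  have in_ring: "ev q \<in> {x \<in> L. 0 \<le> \<omega> x}" if "q \<in> RX" for q
    using ev_nonneg[OF \<omega> that] by simp
  show ?thesis
  proof
    assume "rp \<phi> dvd rp p"
    then obtain b where b: "rp p = rp \<phi> * b" by (elim dvdE)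
    obtain b' where b': "b' \<in> RX" "rp b' = b" by (rule rp_surj)
    have "rp (p - \<phi> * b') = 0" using b b' \<phi> p by (simp add: rp_diff rp_mult RX_mult)
    then have "p - \<phi> * b' \<in> MX" using \<phi> b' p by (subst (asm) rp_eq_0_iff) (auto intro!: RX_diff RX_mult)
    from D(11)[OF in_ideal[OF this] D(13)[OF in_ring[OF b'(1)], of "ev \<phi>"]]
    show "0 < \<omega> (ev p)" using \<phi>(2) by simp
  next
    assume pos: "0 < \<omega> (ev p)"
    show "rp \<phi> dvd rp p"
    proof (rule ccontr)
      assume "\<not> rp \<phi> dvd rp p"
      then obtain a b where ab: "a * rp \<phi> + b * rp p = 1" using irreducible_bezout[OF irr] by blast
      obtain a' where a': "a' \<in> RX" "rp a' = a" by (rule rp_surj)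
      obtain b' where b': "b' \<in> RX" "rp b' = b" by (rule rp_surj)
      have "rp (a' * \<phi> + b' * p - 1) = 0"
        using ab a' b' \<phi> p by (simp add: rp_diff rp_add rp_mult RX_mult RX_add RX_1)
      then have "a' * \<phi> + b' * p - 1 \<in> MX"
        using \<phi> b' a' p by (subst (asm) rp_eq_0_iff) (auto intro!: RX_diff RX_mult RX_add RX_1)
      from in_ideal[OF this] have 1: "ev a' * ev \<phi> + ev b' * ev p - 1 \<in> {x \<in> L. 0 < \<omega> x}" by simp
      have 2: "ev a' * ev \<phi> + ev b' * ev p \<in> {x \<in> L. 0 < \<omega> x}"
        using D(11)[OF D(12)[OF in_ring[OF a'(1)]] D(12)[OF in_ring[OF b'(1)]], of "ev \<phi>" "ev p"]
          \<phi>(2) pos by simp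
      show False using D(11)[OF 2 D(14)[OF 1]] D(4) by simp
    qed
  qed
qed

text \<open>A valuation ring is taken over the ideal of \<open>R[\<alpha>]\<close> generated by
  \<open>M\<close> and \<open>\<phi>(\<alpha>)\<close>. That ideal is proper: if
  \<open>rp \<phi>\<close> divides \<open>rp p\<close> and \<open>p(\<alpha>) = 1\<close>, then
  \<open>p - 1 = f * q\<close> with \<open>q\<close> over \<open>R\<close>, and reducing this makes
  \<open>rp \<phi>\<close> a divisor of 1.\<close>

lemma center_exists:
  assumes irr: "Factorial_Ring.irreducible (rp \<phi>)" and \<phi>: "\<phi> \<in> RX" "rp \<phi> dvd rp f"
  obtains \<omega> where "\<omega> \<in> E" "0 < \<omega> (ev \<phi>)"
proof -
  define B0 Q0 where "B0 = ev ` RX" and "Q0 = ev ` {p \<in> RX. rp \<phi> dvd rp p}"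
  have "proper_ideal_of B0 Q0"
    unfolding proper_ideal_of_def
  proof (intro conjI ballI)
    show "1 \<in> B0" unfolding B0_def using RX_1 by (intro image_eqI[of _ _ 1]) auto
    show "0 \<in> Q0" unfolding Q0_def using RX_0 by (intro image_eqI[of _ _ 0]) auto
    show "Q0 \<subseteq> B0" by (auto simp: B0_def Q0_def)
    show "1 \<notin> Q0"
    proof
      assume "1 \<in> Q0"
      then obtain p where p: "p \<in> RX" "rp \<phi> dvd rp p" "ev (p - 1) = 0" by (auto simp: Q0_def)
      then have "f dvd p - 1" using irreducible_dvd_of_common_root[OF f_irr f_root] by blast
      then obtain q where q: "p - 1 = f * q" by (elim dvdE)
      then have "f * q \<in> RX" using p RX_diff RX_1 by metis
      then have "q \<in> RX" using monic_dvd_in_RX f_RX f_monic by blast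
      then have "rp p - 1 = rp f * rp q"
        using arg_cong[OF q, of rp] p RX_1 f_RX by (simp add: rp_diff rp_mult)
      then have "1 = rp p - rp f * rp q" by (simp add: algebra_simps)
      then have "rp \<phi> dvd 1" using p(2) \<phi>(2) by (metis dvd_diff dvd_mult2)
      then show False using irr irreducible_not_unit by blast
    qed
  next
    fix x y assume "x \<in> B0" "y \<in> B0"
    then obtain p q where "p \<in> RX" "q \<in> RX" "x = ev p" "y = ev q" by (auto simp: B0_def)
    then show "x - y \<in> B0" "x * y \<in> B0"
      using RX_diff[of p q] RX_mult[of p q] by (auto simp: B0_def simp flip: eval_ac_diff eval_ac_mult)
  next
    fix x y assume "x \<in> Q0" "y \<in> Q0"
    then obtain p q where "p \<in> RX" "q \<in> RX" "x = ev p" "y = ev q" "rp \<phi> dvd rp p" "rp \<phi> dvd rp q"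
      by (auto simp: Q0_def)
    then show "x + y \<in> Q0"
      using RX_add[of p q] by (auto simp: Q0_def rp_add simp flip: eval_ac_add)
  next
    fix x y assume "x \<in> B0" "y \<in> Q0"
    then obtain p q where "p \<in> RX" "q \<in> RX" "x = ev p" "y = ev q" "rp \<phi> dvd rp q"
      by (auto simp: B0_def Q0_def)
    then show "x * y \<in> Q0"
      using RX_mult[of p q] by (auto simp: Q0_def rp_mult simp flip: eval_ac_mult)
  qed
  then obtain B Q where BQ: "valuation_pair B Q" "B0 \<subseteq> B" "Q0 \<subseteq> Q"
    using dominating_valuation_pair_exists by blast
  have const: "to_ac c = ev [:c:]" for c by simp
  have constR: "[:c:] \<in> RX" if "c \<in> R" for c
    using that RM_simps by (auto simp: polys_over_def coeff_pCons split: nat.splits)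
  have B: "to_ac c \<in> B" if "0 \<le> v c" for c
    using BQ(2) constR[of c] that unfolding B0_def const by (auto simp: val_ring_def simp del: eval_ac_pCons)
  have Q: "to_ac c \<in> Q" if "0 < v c" for c
  proof -
    have "c \<in> M" using that by (simp add: max_ideal_def)
    then have "rp [:c:] = 0" "[:c:] \<in> RX"
      using RM_simps(10) res_eq_0_iff constR by (auto simp: map_poly_pCons)
    then have "[:c:] \<in> {p \<in> RX. rp \<phi> dvd rp p}" by simp
    then have "ev [:c:] \<in> Q0" unfolding Q0_def by (rule imageI)
    then show ?thesis using BQ(3) by auto
  qed
  have "range to_ac \<subseteq> L" by auto
  with valuation_pair_extension[OF v BQ(1) B Q L_subfield]
  obtain \<omega> where "\<omega> \<in> E" "\<And>x. x \<in> L \<Longrightarrow> 0 < \<omega> x \<longleftrightarrow> x \<in> Q" by metis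
  moreover have "ev \<phi> \<in> Q0" unfolding Q0_def using \<phi> by auto
  ultimately show ?thesis using that[of \<omega>] BQ(3) by auto
qed

end

section \<open>Extensions and the factors of the reduction\<close>

lemma nmul_pos:
  fixes a :: "'h::linordered_ab_group_add"
  shows "0 < n \<Longrightarrow> 0 < a \<Longrightarrow> 0 < nmul n a"
  using nmul_strict_mono[of n 0 a] by simp

lemma nmul_less_nmul:
  fixes a :: "'h::linordered_ab_group_add"
  assumes "m < n" "0 < a"
  shows "nmul m a < nmul n a"
  using nmul_add[of "n - m" m a] nmul_pos[of "n - m" a] assms by simp

context simple_extension
begin

text \<open>
  The Horner tails \<open>b\<^sub>k = u\<^sub>k + u\<^sub>k\<^sub>+\<^sub>1 x + \<dots>\<close> of a relation \<open>u(x) = 0\<close> are polynomials in \<open>x\<close>, and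
  the relation also makes them polynomials in \<open>1/x\<close>, so they lie in every valuation ring over \<open>R\<close>.
\<close>

lemma horner_tails_integral:
  assumes x: "x \<in> L" and u: "u \<in> RX" "eval_ac u x = 0"
  shows "eval_ac (poly_shift k u) x \<in> S" "x * eval_ac (poly_shift (Suc k) u) x \<in> S"
proof -
  define b where "b k = eval_ac (poly_shift k u) x" for k
  have "poly_shift k u = pCons (Polynomial.coeff u k) (poly_shift (Suc k) u)" for k
    by (rule poly_eqI) (simp add: coeff_poly_shift coeff_pCons split: nat.splits)
  then have rec: "b k = to_ac (Polynomial.coeff u k) + x * b (Suc k)" for k
    unfolding b_def by (metis eval_ac_pCons)
  have bL: "b k \<in> L" for k
    unfolding b_def using x L_closed by (intro eval_ac_in_subring) auto
  have nonneg: "0 \<le> \<omega> (b k)" if \<omega>: "\<omega> \<in> E" for \<omega> k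
  proof (cases "0 \<le> \<omega> x")
    case True
    moreover have "poly_shift k u \<in> RX" using u(1) by (simp add: polys_over_def coeff_poly_shift)
    ultimately show ?thesis unfolding b_def using eval_ac_nonneg[OF \<omega> x] by blast
  next
    case False
    note D = proper_ideal_ofD[OF extension_proper_ideal[OF \<omega>]]
    have x0: "x \<noteq> 0" using False extensionD(4)[OF \<omega> L_closed(5)] by auto
    have "0 < \<omega> (1 / x)"
      using extension_divide(2)[OF \<omega> L_closed(6) x x0] False extensionD(6)[OF \<omega>] by simp
    then have inv: "inverse x \<in> {x \<in> L. 0 \<le> \<omega> x}" using L_closed(4)[OF x] by (simp add: inverse_eq_divide)
    have "b k \<in> {x \<in> L. 0 \<le> \<omega> x}"
    proof (induction k)
      case 0
      then show ?case using D(2) u(2) by (simp add: b_def)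
    next
      case (Suc k)
      have c: "to_ac (Polynomial.coeff u k) \<in> {x \<in> L. 0 \<le> \<omega> x}"
        using u(1) \<omega> by (simp add: extensionD(2) polys_over_def val_ring_def)
      have "b (Suc k) = (b k - to_ac (Polynomial.coeff u k)) * inverse x" using rec[of k] x0 by simp
      then show ?case using D(7)[OF D(6)[OF Suc c] inv] by simp
    qed
    then show ?thesis by simp
  qed
  then have bS: "b k \<in> S" for k using integralI[OF bL] by blast
  show "eval_ac (poly_shift k u) x \<in> S" using bS[of k] by (simp add: b_def)
  have "0 \<le> \<omega> (x * b (Suc k))" if \<omega>: "\<omega> \<in> E" for \<omega>
  proof -
    note D = proper_ideal_ofD[OF extension_proper_ideal[OF \<omega>]]
    have c: "to_ac (Polynomial.coeff u k) \<in> {x \<in> L. 0 \<le> \<omega> x}" "b k \<in> {x \<in> L. 0 \<le> \<omega> x}"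
      using u(1) \<omega> bL nonneg by (simp_all add: extensionD(2) polys_over_def val_ring_def)
    show ?thesis using D(6)[OF c(2,1)] rec[of k] by simp
  qed
  then show "x * eval_ac (poly_shift (Suc k) u) x \<in> S"
    using integralI[OF L_closed(2)[OF x bL]] by (simp add: b_def)
qed

text \<open>The element \<open>x\<close> is a quotient of the integral elements
  \<open>x * b (Suc k)\<close> and \<open>b (Suc k)\<close>, and for some \<open>k\<close> the
  denominator is a unit at \<omega>, hence also at \<omega>'. This is the Pruefer property of
  \<open>S\<close>: its localization at the centre of \<omega> is the valuation ring of
  \<omega>.\<close>

lemma nonneg_of_same_center:
  assumes \<omega>: "\<omega> \<in> E" and \<omega>': "\<omega>' \<in> E" and same: "\<And>x. x \<in> S \<Longrightarrow> 0 < \<omega> x \<longleftrightarrow> 0 < \<omega>' x"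
    and x: "x \<in> L" "0 \<le> \<omega> x"
  shows "0 \<le> \<omega>' x"
proof -
  note D = proper_ideal_ofD[OF extension_proper_ideal[OF \<omega>]]
  obtain p :: "'a poly" where p: "p \<noteq> 0" "eval_ac p x = 0"
    using alg_closure_algebraic[of x] unfolding eval_ac_def by blast
  obtain j u where u: "Polynomial.coeff p j \<noteq> 0" "u \<in> RX" "Polynomial.coeff u j = 1"
    and pu: "p = Polynomial.smult (Polynomial.coeff p j) u"
    using primitive_part[OF p(1)] by metis
  have "eval_ac p x = to_ac (Polynomial.coeff p j) * eval_ac u x" by (subst pu) simp
  then have ux: "eval_ac u x = 0" using p(2) u(1) by simp
  define b where "b k = eval_ac (poly_shift k u) x" for k
  have bS: "b k \<in> S" "x * b (Suc k) \<in> S" for k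
    unfolding b_def using horner_tails_integral[OF x(1) u(2) ux] by auto
  have SL: "y \<in> L" if "y \<in> S" for y using that by (simp add: integral_closure_in_def)
  have b0: "b 0 = 0" using ux by (simp add: b_def)
  have "poly_shift j u = pCons 1 (poly_shift (Suc j) u)"
    by (rule poly_eqI) (simp add: coeff_poly_shift coeff_pCons u(3) split: nat.splits)
  then have rec: "b j + - (x * b (Suc j)) = 1" by (simp add: b_def)
  \<comment> \<open>If all these tails had positive value, so would
    \<open>b j - x * b (Suc j) = 1\<close>; the index that \<open>b (Suc k)\<close> misses is
    supplied by \<open>b 0 = 0\<close>.\<close>
  have "\<exists>k. \<not> 0 < \<omega> (b (Suc k))"
  proof (rule ccontr)
    assume "\<nexists>k. \<not> 0 < \<omega> (b (Suc k))"
    then have "b k \<in> {x \<in> L. 0 < \<omega> x}" for k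
      using b0 D(3) SL bS by (cases k) auto
    moreover from this have "x * b (Suc j) \<in> {x \<in> L. 0 < \<omega> x}" using D(12)[of x] x by blast
    ultimately have "b j + - (x * b (Suc j)) \<in> {x \<in> L. 0 < \<omega> x}" using D(11)[OF _ D(14)] by blast
    then show False using rec D(4) by simp
  qed
  then obtain k where "\<not> 0 < \<omega> (b (Suc k))" by blast
  then have "\<not> 0 < \<omega>' (b (Suc k))" using same bS by blast
  then have "\<omega>' (b (Suc k)) = 0" using integral_nonneg[OF \<omega>' bS(1)] by (metis order_le_less)
  then have "\<omega>' (x * b (Suc k)) = \<omega>' x" using extensionD(3)[OF \<omega>' x(1)] SL bS(1) by simp
  then show ?thesis using integral_nonneg[OF \<omega>' bS(2)] by metis
qed

text \<open>Equal centres on \<open>S\<close> give equal valuation rings, and these determine the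
  order of values on \<open>L\<close>; the uniqueness in \<open>extension_normal_form\<close> then
  identifies the two functions.\<close>

lemma extension_eqI:
  assumes \<omega>: "\<omega> \<in> E" and \<omega>': "\<omega>' \<in> E" and same: "\<And>x. x \<in> S \<Longrightarrow> 0 < \<omega> x \<longleftrightarrow> 0 < \<omega>' x"
  shows "\<omega> = \<omega>'"
proof -
  have ring: "0 \<le> \<omega> x \<longleftrightarrow> 0 \<le> \<omega>' x" if "x \<in> L" for x
    using nonneg_of_same_center[OF \<omega> \<omega>' same that] nonneg_of_same_center[OF \<omega>' \<omega> same[symmetric] that] by blast
  have le: "\<omega>' x \<le> \<omega>' y \<longleftrightarrow> \<omega> x \<le> \<omega> y" if "x \<in> L" "y \<in> L" for x y
  proof (cases "x = 0")
    case True
    then have "\<omega>' x = Pinf" "\<omega> x = Pinf" using extensionD(4) \<omega> \<omega>' that by blast+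
    then show ?thesis using extensionD(4)[OF \<omega> that(2)] extensionD(4)[OF \<omega>' that(2)] by simp
  next
    case False
    have "y / x \<in> L" using that L_closed by (simp add: divide_inverse)
    then show ?thesis
      using ring extension_divide(1)[OF \<omega> that(2,1) False] extension_divide(1)[OF \<omega>' that(2,1) False] by simp
  qed
  have "range to_ac \<subseteq> L" by auto
  moreover have "\<omega> (to_ac x) \<le> \<omega> (to_ac y) \<longleftrightarrow> v x \<le> v y" for x y
    by (simp add: extensionD(2)[OF \<omega>] hull_ext_le_iff)
  ultimately have "\<exists>!w'. w' \<in> E \<and> (\<forall>x\<in>L. \<forall>y\<in>L. w' x \<le> w' y \<longleftrightarrow> \<omega> x \<le> \<omega> y)"
    by (rule extension_normal_form[OF v L_subfield _ extensionD(1)[OF \<omega>]])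
  then show ?thesis using le \<omega> \<omega>' by blast
qed

lemma adjoin_ring_eq: "adjoin_ring R \<alpha> = ev ` RX"
  by (auto simp: adjoin_ring_def)

lemma adjoin_ring_subset: "adjoin_ring R \<alpha> \<subseteq> S"
  unfolding adjoin_ring_eq using integralI ev_nonneg by auto

end

locale factored_extension = simple_extension v res f \<alpha> L
  for v :: "'a::field \<Rightarrow> 'g::linordered_ab_group_add extended" and res :: "'a \<Rightarrow> 'r::field"
    and f \<alpha> L +
  fixes J :: "'i set" and \<phi> :: "'i \<Rightarrow> 'a poly" and l :: "'i \<Rightarrow> nat"
  assumes J_finite: "finite J"
    and factorization: "map_poly res f = (\<Prod>i\<in>J. map_poly res (\<phi> i) ^ l i)"
    and distinct: "inj_on (\<lambda>i. map_poly res (\<phi> i)) J"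
    and irr: "\<And>i. i \<in> J \<Longrightarrow> Factorial_Ring.irreducible (map_poly res (\<phi> i))"
    and l_pos: "\<And>i. i \<in> J \<Longrightarrow> 1 \<le> l i"
    and \<phi>_RX: "\<And>i. i \<in> J \<Longrightarrow> \<phi> i \<in> polys_over (val_ring v)"
    and \<phi>_monic: "\<And>i. i \<in> J \<Longrightarrow> Polynomial.lead_coeff (\<phi> i) = 1"
begin

lemma prime: "i \<in> J \<Longrightarrow> prime_elem (rp (\<phi> i))"
  using irreducible_imp_prime_elem_field_poly irr by blast

lemma dvd_index:
  assumes "i \<in> J" "j \<in> J" "rp (\<phi> i) dvd rp (\<phi> j)"
  shows "i = j"
  using monic_irreducible_dvd_eq[OF irr irr _ _ assms(3)] assms distinct \<phi>_monic lead_coeff_rp(2)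
  by (auto simp: inj_on_def)

lemma factor_dvd: "i \<in> J \<Longrightarrow> rp (\<phi> i) dvd rp f"
  unfolding factorization using J_finite l_pos[of i]
  by (intro dvd_trans[OF _ dvd_prodI[of J i]] dvd_power) auto

lemma over_exists:
  assumes "i \<in> J"
  obtains \<omega> where "\<omega> \<in> E" "0 < \<omega> (ev (\<phi> i))"
  using center_exists[OF irr \<phi>_RX factor_dvd] assms by blast

lemma over_unique:
  assumes "\<omega> \<in> E" "i \<in> J" "0 < \<omega> (ev (\<phi> i))" "j \<in> J" "0 < \<omega> (ev (\<phi> j))"
  shows "i = j"
  using center_iff_dvd[OF assms(1) irr \<phi>_RX assms(3) \<phi>_RX[OF assms(4)]] assms dvd_index by blast

text \<open>The product of all \<open>\<phi> i ^ l i\<close> agrees with \<open>f\<close> modulo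
  \<open>M\<close> and \<open>f\<close> vanishes at \<alpha>, so the product has positive value at
  \<alpha>, which is impossible if all factors have value 0.\<close>

lemma over_some:
  assumes "\<omega> \<in> E"
  obtains i where "i \<in> J" "0 < \<omega> (ev (\<phi> i))"
proof -
  note D = proper_ideal_ofD[OF extension_proper_ideal[OF assms]]
  define P where "P = (\<Prod>i\<in>J. \<phi> i ^ l i)"
  have P: "P \<in> RX" unfolding P_def using \<phi>_RX by (intro RX_prod RX_power) auto
  have "rp (P - f) = 0"
    using P f_RX \<phi>_RX by (simp add: rp_diff factorization) (simp add: P_def rp_prod rp_power RX_power)
  then have "P - f \<in> MX" using rp_eq_0_iff[of "P - f"] P f_RX RX_diff by blast
  then have "0 < \<omega> (ev (P - f))" by (rule ev_MX_pos[OF assms])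
  then have pos: "0 < \<omega> (\<Prod>i\<in>J. ev (\<phi> i) ^ l i)" by (simp add: f_root P_def eval_ac_prod)
  have "\<exists>i\<in>J. 0 < \<omega> (ev (\<phi> i))"
  proof (rule ccontr)
    assume no: "\<not> ?thesis"
    have "\<omega> (\<Prod>i\<in>T. ev (\<phi> i) ^ l i) = 0" if "T \<subseteq> J" for T
      using finite_subset[OF that J_finite] that
    proof (induction T)
      case empty
      then show ?case using extensionD(6)[OF assms] by simp
    next
      case (insert i T)
      have "\<omega> (ev (\<phi> i)) = 0"
        using no insert.prems ev_nonneg[OF assms \<phi>_RX[of i]] by (auto simp: order_le_less)
      moreover have "(\<Prod>i\<in>T. ev (\<phi> i) ^ l i) \<in> L"
        using ev_in_L[of "\<Prod>i\<in>T. \<phi> i ^ l i"] by (simp add: eval_ac_prod)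
      ultimately show ?case
        using insert extensionD(3,7)[OF assms] L_closed(7) by simp
    qed
    then show False using pos by auto
  qed
  then show ?thesis using that by blast
qed

lemma pos_valuesI: "c \<in> M \<Longrightarrow> v c = Fin g \<Longrightarrow> g \<in> pos_values v"
  using v_inf_iff[of c] by (auto simp: pos_values_def value_group_def max_ideal_def zero_extended_def)

text \<open>
  Write an element of \<open>S\<close> outside \<open>R[\<alpha>]\<close> as \<open>\<rho> u(\<alpha>)\<close> with \<open>\<rho>\<close> outside \<open>R\<close> and \<open>u\<close> primitive of degree
  less than that of \<open>f\<close>.  Some \<open>\<phi>\<^sub>i\<close> then divides the reduction of \<open>u\<close> to an order \<open>a < l\<^sub>i\<close>, and the
  value of \<open>u(\<alpha>)\<close> over \<open>\<phi>\<^sub>i\<close> is \<open>a\<close> times that of \<open>\<phi>\<^sub>i(\<alpha>)\<close>, too small to compensate \<open>\<rho>\<close>.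
\<close>

theorem integrally_closedI:
  assumes ram: "\<And>i. i \<in> J \<Longrightarrow> 2 \<le> l i \<Longrightarrow> \<exists>m. m \<in> pos_values v \<and> (\<forall>g\<in>pos_values v. m \<le> g) \<and>
      (\<forall>\<omega>\<in>E. 0 < \<omega> (ev (\<phi> i)) \<longrightarrow> nmul (l i) (\<omega> (ev (\<phi> i))) = Fin (to_hull m))"
  shows "adjoin_ring R \<alpha> = S"
proof (rule antisym[OF adjoin_ring_subset], rule subsetI)
  fix x assume xS: "x \<in> S"
  then have "x \<in> L" by (simp add: integral_closure_in_def)
  then obtain p where p: "x = ev p" by (auto simp: L_range)
  \<comment> \<open>The remainder represents \<open>x\<close> in degree below that of
    \<open>f\<close>, so it suffices to show that its coefficients lie in \<open>R\<close>.\<close>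
  define g where "g = p mod f"
  have f0: "f \<noteq> 0" using f_monic by auto
  have "x = ev (p div f * f + g)" by (simp add: p g_def)
  then have xg: "x = ev g" using f_root by (simp only: eval_ac_add eval_ac_mult) simp
  have deg: "g = 0 \<or> Polynomial.degree g < Polynomial.degree f"
    unfolding g_def using degree_mod_less[OF f0] by blast
  have "g \<in> RX"
  proof (rule ccontr)
    assume gR: "g \<notin> RX"
    then have "g \<noteq> 0" using RX_0 by auto
    then obtain j u where u: "Polynomial.coeff g j \<noteq> 0" "u \<in> RX" "rp u \<noteq> 0"
      "g = Polynomial.smult (Polynomial.coeff g j) u"
      using primitive_part by metis
    define \<rho> where "\<rho> = Polynomial.coeff g j"
    have gu: "g = Polynomial.smult \<rho> u" using u(4) by (simp add: \<rho>_def)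
    then have "\<rho> \<notin> R" using gR RX_smult u(2) by auto
    then have \<rho>: "inverse \<rho> \<in> M" "\<rho> \<noteq> 0" by (auto simp: notin_R_iff)
    have "Polynomial.degree (rp u) < Polynomial.degree (rp f)"
      using deg \<open>g \<noteq> 0\<close> degree_rp_le[of u] \<rho>(2) gu lead_coeff_rp(1)[OF f_monic] by auto
    then have "\<not> rp f dvd rp u" using u(3) dvd_imp_degree_le[of "rp f" "rp u"] by auto
    then have "\<exists>i\<in>J. \<not> rp (\<phi> i) ^ l i dvd rp u"
      using prime_powers_prod_dvd[of J "\<lambda>i. rp (\<phi> i)" l "rp u"] J_finite prime dvd_index
      unfolding factorization by blast
    then obtain i where i: "i \<in> J" "\<not> rp (\<phi> i) ^ l i dvd rp u" by blast
    obtain \<omega> where \<omega>: "\<omega> \<in> E" "0 < \<omega> (ev (\<phi> i))" using over_exists[OF i(1)] .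
    \<comment> \<open>This contradicts integrality of \<open>x\<close>, because
      \<open>u(\<alpha>) = x / \<rho>\<close> and \<omega> is nonnegative at
      \<open>x\<close>.\<close>
    have "\<omega> (ev u) < hull_ext (v (inverse \<rho>))"
    proof (cases "2 \<le> l i")
      case False
      \<comment> \<open>A simple factor does not divide the reduction of \<open>u\<close> at all, so
        \<open>u(\<alpha>)\<close> is a unit at \<omega>, and \<open>1 / \<rho> \<in> M\<close> is
        enough.\<close>
      then have "l i = 1" using l_pos[OF i(1)] by simp
      then have "\<not> 0 < \<omega> (ev u)" using i center_iff_dvd[OF \<omega>(1) irr \<phi>_RX \<omega>(2) u(2)] by simp
      moreover have "0 < hull_ext (v (inverse \<rho>))" using \<rho>(1) by (simp add: max_ideal_def)
      ultimately show ?thesis by (rule le_less_trans[OF leI])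
    next
      case True
      then obtain m where m: "\<And>g. g \<in> pos_values v \<Longrightarrow> m \<le> g"
        "nmul (l i) (\<omega> (ev (\<phi> i))) = Fin (to_hull m)"
        using ram[OF i(1)] \<omega> by blast
      have M_ge: "Fin (to_hull m) \<le> hull_ext (v c)" if "c \<in> M" for c
      proof (cases "c = 0")
        case False
        then obtain g where "v c = Fin g" using v_fin by blast
        then show ?thesis using m(1) pos_valuesI[OF that] by simp
      qed (use v_inf_iff[of 0] in simp)
      define n where "n = (LEAST n. \<not> rp (\<phi> i) ^ n dvd rp u)"
      have n: "\<not> rp (\<phi> i) ^ n dvd rp u" "n \<le> l i"
        unfolding n_def using i(2) by (rule LeastI, rule Least_le)
      then obtain a where a: "n = Suc a" by (cases n) auto
      then have "rp (\<phi> i) ^ a dvd rp u" using not_less_Least[of a "\<lambda>n. \<not> rp (\<phi> i) ^ n dvd rp u"] n_def by auto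
      then obtain h where h: "rp u = rp (\<phi> i) ^ a * h" by (elim dvdE)
      then have hnd: "\<not> rp (\<phi> i) dvd h" using n(1) a mult_dvd_mono[of "rp (\<phi> i) ^ a" "rp (\<phi> i) ^ a" "rp (\<phi> i)" h]
        by (auto simp: mult.commute)
      obtain h' where h': "h' \<in> RX" "rp h' = h" by (rule rp_surj)
      \<comment> \<open>A model of \<open>u\<close> with the same reduction and a known value at
        \<alpha>. The error \<open>u - q\<close> has coefficients in \<open>M\<close>, so its value
        is at least \<open>m\<close>, too large to alter that of \<open>q\<close>.\<close>
      define q where "q = \<phi> i ^ a * h'"
      have q: "q \<in> RX" "rp q = rp u"
        using h h' \<phi>_RX[OF i(1)] by (simp_all add: q_def RX_mult RX_power rp_mult rp_power)
      have uq: "u - q \<in> MX" using rp_eq_0_iff[of "u - q"] q u(2) by (simp add: rp_diff RX_diff)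
      have "\<omega> (ev h') = 0"
        using center_iff_dvd[OF \<omega>(1) irr[OF i(1)] \<phi>_RX[OF i(1)] \<omega>(2) h'(1)] hnd h'(2)
          ev_nonneg[OF \<omega>(1) h'(1)] by (auto simp: order_le_less)
      then have \<omega>q: "\<omega> (ev q) = nmul a (\<omega> (ev (\<phi> i)))"
        using extensionD(3,7)[OF \<omega>(1)] L_closed(7) by (simp add: q_def)
      obtain \<gamma> where \<gamma>: "\<omega> (ev (\<phi> i)) = Fin \<gamma>"
        using m(2) True extensionD(5)[OF \<omega>(1) ev_in_L, of "\<phi> i"]
        by (cases "\<omega> (ev (\<phi> i))") (auto simp: nmul_Pinf)
      have "\<gamma> > 0" using \<omega>(2) \<gamma> by (simp add: zero_extended_def)
      then have "nmul a \<gamma> < nmul (l i) \<gamma>" using n(2) a by (intro nmul_less_nmul) auto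
      then have lt: "\<omega> (ev q) < Fin (to_hull m)" using m(2) \<gamma> \<omega>q by (simp add: nmul_Fin)
      have "Fin (to_hull m) \<le> \<omega> (ev (u - q))"
      proof (cases "u - q = 0")
        case True
        then show ?thesis using extensionD(4)[OF \<omega>(1) L_closed(5)] by simp
      next
        case False
        then obtain c where "c \<in> M" "hull_ext (v c) \<le> \<omega> (ev (u - q))" using ev_MX_ge[OF \<omega>(1) uq] by blast
        then show ?thesis using M_ge order_trans by blast
      qed
      then have "\<omega> (ev q + ev (u - q)) = \<omega> (ev q)"
        using lt by (intro valuation_on_add_eq[OF extensionD(1)[OF \<omega>(1)] L_subfield ev_in_L ev_in_L]) (rule less_le_trans)
      then have "\<omega> (ev u) < Fin (to_hull m)" using lt by simp
      then show ?thesis using M_ge[OF \<rho>(1)] by simp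
    qed
    moreover have "ev u = to_ac (inverse \<rho>) * x" using \<rho>(2) by (simp add: xg gu)
    then have "\<omega> (ev u) = hull_ext (v (inverse \<rho>)) + \<omega> x"
      using extensionD(2,3)[OF \<omega>(1)] \<open>x \<in> L\<close> to_ac_in_L by metis
    ultimately show False
      using integral_nonneg[OF \<omega>(1) xS] add_mono[of "hull_ext (v (inverse \<rho>))" "hull_ext (v (inverse \<rho>))" 0 "\<omega> x"] by simp
  qed
  then show "x \<in> adjoin_ring R \<alpha>" using xg by (auto simp: adjoin_ring_eq)
qed

text \<open>When \<open>S\<close> is \<open>R[\<alpha>]\<close>, the centre on \<open>S\<close> of
  any extension over \<open>\<phi> i\<close> is described by divisibility by
  \<open>rp (\<phi> i)\<close> alone.\<close>

lemma extension_unique: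
  assumes closed: "adjoin_ring R \<alpha> = S" and "i \<in> J"
    and \<omega>: "\<omega> \<in> E" "0 < \<omega> (ev (\<phi> i))" and \<omega>': "\<omega>' \<in> E" "0 < \<omega>' (ev (\<phi> i))"
  shows "\<omega> = \<omega>'"
proof (rule extension_eqI[OF \<omega>(1) \<omega>'(1)])
  fix x assume "x \<in> S"
  then obtain p where p: "p \<in> RX" "x = ev p" using closed by (auto simp: adjoin_ring_eq)
  show "0 < \<omega> x \<longleftrightarrow> 0 < \<omega>' x"
    using center_iff_dvd[OF \<omega>(1) irr \<phi>_RX \<omega>(2) p(1)] center_iff_dvd[OF \<omega>'(1) irr \<phi>_RX \<omega>'(2) p(1)]
      p(2) assms(2) by simp
qed

theorem extensions_card:
  assumes closed: "adjoin_ring R \<alpha> = S"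
  shows "finite E" "card E = card J"
proof -
  have "\<forall>i\<in>J. \<exists>\<omega>. \<omega> \<in> E \<and> 0 < \<omega> (ev (\<phi> i))" using over_exists by metis
  then obtain h where h: "\<And>i. i \<in> J \<Longrightarrow> h i \<in> E" "\<And>i. i \<in> J \<Longrightarrow> 0 < h i (ev (\<phi> i))" by metis
  have "inj_on h J" using h over_unique unfolding inj_on_def by metis
  moreover have "h ` J = E"
  proof
    show "E \<subseteq> h ` J"
    proof
      fix \<omega> assume \<omega>: "\<omega> \<in> E"
      obtain i where i: "i \<in> J" "0 < \<omega> (ev (\<phi> i))" using over_some[OF \<omega>] .
      then have "h i = \<omega>" using extension_unique[OF closed i(1) h(1,2) \<omega>] by blast
      then show "\<omega> \<in> h ` J" using i(1) by blast
    qed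
  qed (use h in auto)
  ultimately have "bij_betw h J E" by (simp add: bij_betw_def)
  then show "finite E" "card E = card J" using bij_betw_finite bij_betw_same_card J_finite by (blast, metis)
qed

end

section \<open>Ramified factors\<close>

context factored_extension
begin

text \<open>If every extension gave \<open>g(\<alpha>)\<close> at least the value of
  \<open>c\<close>, then \<open>g(\<alpha>) / c = b(\<alpha>)\<close> for some \<open>b\<close> over
  \<open>R\<close>, and \<open>f\<close> would divide \<open>g - c b\<close> with quotient over
  \<open>R\<close>. Modulo \<open>M\<close> the reduction of \<open>f\<close> would divide that of
  \<open>g\<close>, but reduction preserves the degrees of monic polynomials.\<close>

lemma monic_over_M_not_integral:
  assumes closed: "adjoin_ring R \<alpha> = S" and g: "g \<in> RX" "Polynomial.lead_coeff g = 1"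
    "Polynomial.degree g < Polynomial.degree f" and c: "c \<in> M" "c \<noteq> 0"
  obtains \<omega> where "\<omega> \<in> E" "\<omega> (ev g) < hull_ext (v c)"
proof -
  have False if no: "\<not> (\<exists>\<omega>\<in>E. \<omega> (ev g) < hull_ext (v c))"
  proof -
    have ge: "hull_ext (v c) \<le> \<omega> (ev g)" if "\<omega> \<in> E" for \<omega>
      using no that by (auto simp: not_less)
    have "ev g / to_ac c \<in> S"
    proof (rule integralI)
      show "ev g / to_ac c \<in> L" using L_closed by (simp add: divide_inverse)
      show "0 \<le> \<omega> (ev g / to_ac c)" if "\<omega> \<in> E" for \<omega>
        using ge[OF that] c(2) that by (simp add: extension_divide(1) extensionD(2))
    qed
    then obtain b where b: "b \<in> RX" "ev g / to_ac c = ev b" using closed by (auto simp: adjoin_ring_eq)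
    have "ev (g - Polynomial.smult c b) = 0" using b(2)[symmetric] c(2) by simp
    then have "f dvd g - Polynomial.smult c b" by (rule irreducible_dvd_of_common_root[OF f_irr f_root])
    then obtain q where q: "g - Polynomial.smult c b = f * q" by (elim dvdE)
    have cb: "Polynomial.smult c b \<in> MX" "Polynomial.smult c b \<in> RX"
      using MX_smult[OF c(1) b(1)] MX_RX by auto
    have "f * q \<in> RX" using q RX_diff[OF g(1) cb(2)] by simp
    then have qR: "q \<in> RX" using monic_dvd_in_RX f_RX f_monic by blast
    have "rp g = rp (f * q)"
      using rp_diff[OF g(1) cb(2)] rp_eq_0_iff[OF cb(2)] cb(1) q by simp
    then have "rp f dvd rp g" using rp_mult[OF f_RX qR] by simp
    moreover have "rp g \<noteq> 0" using lead_coeff_rp(2)[OF g(2)] by auto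
    ultimately have "Polynomial.degree (rp f) \<le> Polynomial.degree (rp g)" by (rule dvd_imp_degree_le)
    then show False using g(3) lead_coeff_rp(1)[OF f_monic] lead_coeff_rp(1)[OF g(2)] by simp
  qed
  then show ?thesis using that by blast
qed

theorem ramified_factor_value:
  assumes closed: "adjoin_ring R \<alpha> = S" and i: "i \<in> J" "2 \<le> l i"
    and \<omega>: "\<omega> \<in> E" "0 < \<omega> (ev (\<phi> i))"
  obtains m where "m \<in> pos_values v" "\<And>g. g \<in> pos_values v \<Longrightarrow> m \<le> g"
    "nmul (l i) (\<omega> (ev (\<phi> i))) = Fin (to_hull m)"
proof -
  note goal = that
  define k where "k = l i - 1"
  have k: "l i = Suc k" "0 < k" using i(2) by (auto simp: k_def)
  \<comment> \<open>All factors other than \<open>\<phi> i\<close>; their product is a unit at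
    \<omega>, so \<open>g(\<alpha>)\<close> has \<open>k\<close> times the value of
    \<open>\<phi> i(\<alpha>)\<close> there.\<close>
  define g0 where "g0 = (\<Prod>j\<in>J - {i}. \<phi> j ^ l j)"
  define g where "g = \<phi> i ^ k * g0"
  define r1 where "r1 = f - g * \<phi> i"
  have g0R: "g0 \<in> RX" unfolding g0_def using \<phi>_RX by (intro RX_prod RX_power) auto
  have gR: "g \<in> RX" "g * \<phi> i \<in> RX"
    using g0R \<phi>_RX[OF i(1)] by (auto simp: g_def intro: RX_mult RX_power)
  have "Polynomial.lead_coeff g0 = 1"
    unfolding g0_def using \<phi>_monic by (simp add: lead_coeff_prod lead_coeff_power)
  then have g_monic: "Polynomial.lead_coeff g = 1"
    using \<phi>_monic[OF i(1)] by (simp add: g_def lead_coeff_mult lead_coeff_power)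
  then have g\<phi>_monic: "Polynomial.lead_coeff (g * \<phi> i) = 1"
    using \<phi>_monic[OF i(1)] by (simp add: lead_coeff_mult)
  have rp_g0: "rp g0 = (\<Prod>j\<in>J - {i}. rp (\<phi> j) ^ l j)"
    unfolding g0_def using \<phi>_RX by (subst rp_prod) (auto simp: rp_power intro!: RX_power prod.cong)
  have "rp (g * \<phi> i) = rp f"
    using gR g0R \<phi>_RX[OF i(1)] J_finite i(1) k(1)
    by (simp add: g_def factorization rp_mult rp_power RX_mult RX_power rp_g0 prod.remove[of J i] mult_ac)
  then have r1M: "r1 \<in> MX"
    using rp_eq_0_iff[of r1] f_RX gR by (simp add: r1_def rp_diff RX_diff)
  have deg_eq: "Polynomial.degree (g * \<phi> i) = Polynomial.degree f"
    using lead_coeff_rp(1)[OF g\<phi>_monic] lead_coeff_rp(1)[OF f_monic] \<open>rp (g * \<phi> i) = rp f\<close> by simp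
  have \<phi>_deg: "0 < Polynomial.degree (\<phi> i)"
  proof (rule ccontr)
    assume "\<not> 0 < Polynomial.degree (\<phi> i)"
    then obtain a where "\<phi> i = [:a:]" using degree_eq_zeroE by blast
    then have "\<phi> i = 1" using \<phi>_monic[OF i(1)] by (simp add: one_pCons)
    then show False using irr[OF i(1)] by simp
  qed
  have nz: "g \<noteq> 0" "\<phi> i \<noteq> 0" using g_monic \<phi>_deg by auto
  have g_deg: "Polynomial.degree g < Polynomial.degree f"
    using deg_eq \<phi>_deg nz by (simp add: degree_mult_eq)
  have "\<not> \<phi> i dvd 1" using \<phi>_deg by (auto simp: is_unit_iff_degree nz)
  moreover have "\<phi> i dvd g" using k(2) by (simp add: g_def)
  ultimately have "\<not> g dvd 1" using dvd_trans by blast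
  \<comment> \<open>Since \<open>k > 0\<close>, both \<open>g\<close> and \<open>\<phi> i\<close>
    are nonunits, and \<open>f = g * \<phi> i\<close> would contradict irreducibility of
    \<open>f\<close>.\<close>
  have r1_nz: "r1 \<noteq> 0"
  proof
    assume "r1 = 0"
    then have "f = g * \<phi> i" by (simp add: r1_def)
    then show False using irreducibleD[OF f_irr] \<open>\<not> g dvd 1\<close> \<open>\<not> \<phi> i dvd 1\<close> by blast
  qed
  have "Polynomial.degree r1 < Polynomial.degree f"
  proof (rule le_neq_implies_less)
    show "Polynomial.degree r1 \<le> Polynomial.degree f"
      unfolding r1_def using deg_eq by (intro degree_diff_le) auto
    show "Polynomial.degree r1 \<noteq> Polynomial.degree f"
    proof
      assume "Polynomial.degree r1 = Polynomial.degree f"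
      then have "Polynomial.lead_coeff r1 = Polynomial.lead_coeff f - Polynomial.lead_coeff (g * \<phi> i)"
        using deg_eq by (simp add: r1_def)
      then have "Polynomial.lead_coeff r1 = 0" using f_monic g\<phi>_monic by simp
      then show False using r1_nz by simp
    qed
  qed
  then have ev_r1: "ev r1 \<noteq> 0"
    using irreducible_dvd_of_common_root[OF f_irr f_root, of r1] dvd_imp_degree_le[of f r1] r1_nz by auto
  have prod_eq: "ev g * ev (\<phi> i) = - ev r1" using f_root by (simp add: r1_def)
  have val_prod: "\<omega>' (ev g) + \<omega>' (ev (\<phi> i)) = \<omega>' (ev r1)" if "\<omega>' \<in> E" for \<omega>'
    using extensionD(3,8)[OF that] prod_eq ev_in_L by metis

  obtain j u where u: "Polynomial.coeff r1 j \<noteq> 0" "u \<in> RX" "r1 = Polynomial.smult (Polynomial.coeff r1 j) u"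
    using primitive_part[OF r1_nz] by metis
  define \<rho> where "\<rho> = Polynomial.coeff r1 j"
  have \<rho>: "\<rho> \<in> M" "\<rho> \<noteq> 0" using r1M u(1) by (auto simp: \<rho>_def polys_over_def)
  have val_r1: "\<omega>' (ev r1) = hull_ext (v \<rho>) + \<omega>' (ev u)" if "\<omega>' \<in> E" for \<omega>'
  proof -
    have "ev r1 = to_ac \<rho> * ev u" by (subst u(3)) (simp add: \<rho>_def)
    then show ?thesis using extensionD(2,3)[OF that] by simp
  qed
  obtain r where r: "v \<rho> = Fin r" using v_fin[OF \<rho>(2)] by blast

  have "ev (\<phi> i) \<noteq> 0" using prod_eq ev_r1 by auto
  then obtain \<gamma> where \<gamma>: "\<omega> (ev (\<phi> i)) = Fin \<gamma>"
    using extensionD(4,5)[OF \<omega>(1) ev_in_L, of "\<phi> i"] by (cases "\<omega> (ev (\<phi> i))") auto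
  have \<gamma>_pos: "0 < \<gamma>" using \<gamma> \<omega>(2) by (simp add: zero_extended_def)
  have "\<not> rp (\<phi> i) dvd rp g0"
  proof
    assume "rp (\<phi> i) dvd rp g0"
    then obtain j where "j \<in> J - {i}" "rp (\<phi> i) dvd rp (\<phi> j) ^ l j"
      unfolding rp_g0 by (rule prime_elem_dvd_prodE[OF prime[OF i(1)]])
    then show False using dvd_index[OF i(1), of j] prime_elem_dvd_power[OF prime[OF i(1)]] by blast
  qed
  then have "\<omega> (ev g0) = 0"
    using center_iff_dvd[OF \<omega>(1) irr[OF i(1)] \<phi>_RX[OF i(1)] \<omega>(2) g0R] ev_nonneg[OF \<omega>(1) g0R]
    by (auto simp: order_le_less)
  then have val_g: "\<omega> (ev g) = Fin (nmul k \<gamma>)"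
    using extensionD(3,7)[OF \<omega>(1)] L_closed(7) \<gamma> by (simp add: g_def nmul_Fin)
  \<comment> \<open>Uniqueness over \<open>\<phi> i\<close> makes \<open>\<phi> i(\<alpha>)\<close>
    a unit at every other extension, so there \<open>g(\<alpha>)\<close> carries the whole value of
    \<open>r1(\<alpha>)\<close>.\<close>
  have other: "hull_ext (v \<rho>) \<le> \<omega>' (ev g)" if "\<omega>' \<in> E" "\<omega>' \<noteq> \<omega>" for \<omega>'
  proof -
    have "\<omega>' (ev (\<phi> i)) = 0"
      using extension_unique[OF closed i(1) \<omega> that(1)] that(2) ev_nonneg[OF that(1) \<phi>_RX[OF i(1)]]
      by (auto simp: order_le_less)
    then have "\<omega>' (ev g) = hull_ext (v \<rho>) + \<omega>' (ev u)" using val_prod[OF that(1)] val_r1[OF that(1)] by simp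
    then show ?thesis
      using ev_nonneg[OF that(1) u(2)] add_mono[of "hull_ext (v \<rho>)" _ 0 "\<omega>' (ev u)"] by simp
  qed

  txt \<open>
    Only \<open>\<omega>\<close> can prevent \<open>g(\<alpha>) / c\<close> from being integral when \<open>v c \<le> v \<rho>\<close>, so every element of \<open>M\<close>
    has value greater than \<open>(l\<^sub>i - 1) \<gamma>\<close>; as \<open>l\<^sub>i \<ge> 2\<close>, this bound is at least \<open>\<gamma>\<close>.
  \<close>
  have small: "Fin (nmul k \<gamma>) < hull_ext (v c)" if c: "c \<in> M" "c \<noteq> 0" "v c \<le> v \<rho>" for c
  proof -
    obtain \<omega>' where \<omega>': "\<omega>' \<in> E" "\<omega>' (ev g) < hull_ext (v c)"
      using monic_over_M_not_integral[OF closed gR(1) g_monic g_deg c(1,2)] .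
    have "hull_ext (v c) \<le> hull_ext (v \<rho>)" using c(3) by (simp add: hull_ext_le_iff)
    then have "\<omega>' = \<omega>" using other[OF \<omega>'(1)] \<omega>'(2) by fastforce
    then show ?thesis using \<omega>'(2) val_g by simp
  qed
  \<comment> \<open>Elements of larger value than \<rho> inherit the bound from \<rho>
    itself.\<close>
  have step1: "nmul k \<gamma> < to_hull h" if c: "c \<in> M" "v c = Fin h" for c h
  proof -
    have c0: "c \<noteq> 0" using c(2) v_inf_iff[of c] by auto
    have "Fin (nmul k \<gamma>) < hull_ext (v c)"
    proof (cases "v c \<le> v \<rho>")
      case False
      then have "hull_ext (v \<rho>) \<le> hull_ext (v c)" by (simp add: hull_ext_le_iff)
      then show ?thesis using small[OF \<rho>] by (meson less_le_trans order_refl)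
    qed (use small c0 c in blast)
    then show ?thesis using c(2) by simp
  qed
  have \<gamma>_le: "\<gamma> \<le> nmul k \<gamma>"
    using nmul_less_nmul[of 1 k \<gamma>] \<gamma>_pos k(2) by (cases "k = 1") auto

  have step2: "nmul (l i) \<gamma> = to_hull r"
  proof -
    have eq: "Fin (nmul (l i) \<gamma>) = Fin (to_hull r) + \<omega> (ev u)"
      using val_prod[OF \<omega>(1)] val_r1[OF \<omega>(1)] by (simp add: \<gamma> val_g r k(1) add.commute)
    \<comment> \<open>Otherwise \<open>u = \<phi> i * b' + d\<close> with \<open>d\<close> over
      \<open>M\<close>. Both parts have value at least \<gamma> at \<alpha>, the second by
      \<open>step1\<close>, so \<open>r + \<gamma> \<le> (k + 1) \<gamma>\<close>, against
      \<open>step1\<close> for \<rho>.\<close>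
    have "\<not> 0 < \<omega> (ev u)"
    proof
      assume "0 < \<omega> (ev u)"
      then have "rp (\<phi> i) dvd rp u"
        using center_iff_dvd[OF \<omega>(1) irr[OF i(1)] \<phi>_RX[OF i(1)] \<omega>(2) u(2)] by simp
      then obtain b where b: "rp u = rp (\<phi> i) * b" by (elim dvdE)
      obtain b' where b': "b' \<in> RX" "rp b' = b" by (rule rp_surj)
      define d where "d = u - \<phi> i * b'"
      have dM: "d \<in> MX"
        using rp_eq_0_iff[of d] b b' u(2) \<phi>_RX[OF i(1)] by (simp add: d_def rp_diff rp_mult RX_diff RX_mult)
      have 1: "Fin \<gamma> \<le> \<omega> (ev d)"
      proof (cases "d = 0")
        case True
        then show ?thesis using extensionD(4)[OF \<omega>(1) L_closed(5)] by simp
      next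
        case False
        then obtain c where c: "c \<in> M" "c \<noteq> 0" "hull_ext (v c) \<le> \<omega> (ev d)"
          using ev_MX_ge[OF \<omega>(1) dM] by blast
        obtain h where h: "v c = Fin h" using v_fin[OF c(2)] by blast
        then have "\<gamma> \<le> to_hull h" using step1[OF c(1) h] \<gamma>_le by simp
        then have "Fin \<gamma> \<le> hull_ext (v c)" using h by simp
        then show ?thesis using c(3) by (rule order_trans)
      qed
      have 2: "Fin \<gamma> \<le> \<omega> (ev (\<phi> i) * ev b')"
        using ev_nonneg[OF \<omega>(1) b'(1)] extensionD(3)[OF \<omega>(1)] \<gamma>
          add_mono[of "Fin \<gamma>" "Fin \<gamma>" 0 "\<omega> (ev b')"] by simp
      have "min (\<omega> (ev d)) (\<omega> (ev (\<phi> i) * ev b')) \<le> \<omega> (ev d + ev (\<phi> i) * ev b')"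
        using extensionD(1)[OF \<omega>(1)] L_closed(2)[OF ev_in_L ev_in_L] ev_in_L unfolding valuation_on_def by blast
      then have "Fin \<gamma> \<le> \<omega> (ev u)" using 1 2 by (simp add: d_def min_def split: if_splits)
      then have "Fin (to_hull r) + Fin \<gamma> \<le> Fin (nmul (l i) \<gamma>)"
        unfolding eq by (intro add_mono) auto
      then have "to_hull r \<le> nmul k \<gamma>" by (simp add: k(1) add.commute)
      then show False using step1[OF \<rho>(1) r] by simp
    qed
    then have "\<omega> (ev u) = 0" using ev_nonneg[OF \<omega>(1) u(2)] by (auto simp: order_le_less)
    then show ?thesis using eq by simp
  qed

  \<comment> \<open>If \<open>h < r\<close>, then \<open>\<rho> / c\<close> lies in \<open>M\<close>
    as well, and \<open>step1\<close> applies to its value \<open>e\<close>: from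
    \<open>e + h = r = (k + 1) \<gamma>\<close> and \<open>e > k \<gamma>\<close> follows
    \<open>h < \<gamma>\<close>, while \<open>step1\<close> for \<open>c\<close> gives
    \<open>h > k \<gamma> \<ge> \<gamma>\<close>.\<close>
  have step3: "r \<le> h" if c: "c \<in> M" "v c = Fin h" for c h
  proof (rule ccontr)
    assume "\<not> r \<le> h"
    then have "v c < v \<rho>" using c r by simp
    moreover have c0: "c \<noteq> 0" using c(2) v_inf_iff[of c] by auto
    ultimately have "\<rho> / c \<in> M" by (simp add: divide_in_M)
    moreover have "v \<rho> = v (\<rho> / c) + v c" using v_mult[of "\<rho> / c" c] c0 by simp
    then obtain e where e: "v (\<rho> / c) = Fin e" "r = e + h"
      using r c(2) v_fin[of "\<rho> / c"] c0 \<rho>(2) by auto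
    ultimately have "nmul k \<gamma> < to_hull e" using step1 by blast
    then have "nmul k \<gamma> + to_hull h < \<gamma> + nmul k \<gamma>"
      using step2 e(2) by (simp add: to_hull_add k(1))
    then have "to_hull h < \<gamma>" by (simp add: add.commute)
    then show False using step1[OF c] \<gamma>_le by simp
  qed
  show ?thesis
  proof (rule goal[of r])
    show "r \<in> pos_values v" using pos_valuesI[OF \<rho>(1) r] .
    show "r \<le> h" if "h \<in> pos_values v" for h
      using that step3 by (auto simp: pos_values_def value_group_def max_ideal_def zero_extended_def)
    show "nmul (l i) (\<omega> (ev (\<phi> i))) = Fin (to_hull r)" using step2 \<gamma> by (simp add: nmul_Fin)
  qed
qed

end

theorem theorem2p10:
  fixes v :: "'a::field \<Rightarrow> 'g::linordered_ab_group_add extended"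
    and res :: "'a \<Rightarrow> 'r::field"
    and f :: "'a poly"
    and \<alpha> :: "'a alg_closure"
    and L :: "'a alg_closure set"
    and s :: nat
    and \<phi>bar :: "nat \<Rightarrow> 'r poly"
    and \<phi> :: "nat \<Rightarrow> 'a poly"
    and l :: "nat \<Rightarrow> nat"
    and I :: "nat set"
  assumes "valuation_on UNIV v"
    and "residue_map v res"
    and "f \<in> polys_over (val_ring v)"
    and "Polynomial.lead_coeff f = 1"
    and "Factorial_Ring.irreducible f"
    and "separable_poly f"
    and "eval_ac f \<alpha> = 0"
    and "L = adjoin_field \<alpha>"
    and "map_poly res f = (\<Prod>i=1..s. \<phi>bar i ^ l i)"
    and "inj_on \<phi>bar {1..s}"
    and "\<And>i. i \<in> {1..s} \<Longrightarrow> Polynomial.lead_coeff (\<phi>bar i) = 1"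
    and "\<And>i. i \<in> {1..s} \<Longrightarrow> Factorial_Ring.irreducible (\<phi>bar i)"
    and "\<And>i. i \<in> {1..s} \<Longrightarrow> 1 \<le> l i"
    and "\<And>i. i \<in> {1..s} \<Longrightarrow> \<phi> i \<in> polys_over (val_ring v)"
    and "\<And>i. i \<in> {1..s} \<Longrightarrow> Polynomial.lead_coeff (\<phi> i) = 1"
    and "\<And>i. i \<in> {1..s} \<Longrightarrow> map_poly res (\<phi> i) = \<phi>bar i"
    and "I = {i \<in> {1..s}. 2 \<le> l i}"
  shows "adjoin_ring (val_ring v) \<alpha> = integral_closure_in (val_ring v) L \<longleftrightarrow>
    (finite (val_extensions v L) \<and> card (val_extensions v L) = s \<and>
     (I \<noteq> {} \<longrightarrow>
       (\<exists>m. m \<in> pos_values v \<and> (\<forall>g \<in> pos_values v. m \<le> g) \<and>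
         (\<forall>i \<in> I. \<forall>\<omega> \<in> val_extensions v L.
            0 < \<omega> (eval_ac (\<phi> i) \<alpha>) \<longrightarrow>
            nmul (l i) (\<omega> (eval_ac (\<phi> i) \<alpha>)) = Fin (to_hull m)))))"
proof -
  interpret factored_extension v res f \<alpha> L "{1..s}" \<phi> l
  proof
    show "map_poly res f = (\<Prod>i\<in>{1..s}. map_poly res (\<phi> i) ^ l i)"
      using assms(9,16) by simp
    show "inj_on (\<lambda>i. map_poly res (\<phi> i)) {1..s}"
      using assms(10) by (subst inj_on_cong[where g = \<phi>bar]) (use assms(16) in auto)
    show "Factorial_Ring.irreducible (map_poly res (\<phi> i))" if "i \<in> {1..s}" for i
      using assms(12)[OF that] assms(16)[OF that] by simp
  qed (use assms in auto)
  show ?thesis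
  proof
    assume closed: "adjoin_ring R \<alpha> = S"
    have "\<exists>m. m \<in> pos_values v \<and> (\<forall>g \<in> pos_values v. m \<le> g) \<and>
         (\<forall>i \<in> I. \<forall>\<omega> \<in> E. 0 < \<omega> (ev (\<phi> i)) \<longrightarrow> nmul (l i) (\<omega> (ev (\<phi> i))) = Fin (to_hull m))"
      if nonempty: "I \<noteq> {}"
    proof -
      \<comment> \<open>The minimum is read off from one ramified factor, together with an extension
        over it.\<close>
      obtain i where i: "i \<in> I" using nonempty by blast
      then obtain \<omega> where "\<omega> \<in> E" "0 < \<omega> (ev (\<phi> i))" using over_exists[of i] assms(17) by auto
      then obtain m where m: "m \<in> pos_values v" "\<And>g. g \<in> pos_values v \<Longrightarrow> m \<le> g"
        using ramified_factor_value[OF closed] i assms(17) by blast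
      have "nmul (l i) (\<omega> (ev (\<phi> i))) = Fin (to_hull m)"
        if ram: "i \<in> {1..s}" "2 \<le> l i" "\<omega> \<in> E" "0 < \<omega> (ev (\<phi> i))" for i \<omega>
      proof -
        obtain m' where m': "m' \<in> pos_values v" "\<And>g. g \<in> pos_values v \<Longrightarrow> m' \<le> g"
          "nmul (l i) (\<omega> (ev (\<phi> i))) = Fin (to_hull m')"
          using ramified_factor_value[OF closed ram] by blast
        \<comment> \<open>Each ramified factor yields a least positive value; uniqueness of the
          minimum lets a single \<open>m\<close> serve all factors, as the order of the quantifiers
          demands.\<close>
        have "m' = m" using m m'(1,2) by (auto intro: antisym)
        then show ?thesis using m'(3) by simp
      qed
      then show ?thesis using m assms(17) by blast
    qed
    then show "finite E \<and> card E = s \<and> (I \<noteq> {} \<longrightarrow> (\<exists>m. m \<in> pos_values v \<and> (\<forall>g \<in> pos_values v. m \<le> g) \<and>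
         (\<forall>i \<in> I. \<forall>\<omega> \<in> E. 0 < \<omega> (ev (\<phi> i)) \<longrightarrow> nmul (l i) (\<omega> (ev (\<phi> i))) = Fin (to_hull m))))"
      using extensions_card[OF closed] by simp
  next
    assume ii: "finite E \<and> card E = s \<and> (I \<noteq> {} \<longrightarrow> (\<exists>m. m \<in> pos_values v \<and> (\<forall>g \<in> pos_values v. m \<le> g) \<and>
         (\<forall>i \<in> I. \<forall>\<omega> \<in> E. 0 < \<omega> (ev (\<phi> i)) \<longrightarrow> nmul (l i) (\<omega> (ev (\<phi> i))) = Fin (to_hull m))))"
    show "adjoin_ring R \<alpha> = S"
    proof (rule integrally_closedI)
      fix i assume "i \<in> {1..s}" "2 \<le> l i"
      then have "i \<in> I" using assms(17) by simp
      then show "\<exists>m. m \<in> pos_values v \<and> (\<forall>g\<in>pos_values v. m \<le> g) \<and>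
        (\<forall>\<omega>\<in>E. 0 < \<omega> (ev (\<phi> i)) \<longrightarrow> nmul (l i) (\<omega> (ev (\<phi> i))) = Fin (to_hull m))"
        using ii by blast
    qed
  qed
qed

end
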